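(* Let $k$ be an infinite field, $H$ a Hopf algebra over $k$, and $\alpha:H\times H\to k$ a normalized convolution-invertible two-cocycle. If $\alpha$ is nondegenerate, i.e., if the center of ${}^{\alpha}H$ equals $k1$, then both $\mu_\alpha$ and $\mu_\sigma$ map the center $\mathcal Z_H^{\alpha}$ of $\mathcal U_H^{\alpha}$ into $\mathcal B_H^{\alpha}\otimes1$.
   Context: All algebras are associative unital $k$-algebras; unadorned tensor products are over $k$; $\Delta$, $\varepsilon$ are the comultiplication and counit of $H$, with Sweedler notation. An $H$-comodule algebra is an algebra with a right $H$-coaction that is an algebra morphism; morphisms are algebra morphisms that are comodule maps. Cocycles and twisted algebras: let $R$ be a commutative algebra. A two-cocycle with values in $R$ is a bilinear map $\alpha:H\times H\to R$ with $\sum\alpha(x_{(1)},y_{(1)})\alpha(x_{(2)}y_{(2)},z)=\sum\alpha(y_{(1)},z_{(1)})\alpha(x,y_{(2)}z_{(2)})$ for all $x,y,z\in H$; it is normalized if $\alpha(x,1)=\alpha(1,x)=\varepsilon(x)1$, and convolution-invertible if it is invertible for convolution in $\operatorname{Hom}(H\otimes H,R)$. The twisted algebra $R\otimes{}^{\alpha}H$ is $R\otimes H$ with product $(b\otimes x)\cdot_\alpha(c\otimes y)=\sum bc\,\alpha(x_{(1)},y_{(1)})\otimes x_{(2)}y_{(2)}$ and coaction $\mathrm{id}_R\otimes\Delta$. For $R=k$ write ${}^{\alpha}H=k\otimes{}^{\alpha}H$. Universal cocycle: let $t_H$ be a copy of the vector space $H$ (with identity map $h\mapsto t_h$), $S(t_H)$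 its symmetric algebra, $K_H$ the field of fractions of $S(t_H)$. Let $t^{-1}:H\to K_H$, $h\mapsto t_h^{-1}$, be the unique linear map with $\sum t_{h_{(1)}}t^{-1}_{h_{(2)}}=\sum t^{-1}_{h_{(1)}}t_{h_{(2)}}=\varepsilon(h)1$ for all $h\in H$ (it exists; note that $t^{-1}_h$ is in general not $1/t_h$). $S(t_H)_{\Theta}$ is the subalgebra of $K_H$ generated by all $t_h$ and $t_h^{-1}$, $h\in H$. Define $\sigma:H\times H\to S(t_H)_{\Theta}$ by $\sigma(x,y)=\sum t_{x_{(1)}}t_{y_{(1)}}\alpha(x_{(2)},y_{(2)})t^{-1}_{x_{(3)}y_{(3)}}$; it is a convolution-invertible two-cocycle with convolution inverse $\sigma^{-1}(x,y)=\sum t_{x_{(1)}y_{(1)}}\alpha^{-1}(x_{(2)},y_{(2)})t^{-1}_{x_{(3)}}t^{-1}_{y_{(3)}}$. $\mathcal B_H^{\alpha}\subset S(t_H)_{\Theta}$ is the subalgebra generated by all values of $\sigma$ and $\sigma^{-1}$. The twisted algebra $S(t_H)_\Theta\otimes{}^{\sigma}H$ has unit $t_1^{-1}\otimes1$. The map $\varphi:S(t_H)_\Theta\otimes{}^{\sigma}H\to S(t_H)_\Theta\otimes{}^{\alpha}H$, $\varphi(b\otimes h)=\sum b\,t_{h_{(1)}}\otimes h_{(2)}$, is an $S(t_H)_\Theta$-linear isomorphism of $H$-comodule algebras with inverse $\varphi^{-1}(b\otimes h)=\sum b\,t^{-1}_{h_{(1)}}\otimes h_{(2)}$. Identities: $X_H$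 is a copy of $H$ (with identity map $h\mapsto X_h$); $T(X_H)$ is the tensor algebra, an $H$-comodule algebra with coaction determined by $\delta(X_h)=\sum X_{h_{(1)}}\otimes h_{(2)}$. $I_H({}^{\alpha}H)$ is the ideal of those $P\in T(X_H)$ with $\mu(P)=0$ for all $H$-comodule algebra morphisms $\mu:T(X_H)\to{}^{\alpha}H$, and $\mathcal U_H^{\alpha}=T(X_H)/I_H({}^{\alpha}H)$. The algebra morphism $T(X_H)\to S(t_H)\otimes{}^{\alpha}H$, $X_h\mapsto\sum t_{h_{(1)}}\otimes h_{(2)}$, induces an injective $H$-comodule algebra morphism $\mu_\alpha:\mathcal U_H^{\alpha}\to S(t_H)\otimes{}^{\alpha}H\subset S(t_H)_\Theta\otimes{}^{\alpha}H$, and $\mu_\sigma=\varphi^{-1}\circ\mu_\alpha:\mathcal U_H^{\alpha}\to S(t_H)_\Theta\otimes{}^{\sigma}H$. The inclusion for $\mu_\alpha$ is in $S(t_H)_\Theta\otimes{}^{\alpha}H$ and that for $\mu_\sigma$ is in $S(t_H)_\Theta\otimes{}^{\sigma}H$. *)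

theory Defs
  imports
    Complex_Main
    "HOL-Library.Poly_Mapping"
    "HOL-Computational_Algebra.Fraction_Field"
    "HOL-Algebra.QuotRing"
    "HOL-Algebra.Module"
begin

section \<open>Tensor products with \<open>H\<close>\<close>

text \<open>
  The vector space underlying \<open>H\<close> is an arbitrary type with an arbitrary scalar multiplication.
  Its multiplication and unit are those of the type class \<^class>\<open>ring_1\<close>; the remaining structure
  maps are collected in a record.

  All tensor products that occur have \<open>H\<close> as their right-hand factor. Fixing a basis \<open>E\<close> of \<open>H\<close>,
  every element of \<open>V \<otimes> H\<close> is uniquely \<open>\<Sum>\<^sub>e v\<^sub>e \<otimes> e\<close>, so \<open>V \<otimes> H\<close> is modelled by the finitely
  supported functions \<open>e \<mapsto> v\<^sub>e\<close> from \<open>E\<close> to \<open>V\<close>; the lemmas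
  \<open>bilinear_tens\<close>, \<open>tlift_tens\<close> and \<open>tens_expand\<close> below are its universal property. Only the additive structure of the type of finitely supported
  functions is used here: its library multiplication \<open>(*)\<close> is not the product of the algebra
  \<open>V \<otimes> H\<close>.
\<close>

record (overloaded) ('k, 'h) hopf_data =
  hscale :: "'k \<Rightarrow> 'h \<Rightarrow> 'h"
  comult :: "'h \<Rightarrow> ('h \<Rightarrow>\<^sub>0 'h::zero)"
  counit :: "'h \<Rightarrow> 'k"

definition basis :: "('k::field, 'h::ring_1) hopf_data \<Rightarrow> 'h set" where
  "basis H = vector_space.extend_basis (hscale H) {}"

definition coord :: "('k::field, 'h::ring_1) hopf_data \<Rightarrow> 'h \<Rightarrow> 'h \<Rightarrow> 'k" where
  "coord H h e = Modules.module.representation (hscale H) (basis H) h e"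

definition csupp :: "('k::field, 'h::ring_1) hopf_data \<Rightarrow> 'h \<Rightarrow> 'h set" where
  "csupp H h = {e. coord H h e \<noteq> 0}"

text \<open>\<open>v \<otimes> h\<close>, where \<open>sv\<close> is the scalar multiplication of \<open>V\<close>.\<close>
definition tens ::
  "('k::field, 'h::ring_1) hopf_data \<Rightarrow> ('k \<Rightarrow> 'v \<Rightarrow> 'v) \<Rightarrow> 'v \<Rightarrow> 'h \<Rightarrow> ('h \<Rightarrow>\<^sub>0 'v::comm_monoid_add)"
  where "tens H sv v h = (\<Sum>e\<in>csupp H h. Poly_Mapping.single e (sv (coord H h e) v))"

definition tens_space ::
  "('k::field, 'h::ring_1) hopf_data \<Rightarrow> 'v set \<Rightarrow> ('h \<Rightarrow>\<^sub>0 'v::zero) set"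
  where "tens_space H V =
    {u. Poly_Mapping.keys u \<subseteq> basis H \<and> (\<forall>e. Poly_Mapping.lookup u e \<in> V)}"

definition tscale :: "('k \<Rightarrow> 'v \<Rightarrow> 'v) \<Rightarrow> 'k \<Rightarrow> ('h \<Rightarrow>\<^sub>0 'v) \<Rightarrow> ('h \<Rightarrow>\<^sub>0 'v::zero)" where
  "tscale sv c u = Poly_Mapping.map (sv c) u"

text \<open>For a bilinear map \<open>f\<close>, the linear map with \<open>v \<otimes> h \<mapsto> f v h\<close>.\<close>
definition tlift :: "('v::zero \<Rightarrow> 'h \<Rightarrow> 'z::comm_monoid_add) \<Rightarrow> ('h \<Rightarrow>\<^sub>0 'v) \<Rightarrow> 'z" where
  "tlift f u = (\<Sum>e\<in>Poly_Mapping.keys u. f (Poly_Mapping.lookup u e) e)"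

text \<open>\<open>sw2 H x f\<close> is the Sweedler sum \<open>\<Sum> f x\<^sub>1 x\<^sub>2\<close>, and \<open>sw3 H x f\<close> is \<open>\<Sum> f x\<^sub>1 x\<^sub>2 x\<^sub>3\<close>.\<close>
definition sw2 ::
  "('k, 'h::ring_1) hopf_data \<Rightarrow> 'h \<Rightarrow> ('h \<Rightarrow> 'h \<Rightarrow> 'z::comm_monoid_add) \<Rightarrow> 'z" where
  "sw2 H x f = tlift f (comult H x)"

definition sw3 ::
  "('k, 'h::ring_1) hopf_data \<Rightarrow> 'h \<Rightarrow> ('h \<Rightarrow> 'h \<Rightarrow> 'h \<Rightarrow> 'z::comm_monoid_add) \<Rightarrow> 'z" where
  "sw3 H x f = sw2 H x (\<lambda>y x3. sw2 H y (\<lambda>x1 x2. f x1 x2 x3))"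

definition bilinear_map ::
  "('k::field \<Rightarrow> 'u::ab_group_add \<Rightarrow> 'u) \<Rightarrow> ('k \<Rightarrow> 'v::ab_group_add \<Rightarrow> 'v) \<Rightarrow>
   ('k \<Rightarrow> 'w::ab_group_add \<Rightarrow> 'w) \<Rightarrow> ('u \<Rightarrow> 'v \<Rightarrow> 'w) \<Rightarrow> bool" where
  "bilinear_map su sv sw f \<longleftrightarrow>
     (\<forall>u. Vector_Spaces.linear sv sw (f u)) \<and> (\<forall>v. Vector_Spaces.linear su sw (\<lambda>u. f u v))"


lemma
  assumes "vector_space (hscale H)"
  shows independent_basis: "\<not> Modules.module.dependent (hscale H) (basis H)"
    and span_basis: "Modules.module.span (hscale H) (basis H) = UNIV"
proof -
  interpret vector_space "hscale H" by fact
  have "independent {}" by (rule independent_empty)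
  then show "\<not> Modules.module.dependent (hscale H) (basis H)"
    and "Modules.module.span (hscale H) (basis H) = UNIV"
    unfolding basis_def by (rule independent_extend_basis, rule span_extend_basis)
qed

lemma
  assumes "vector_space (hscale H)"
  shows finite_csupp: "finite (csupp H h)"
    and csupp_subset: "csupp H h \<subseteq> basis H"
    and coord_expand: "(\<Sum>e\<in>csupp H h. hscale H (coord H h e) e) = h"
    and coord_basis: "e \<in> basis H \<Longrightarrow> coord H e e' = (if e' = e then 1 else 0)"
    and coord_add: "coord H (h + h') e = coord H h e + coord H h' e"
    and coord_scale: "coord H (hscale H c h) e = c * coord H h e"
proof -
  interpret vector_space "hscale H" by fact
  note B = independent_basis[OF assms] span_basis[OF assms]
  show "finite (csupp H h)" "csupp H h \<subseteq> basis H"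
    unfolding csupp_def coord_def
    by (auto simp: finite_representation intro: representation_ne_zero)
  show "(\<Sum>e\<in>csupp H h. hscale H (coord H h e) e) = h"
    unfolding csupp_def coord_def
    using B by (intro sum_nonzero_representation_eq) auto
  show "e \<in> basis H \<Longrightarrow> coord H e e' = (if e' = e then 1 else 0)"
    unfolding coord_def using B by (simp add: representation_basis)
  show "coord H (h + h') e = coord H h e + coord H h' e"
    unfolding coord_def using B by (simp add: representation_add)
  show "coord H (hscale H c h) e = c * coord H h e"
    unfolding coord_def using B by (simp add: representation_scale)
qed

lemma lookup_tens:
  assumes "vector_space (hscale H)" "vector_space sv"
  shows "Poly_Mapping.lookup (tens H sv v h) e = sv (coord H h e) v"
proof -
  interpret V: vector_space sv by fact
  have "Poly_Mapping.lookup (tens H sv v h) e =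
      (\<Sum>e'\<in>csupp H h. if e' = e then sv (coord H h e') v else 0)"
    unfolding tens_def lookup_sum lookup_single when_def by (rule refl)
  then show ?thesis
    using finite_csupp[OF assms(1), of h] by (simp add: csupp_def)
qed

lemma tens_basis:
  assumes "vector_space (hscale H)" "vector_space sv" "e \<in> basis H"
  shows "tens H sv v e = Poly_Mapping.single e v"
proof (rule poly_mapping_eqI)
  interpret V: vector_space sv by fact
  show "Poly_Mapping.lookup (tens H sv v e) x = Poly_Mapping.lookup (Poly_Mapping.single e v) x" for x
    using assms by (simp add: lookup_tens coord_basis lookup_single when_def)
qed

lemma vector_space_tscale:
  assumes "vector_space sv"
  shows "vector_space (tscale sv :: _ \<Rightarrow> ('h \<Rightarrow>\<^sub>0 'v::ab_group_add) \<Rightarrow> _)"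
proof -
  interpret V: vector_space sv by fact
  have l: "Poly_Mapping.lookup (tscale sv c u) e = sv c (Poly_Mapping.lookup u e)"
    for c e and u :: "'h \<Rightarrow>\<^sub>0 'v"
    by (simp add: tscale_def Poly_Mapping.map.rep_eq when_def)
  show ?thesis
    by standard (auto intro!: poly_mapping_eqI
        simp: l lookup_add V.scale_right_distrib V.scale_left_distrib)
qed

lemma bilinear_tens:
  assumes "vector_space (hscale H)" "vector_space sv"
  shows "bilinear_map sv (hscale H) (tscale sv) (tens H sv)"
proof -
  interpret V: vector_space sv by fact
  have l: "Poly_Mapping.lookup (tscale sv c u) e = sv c (Poly_Mapping.lookup u e)" for c u and e :: 'b
    by (simp add: tscale_def Poly_Mapping.map.rep_eq when_def)
  note vs = assms vector_space_tscale[OF assms(2)]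
  show ?thesis
    unfolding bilinear_map_def
    by (auto intro!: Vector_Spaces.linear.intro vs module_hom.intro module_hom_axioms.intro
        poly_mapping_eqI vs[unfolded module_iff_vector_space[symmetric]]
        simp: l lookup_add lookup_tens assms coord_add coord_scale
          V.scale_right_distrib V.scale_left_distrib V.scale_left_commute)
qed

lemma tlift_tens:
  assumes "vector_space (hscale H)" "bilinear_map sv (hscale H) sz f"
  shows "tlift f (tens H sv v h) = f v h"
proof -
  have lin: "Vector_Spaces.linear (hscale H) sz (f v)" "Vector_Spaces.linear sv sz (\<lambda>v. f v e)" for v e
    using assms(2) by (auto simp: bilinear_map_def)
  interpret L1: Vector_Spaces.linear "hscale H" sz "f v" by (rule lin)
  have vs: "vector_space sv" using lin(2) by (simp add: Vector_Spaces.linear_def)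
  interpret V: vector_space sv by (rule vs)
  have f0: "f 0 e = 0" for e
  proof -
    interpret L2: Vector_Spaces.linear sv sz "\<lambda>v. f v e" by (rule lin)
    show ?thesis by (rule L2.zero)
  qed
  have fs: "f (sv c v) e = sz c (f v e)" for c v e
  proof -
    interpret L2: Vector_Spaces.linear sv sz "\<lambda>v. f v e" by (rule lin)
    show ?thesis by (rule L2.scale)
  qed
  have "tlift f (tens H sv v h) =
      (\<Sum>e\<in>csupp H h. f (Poly_Mapping.lookup (tens H sv v h) e) e)"
    unfolding tlift_def
    by (intro sum.mono_neutral_left finite_csupp assms(1))
      (auto simp: in_keys_iff lookup_tens[OF assms(1) vs] csupp_def f0)
  also have "\<dots> = (\<Sum>e\<in>csupp H h. f v (hscale H (coord H h e) e))"
    by (simp add: lookup_tens[OF assms(1) vs] fs L1.scale)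
  also have "\<dots> = f v h"
    by (simp add: L1.sum[symmetric] coord_expand[OF assms(1)])
  finally show ?thesis .
qed

lemma tens_expand:
  assumes "vector_space (hscale H)" "vector_space sv" "u \<in> tens_space H UNIV"
  shows "u = (\<Sum>e\<in>Poly_Mapping.keys u. tens H sv (Poly_Mapping.lookup u e) e)"
proof -
  have "(\<Sum>e\<in>Poly_Mapping.keys u. tens H sv (Poly_Mapping.lookup u e) e) =
      (\<Sum>e\<in>Poly_Mapping.keys u. Poly_Mapping.single e (Poly_Mapping.lookup u e))"
    using assms by (intro sum.cong) (auto simp: tens_space_def tens_basis)
  also have "\<dots> = u"
    by (rule poly_mapping_eqI) (simp add: lookup_sum lookup_single when_def in_keys_iff)
  finally show ?thesis by simp
qed


section \<open>Hopf algebras\<close>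

definition hopf_algebra :: "('k::field, 'h::ring_1) hopf_data \<Rightarrow> bool" where
  "hopf_algebra H \<longleftrightarrow>
    \<comment> \<open>an associative unital algebra\<close>
    vector_space (hscale H) \<and>
    bilinear_map (hscale H) (hscale H) (hscale H) (*) \<and>
    \<comment> \<open>a coassociative counital coalgebra; coassociativity is an equation in \<open>(H \<otimes> H) \<otimes> H\<close>\<close>
    Vector_Spaces.linear (hscale H) (tscale (hscale H)) (comult H) \<and>
    (\<forall>x. comult H x \<in> tens_space H UNIV) \<and>
    Vector_Spaces.linear (hscale H) (*) (counit H) \<and>
    (\<forall>x. sw2 H x (\<lambda>y z. tens H (tscale (hscale H)) (comult H y) z) =
         sw2 H x (\<lambda>y z. sw2 H z (\<lambda>z1 z2.
           tens H (tscale (hscale H)) (tens H (hscale H) y z1) z2))) \<and>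
    (\<forall>x. sw2 H x (\<lambda>x1 x2. hscale H (counit H x1) x2) = x) \<and>
    (\<forall>x. sw2 H x (\<lambda>x1 x2. hscale H (counit H x2) x1) = x) \<and>
    \<comment> \<open>comultiplication and counit are algebra morphisms\<close>
    comult H 1 = tens H (hscale H) 1 1 \<and>
    (\<forall>x y. comult H (x * y) =
       sw2 H x (\<lambda>x1 x2. sw2 H y (\<lambda>y1 y2. tens H (hscale H) (x1 * y1) (x2 * y2)))) \<and>
    counit H 1 = 1 \<and>
    (\<forall>x y. counit H (x * y) = counit H x * counit H y) \<and>
    \<comment> \<open>antipode\<close>
    (\<exists>S. Vector_Spaces.linear (hscale H) (hscale H) S \<and>
       (\<forall>x. sw2 H x (\<lambda>x1 x2. S x1 * x2) = hscale H (counit H x) 1) \<and>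
       (\<forall>x. sw2 H x (\<lambda>x1 x2. x1 * S x2) = hscale H (counit H x) 1))"


section \<open>Algebras as records; comodule algebra morphisms\<close>

text \<open>
  Algebras are records of type \<open>('k, 'a) module\<close>, i.e. rings with carrier and scalar multiplication.
  The addition of every algebra below is that of the underlying type. Coactions
  \<open>A \<rightarrow> A \<otimes> H\<close> are passed separately.
\<close>

definition ring_center :: "('a, 'm) monoid_scheme \<Rightarrow> 'a set" where
  "ring_center A = {z \<in> carrier A. \<forall>u \<in> carrier A. z \<otimes>\<^bsub>A\<^esub> u = u \<otimes>\<^bsub>A\<^esub> z}"

definition tens_algebra ::
  "('k::field, 'h::ring_1) hopf_data \<Rightarrow> ('k, 'a::comm_monoid_add, 'm) module_scheme \<Rightarrow>
   ('k, 'h \<Rightarrow>\<^sub>0 'a) module" where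
  "tens_algebra H A =
    \<lparr>carrier = tens_space H (carrier A),
     mult = (\<lambda>u v. tlift (\<lambda>a x. tlift (\<lambda>b y. tens H (smult A) (a \<otimes>\<^bsub>A\<^esub> b) (x * y)) v) u),
     one = tens H (smult A) \<one>\<^bsub>A\<^esub> 1,
     zero = 0, add = (+), smult = tscale (smult A)\<rparr>"

definition comodule_algebra_hom ::
  "('k::field, 'h::ring_1) hopf_data \<Rightarrow>
   ('k, 'a::comm_monoid_add, 'm) module_scheme \<Rightarrow> ('a \<Rightarrow> ('h \<Rightarrow>\<^sub>0 'a)) \<Rightarrow>
   ('k, 'b::comm_monoid_add, 'n) module_scheme \<Rightarrow> ('b \<Rightarrow> ('h \<Rightarrow>\<^sub>0 'b)) \<Rightarrow> ('a \<Rightarrow> 'b) set" where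
  "comodule_algebra_hom H A \<delta>A B \<delta>B =
    {f \<in> ring_hom A B.
      (\<forall>c. \<forall>a \<in> carrier A. f (c \<odot>\<^bsub>A\<^esub> a) = c \<odot>\<^bsub>B\<^esub> f a) \<and>
      (\<forall>a \<in> carrier A. \<delta>B (f a) = tlift (\<lambda>a' h. tens H (smult B) (f a') h) (\<delta>A a))}"

text \<open>The unital subalgebra generated by a subset.\<close>
inductive_set subalgebra_gen :: "('k \<Rightarrow> 'r \<Rightarrow> 'r) \<Rightarrow> 'r::ring_1 set \<Rightarrow> 'r set"
  for s :: "'k \<Rightarrow> 'r \<Rightarrow> 'r" and G :: "'r set" where
  gen: "x \<in> G \<Longrightarrow> x \<in> subalgebra_gen s G"
| one: "1 \<in> subalgebra_gen s G"
| add: "x \<in> subalgebra_gen s G \<Longrightarrow> y \<in> subalgebra_gen s G \<Longrightarrow> x + y \<in> subalgebra_gen s G"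
| mult: "x \<in> subalgebra_gen s G \<Longrightarrow> y \<in> subalgebra_gen s G \<Longrightarrow> x * y \<in> subalgebra_gen s G"
| scale: "x \<in> subalgebra_gen s G \<Longrightarrow> s c x \<in> subalgebra_gen s G"


section \<open>Two-cocycles and twisted algebras\<close>

definition two_cocycle ::
  "('k::field, 'h::ring_1) hopf_data \<Rightarrow> ('k \<Rightarrow> 'r \<Rightarrow> 'r) \<Rightarrow> ('h \<Rightarrow> 'h \<Rightarrow> 'r::comm_ring_1) \<Rightarrow> bool"
  where
  "two_cocycle H sr \<alpha> \<longleftrightarrow>
    bilinear_map (hscale H) (hscale H) sr \<alpha> \<and>
    (\<forall>x y z.
      sw2 H x (\<lambda>x1 x2. sw2 H y (\<lambda>y1 y2. \<alpha> x1 y1 * \<alpha> (x2 * y2) z)) =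
      sw2 H y (\<lambda>y1 y2. sw2 H z (\<lambda>z1 z2. \<alpha> y1 z1 * \<alpha> x (y2 * z2))))"

definition normalized_cocycle ::
  "('k::field, 'h::ring_1) hopf_data \<Rightarrow> ('k \<Rightarrow> 'r \<Rightarrow> 'r) \<Rightarrow> ('h \<Rightarrow> 'h \<Rightarrow> 'r::comm_ring_1) \<Rightarrow> bool"
  where
  "normalized_cocycle H sr \<alpha> \<longleftrightarrow>
    (\<forall>x. \<alpha> x 1 = sr (counit H x) 1 \<and> \<alpha> 1 x = sr (counit H x) 1)"

definition convolution_inverse ::
  "('k::field, 'h::ring_1) hopf_data \<Rightarrow> ('k \<Rightarrow> 'r \<Rightarrow> 'r) \<Rightarrow>
   ('h \<Rightarrow> 'h \<Rightarrow> 'r::comm_ring_1) \<Rightarrow> ('h \<Rightarrow> 'h \<Rightarrow> 'r) \<Rightarrow> bool" where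
  "convolution_inverse H sr \<alpha> \<beta> \<longleftrightarrow>
    bilinear_map (hscale H) (hscale H) sr \<beta> \<and>
    (\<forall>x y. sw2 H x (\<lambda>x1 x2. sw2 H y (\<lambda>y1 y2. \<alpha> x1 y1 * \<beta> x2 y2)) =
             sr (counit H x * counit H y) 1 \<and>
           sw2 H x (\<lambda>x1 x2. sw2 H y (\<lambda>y1 y2. \<beta> x1 y1 * \<alpha> x2 y2)) =
             sr (counit H x * counit H y) 1)"

definition convolution_invertible ::
  "('k::field, 'h::ring_1) hopf_data \<Rightarrow> ('k \<Rightarrow> 'r \<Rightarrow> 'r) \<Rightarrow> ('h \<Rightarrow> 'h \<Rightarrow> 'r::comm_ring_1) \<Rightarrow> bool"
  where "convolution_invertible H sr \<alpha> \<longleftrightarrow> (\<exists>\<beta>. convolution_inverse H sr \<alpha> \<beta>)"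

definition cocycle_inv ::
  "('k::field, 'h::ring_1) hopf_data \<Rightarrow> ('h \<Rightarrow> 'h \<Rightarrow> 'k) \<Rightarrow> ('h \<Rightarrow> 'h \<Rightarrow> 'k)" where
  "cocycle_inv H \<alpha> = (THE \<beta>. convolution_inverse H (*) \<alpha> \<beta>)"

text \<open>
  The twisted algebra \<open>R \<otimes> \<^sup>\<alpha>H\<close> for a subalgebra \<open>R\<close> of the commutative algebra \<open>'r\<close> with scalar
  multiplication \<open>sr\<close>. Its unit is \<open>u \<otimes> 1\<close>, where \<open>u = 1\<close> if \<open>\<alpha>\<close> is normalized, but \<open>u\<close> differs
  from \<open>1\<close> for the universal cocycle \<open>\<sigma>\<close> below.
\<close>
definition twisted_algebra ::
  "('k::field, 'h::ring_1) hopf_data \<Rightarrow> ('k \<Rightarrow> 'r \<Rightarrow> 'r) \<Rightarrow> 'r set \<Rightarrow>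
   ('h \<Rightarrow> 'h \<Rightarrow> 'r::comm_ring_1) \<Rightarrow> 'r \<Rightarrow> ('k, 'h \<Rightarrow>\<^sub>0 'r) module" where
  "twisted_algebra H sr R \<alpha> u =
    \<lparr>carrier = tens_space H R,
     mult = (\<lambda>p q. tlift (\<lambda>b x. tlift (\<lambda>c y.
        sw2 H x (\<lambda>x1 x2. sw2 H y (\<lambda>y1 y2. tens H sr (b * c * \<alpha> x1 y1) (x2 * y2)))) q) p),
     one = tens H sr u 1,
     zero = 0, add = (+), smult = tscale sr\<rparr>"

text \<open>The coaction \<open>id\<^sub>R \<otimes> \<Delta>\<close> on \<open>R \<otimes> \<^sup>\<alpha>H\<close>.\<close>
definition twisted_coaction ::
  "('k::field, 'h::ring_1) hopf_data \<Rightarrow> ('k \<Rightarrow> 'r \<Rightarrow> 'r) \<Rightarrow>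
   ('h \<Rightarrow>\<^sub>0 'r::comm_ring_1) \<Rightarrow> ('h \<Rightarrow>\<^sub>0 'h \<Rightarrow>\<^sub>0 'r)" where
  "twisted_coaction H sr =
    tlift (\<lambda>b x. sw2 H x (\<lambda>x1 x2. tens H (tscale sr) (tens H sr b x1) x2))"

text \<open>\<open>\<^sup>\<alpha>H = k \<otimes> \<^sup>\<alpha>H\<close> for normalized \<open>\<alpha>\<close>.\<close>
definition twisted_H ::
  "('k::field, 'h::ring_1) hopf_data \<Rightarrow> ('h \<Rightarrow> 'h \<Rightarrow> 'k) \<Rightarrow> ('k, 'h \<Rightarrow>\<^sub>0 'k) module" where
  "twisted_H H \<alpha> = twisted_algebra H (*) UNIV \<alpha> 1"

definition nondegenerate ::
  "('k::field, 'h::ring_1) hopf_data \<Rightarrow> ('h \<Rightarrow> 'h \<Rightarrow> 'k) \<Rightarrow> bool" where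
  "nondegenerate H \<alpha> \<longleftrightarrow>
    ring_center (twisted_H H \<alpha>) = {c \<odot>\<^bsub>twisted_H H \<alpha>\<^esub> \<one>\<^bsub>twisted_H H \<alpha>\<^esub> | c. True}"


section \<open>Commutative polynomials in arbitrarily many variables\<close>

text \<open>
  A copy of the library's ring of finitely supported functions on monomials. The library shows
  that it is an integral domain only for linearly ordered types of variables, hence the new type.
\<close>

typedef (overloaded) ('x, 'k::zero) cpoly = "UNIV :: (('x \<Rightarrow>\<^sub>0 nat) \<Rightarrow>\<^sub>0 'k) set" ..

setup_lifting type_definition_cpoly

instantiation cpoly :: (type, comm_ring_1) comm_ring_1
begin
lift_definition zero_cpoly :: "('a, 'b) cpoly" is 0 .
lift_definition one_cpoly :: "('a, 'b) cpoly" is 1 .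
lift_definition plus_cpoly :: "('a, 'b) cpoly \<Rightarrow> ('a, 'b) cpoly \<Rightarrow> ('a, 'b) cpoly" is "(+)" .
lift_definition minus_cpoly :: "('a, 'b) cpoly \<Rightarrow> ('a, 'b) cpoly \<Rightarrow> ('a, 'b) cpoly" is "(-)" .
lift_definition uminus_cpoly :: "('a, 'b) cpoly \<Rightarrow> ('a, 'b) cpoly" is uminus .
lift_definition times_cpoly :: "('a, 'b) cpoly \<Rightarrow> ('a, 'b) cpoly \<Rightarrow> ('a, 'b) cpoly" is "(*)" .
instance
  by standard (transfer; simp add: algebra_simps; fail)+
end

lift_definition cconst :: "'k::zero \<Rightarrow> ('x, 'k) cpoly" is "\<lambda>c. Poly_Mapping.single 0 c" .

lift_definition cvar :: "'x \<Rightarrow> ('x, 'k::zero_neq_one) cpoly"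
  is "\<lambda>x. Poly_Mapping.single (Poly_Mapping.single x 1) 1" .

lift_definition cvars :: "('x, 'k::zero) cpoly \<Rightarrow> 'x set"
  is "\<lambda>p. \<Union>m\<in>Poly_Mapping.keys p. Poly_Mapping.keys m" .

definition rename_monom :: "('x \<Rightarrow> 'y) \<Rightarrow> ('x \<Rightarrow>\<^sub>0 nat) \<Rightarrow> ('y \<Rightarrow>\<^sub>0 nat)" where
  "rename_monom f m =
    (\<Sum>x\<in>Poly_Mapping.keys m. Poly_Mapping.single (f x) (Poly_Mapping.lookup m x))"

definition rename_poly ::
  "('x \<Rightarrow> 'y) \<Rightarrow> (('x \<Rightarrow>\<^sub>0 nat) \<Rightarrow>\<^sub>0 'k) \<Rightarrow> (('y \<Rightarrow>\<^sub>0 nat) \<Rightarrow>\<^sub>0 'k::comm_ring_1)" where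
  "rename_poly f p =
    (\<Sum>m\<in>Poly_Mapping.keys p. Poly_Mapping.single (rename_monom f m) (Poly_Mapping.lookup p m))"

lemma sum_keys_superset:
  assumes "finite A" "Poly_Mapping.keys p \<subseteq> A" "\<And>x. g x 0 = 0"
  shows "(\<Sum>x\<in>Poly_Mapping.keys p. g x (Poly_Mapping.lookup p x)) =
    (\<Sum>x\<in>A. g x (Poly_Mapping.lookup p x))"
  using assms by (intro sum.mono_neutral_left) (auto simp: in_keys_iff)

lemma sum_keys_add:
  assumes "\<And>x. g x 0 = 0" "\<And>x a b. g x (a + b) = g x a + g x b"
  shows "(\<Sum>x\<in>Poly_Mapping.keys (p + q). g x (Poly_Mapping.lookup (p + q) x)) =
    (\<Sum>x\<in>Poly_Mapping.keys p. g x (Poly_Mapping.lookup p x)) +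
    (\<Sum>x\<in>Poly_Mapping.keys q. g x (Poly_Mapping.lookup q x))"
proof -
  let ?A = "Poly_Mapping.keys p \<union> Poly_Mapping.keys q"
  have "(\<Sum>x\<in>Poly_Mapping.keys (p + q). g x (Poly_Mapping.lookup (p + q) x)) =
      (\<Sum>x\<in>?A. g x (Poly_Mapping.lookup (p + q) x))"
    by (rule sum_keys_superset) (auto simp: assms dest: subsetD[OF Poly_Mapping.keys_add])
  moreover have "(\<Sum>x\<in>Poly_Mapping.keys p. g x (Poly_Mapping.lookup p x)) =
      (\<Sum>x\<in>?A. g x (Poly_Mapping.lookup p x))"
    by (rule sum_keys_superset) (auto simp: assms)
  moreover have "(\<Sum>x\<in>Poly_Mapping.keys q. g x (Poly_Mapping.lookup q x)) =
      (\<Sum>x\<in>?A. g x (Poly_Mapping.lookup q x))"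
    by (rule sum_keys_superset) (auto simp: assms)
  ultimately show ?thesis
    by (simp add: lookup_add assms sum.distrib)
qed

lemma rename_monom_add: "rename_monom f (m + n) = rename_monom f m + rename_monom f n"
  unfolding rename_monom_def by (rule sum_keys_add) (auto simp: single_add)

lemma rename_poly_add: "rename_poly f (p + q) = rename_poly f p + rename_poly f q"
  unfolding rename_poly_def by (rule sum_keys_add) (auto simp: single_add)

lemma rename_poly_single:
  "rename_poly f (Poly_Mapping.single m c) = Poly_Mapping.single (rename_monom f m) c"
  by (cases "c = 0") (auto simp: rename_poly_def)

lemma rename_poly_zero: "rename_poly f 0 = 0"
  by (simp add: rename_poly_def)

lemma poly_mapping_single_induct:
  assumes "P 0" "\<And>m c. P (Poly_Mapping.single m c)" "\<And>p q. P p \<Longrightarrow> P q \<Longrightarrow> P (p + q)"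
  shows "P (p :: 'a \<Rightarrow>\<^sub>0 'b::comm_monoid_add)"
proof -
  have "P (\<Sum>m\<in>A. Poly_Mapping.single m (Poly_Mapping.lookup p m))" if "finite A" for A
    using that by (induction A) (auto simp: assms)
  moreover have "p = (\<Sum>m\<in>Poly_Mapping.keys p. Poly_Mapping.single m (Poly_Mapping.lookup p m))"
    by (rule poly_mapping_eqI)
      (simp add: lookup_sum lookup_single when_def in_keys_iff)
  ultimately show ?thesis
    by (metis finite_keys)
qed

lemma rename_poly_mult: "rename_poly f (p * q) = rename_poly f p * rename_poly f q"
proof (induction p rule: poly_mapping_single_induct)
  case (2 m c)
  show ?case
  proof (induction q rule: poly_mapping_single_induct)
    case (2 n d)
    then show ?case by (simp add: rename_poly_single mult_single rename_monom_add)
  qed (auto simp: rename_poly_zero rename_poly_add distrib_left)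
qed (auto simp: rename_poly_zero rename_poly_add distrib_right)

lemma lookup_rename_monom:
  assumes "inj_on f V" "Poly_Mapping.keys m \<subseteq> V" "x \<in> V"
  shows "Poly_Mapping.lookup (rename_monom f m) (f x) = Poly_Mapping.lookup m x"
proof -
  have "Poly_Mapping.lookup (rename_monom f m) (f x) =
      (\<Sum>y\<in>Poly_Mapping.keys m. if y = x then Poly_Mapping.lookup m y else 0)"
    unfolding rename_monom_def lookup_sum lookup_single when_def
    using assms by (intro sum.cong) (auto dest: inj_onD)
  then show ?thesis by (simp add: in_keys_iff)
qed

lemma rename_poly_eq_0:
  assumes "inj_on f V" "\<And>m. m \<in> Poly_Mapping.keys p \<Longrightarrow> Poly_Mapping.keys m \<subseteq> V"
    and "rename_poly f p = 0"
  shows "p = 0"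
proof (rule ccontr)
  assume "p \<noteq> 0"
  then obtain m where m: "m \<in> Poly_Mapping.keys p" by (metis keys_eq_empty ex_in_conv)
  have inj: "n = m" if "n \<in> Poly_Mapping.keys p" "rename_monom f n = rename_monom f m" for n
  proof (rule poly_mapping_eqI)
    fix x
    show "Poly_Mapping.lookup n x = Poly_Mapping.lookup m x"
    proof (cases "x \<in> V")
      case True
      then show ?thesis using lookup_rename_monom[OF assms(1)] assms(2) m that by metis
    next
      case False
      then show ?thesis using assms(2) m that(1) by (metis in_keys_iff subsetD)
    qed
  qed
  have "Poly_Mapping.lookup (rename_poly f p) (rename_monom f m) =
      (\<Sum>n\<in>Poly_Mapping.keys p. if n = m then Poly_Mapping.lookup p n else 0)"
    unfolding rename_poly_def lookup_sum lookup_single when_def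
    using inj by (intro sum.cong) auto
  with m assms(3) show False by (simp add: in_keys_iff)
qed

lemma monoid_algebra_no_zero_divisors:
  fixes p q :: "('x \<Rightarrow>\<^sub>0 nat) \<Rightarrow>\<^sub>0 'k::idom"
  assumes nz: "p \<noteq> 0" "q \<noteq> 0"
  shows "p * q \<noteq> 0"
proof
  assume pq: "p * q = 0"
  define V where "V = (\<Union>m\<in>Poly_Mapping.keys p \<union> Poly_Mapping.keys q. Poly_Mapping.keys m)"
  have "finite V" by (simp add: V_def)
  then obtain f :: "'x \<Rightarrow> nat" where f: "inj_on f V"
    using finite_imp_inj_to_nat_seg by blast
  have "rename_poly f p * rename_poly f q = 0"
    by (metis pq rename_poly_mult rename_poly_zero)
  then have "rename_poly f p = 0 \<or> rename_poly f q = 0" by simp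
  moreover have "Poly_Mapping.keys m \<subseteq> V"
    if "m \<in> Poly_Mapping.keys p \<or> m \<in> Poly_Mapping.keys q" for m
    using that by (auto simp: V_def)
  ultimately show False
    using nz rename_poly_eq_0[OF f, of p] rename_poly_eq_0[OF f, of q] by blast
qed

instance cpoly :: (type, idom) idom
  by standard (transfer, rule monoid_algebra_no_zero_divisors)


section \<open>The field \<open>K\<^sub>H\<close> and the universal cocycle\<close>

text \<open>
  \<open>S(t\<^sub>H)\<close> is the polynomial algebra on indeterminates \<open>t\<^sub>e\<close>, \<open>e\<close> in the basis of \<open>H\<close>. Since the basis
  is not a type, it is formed inside the field of fractions of the polynomial ring on all
  \<open>t\<^sub>x\<close>, \<open>x :: 'h\<close>, in which the indeterminates outside the basis are simply not used:
  \<open>S(t\<^sub>H)\<close> and its field of fractions \<open>K\<^sub>H\<close> are the sets \<open>sym_alg\<close> and \<open>sym_field\<close>.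
\<close>

type_synonym ('h, 'k) big_field = "('h, 'k) cpoly fract"

definition kscale :: "'k::field \<Rightarrow> ('h, 'k) big_field \<Rightarrow> ('h, 'k) big_field" where
  "kscale c a = Fract (cconst c) 1 * a"

definition sym_alg :: "('k::field, 'h::ring_1) hopf_data \<Rightarrow> ('h, 'k) big_field set" where
  "sym_alg H = {Fract p 1 | p. cvars p \<subseteq> basis H}"

definition sym_field :: "('k::field, 'h::ring_1) hopf_data \<Rightarrow> ('h, 'k) big_field set" where
  "sym_field H = {a / b | a b. a \<in> sym_alg H \<and> b \<in> sym_alg H \<and> b \<noteq> 0}"

definition tgen :: "('k::field, 'h::ring_1) hopf_data \<Rightarrow> 'h \<Rightarrow> ('h, 'k) big_field" where
  "tgen H h = (\<Sum>e\<in>csupp H h. kscale (coord H h e) (Fract (cvar e) 1))"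

lemma tgen_basis:
  fixes H :: "('k::field, 'h::ring_1) hopf_data"
  assumes "vector_space (hscale H)" "e \<in> basis H"
  shows "tgen H e = Fract (cvar e) 1"
proof -
  have "csupp H e = {e}"
    using coord_basis[OF assms] by (auto simp: csupp_def)
  moreover have "cconst 1 = (1 :: ('h, 'k) cpoly)" by transfer simp
  ultimately show ?thesis
    using coord_basis[OF assms] by (simp add: tgen_def kscale_def One_fract_def[symmetric])
qed

text \<open>\<open>h \<mapsto> t\<^sub>h\<^sup>-\<^sup>1\<close> is the convolution inverse of \<open>h \<mapsto> t\<^sub>h\<close>, not the pointwise one.\<close>
definition is_tinv ::
  "('k::field, 'h::ring_1) hopf_data \<Rightarrow> ('h \<Rightarrow> ('h, 'k) big_field) \<Rightarrow> bool" where
  "is_tinv H f \<longleftrightarrow>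
    Vector_Spaces.linear (hscale H) kscale f \<and>
    (\<forall>h. f h \<in> sym_field H) \<and>
    (\<forall>h. sw2 H h (\<lambda>h1 h2. tgen H h1 * f h2) = kscale (counit H h) 1) \<and>
    (\<forall>h. sw2 H h (\<lambda>h1 h2. f h1 * tgen H h2) = kscale (counit H h) 1)"

definition tinv :: "('k::field, 'h::ring_1) hopf_data \<Rightarrow> 'h \<Rightarrow> ('h, 'k) big_field" where
  "tinv H = (THE f. is_tinv H f)"

definition sym_theta :: "('k::field, 'h::ring_1) hopf_data \<Rightarrow> ('h, 'k) big_field set" where
  "sym_theta H = subalgebra_gen kscale (range (tgen H) \<union> range (tinv H))"

definition sigma ::
  "('k::field, 'h::ring_1) hopf_data \<Rightarrow> ('h \<Rightarrow> 'h \<Rightarrow> 'k) \<Rightarrow> 'h \<Rightarrow> 'h \<Rightarrow> ('h, 'k) big_field" where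
  "sigma H \<alpha> x y =
    sw3 H x (\<lambda>x1 x2 x3. sw3 H y (\<lambda>y1 y2 y3.
      kscale (\<alpha> x2 y2) (tgen H x1 * tgen H y1 * tinv H (x3 * y3))))"

definition sigma_inv ::
  "('k::field, 'h::ring_1) hopf_data \<Rightarrow> ('h \<Rightarrow> 'h \<Rightarrow> 'k) \<Rightarrow> 'h \<Rightarrow> 'h \<Rightarrow> ('h, 'k) big_field" where
  "sigma_inv H \<alpha> x y =
    sw3 H x (\<lambda>x1 x2 x3. sw3 H y (\<lambda>y1 y2 y3.
      kscale (cocycle_inv H \<alpha> x2 y2) (tgen H (x1 * y1) * tinv H x3 * tinv H y3)))"

definition B_alg ::
  "('k::field, 'h::ring_1) hopf_data \<Rightarrow> ('h \<Rightarrow> 'h \<Rightarrow> 'k) \<Rightarrow> ('h, 'k) big_field set" where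
  "B_alg H \<alpha> =
    subalgebra_gen kscale ({sigma H \<alpha> x y | x y. True} \<union> {sigma_inv H \<alpha> x y | x y. True})"

text \<open>\<open>S \<otimes> \<^sup>\<alpha>H\<close> for a subalgebra \<open>S\<close> of \<open>K\<^sub>H\<close>, with \<open>\<alpha>\<close> regarded as having values in \<open>S\<close>.\<close>
definition alpha_algebra ::
  "('k::field, 'h::ring_1) hopf_data \<Rightarrow> ('h \<Rightarrow> 'h \<Rightarrow> 'k) \<Rightarrow> ('h, 'k) big_field set \<Rightarrow>
   ('k, 'h \<Rightarrow>\<^sub>0 ('h, 'k) big_field) module" where
  "alpha_algebra H \<alpha> S = twisted_algebra H kscale S (\<lambda>x y. kscale (\<alpha> x y) 1) 1"

text \<open>\<open>S(t\<^sub>H)\<^sub>\<Theta> \<otimes> \<^sup>\<sigma>H\<close>.\<close>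
definition sigma_algebra ::
  "('k::field, 'h::ring_1) hopf_data \<Rightarrow> ('h \<Rightarrow> 'h \<Rightarrow> 'k) \<Rightarrow>
   ('k, 'h \<Rightarrow>\<^sub>0 ('h, 'k) big_field) module" where
  "sigma_algebra H \<alpha> = twisted_algebra H kscale (sym_theta H) (sigma H \<alpha>) (tinv H 1)"

definition phi ::
  "('k::field, 'h::ring_1) hopf_data \<Rightarrow>
   ('h \<Rightarrow>\<^sub>0 ('h, 'k) big_field) \<Rightarrow> ('h \<Rightarrow>\<^sub>0 ('h, 'k) big_field)" where
  "phi H = tlift (\<lambda>b h. sw2 H h (\<lambda>h1 h2. tens H kscale (b * tgen H h1) h2))"


section \<open>The tensor algebra and the universal comodule algebra\<close>

text \<open>
  \<open>T(X\<^sub>H)\<close> is the free algebra on indeterminates \<open>X\<^sub>e\<close>, \<open>e\<close> in the basis of \<open>H\<close>; its elements are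
  finitely supported functions on the free monoid. Here the library multiplication of finitely
  supported functions is the intended one.
\<close>

datatype 'a free_monoid = Letters (letters: "'a list")

instantiation free_monoid :: (type) monoid_add
begin
definition "0 = Letters []"
definition "u + v = Letters (letters u @ letters v)"
instance
  by standard (auto simp: zero_free_monoid_def plus_free_monoid_def)
end

type_synonym ('h, 'k) free_alg = "'h free_monoid \<Rightarrow>\<^sub>0 'k"

definition tensor_alg ::
  "('k::field, 'h::ring_1) hopf_data \<Rightarrow> ('k, ('h, 'k) free_alg) module" where
  "tensor_alg H =
    \<lparr>carrier = {P. \<forall>w \<in> Poly_Mapping.keys P. set (letters w) \<subseteq> basis H},
     mult = (*), one = 1, zero = 0, add = (+), smult = (\<lambda>c. Poly_Mapping.map ((*) c))\<rparr>"

definition Xgen :: "('k::field, 'h::ring_1) hopf_data \<Rightarrow> 'h \<Rightarrow> ('h, 'k) free_alg" where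
  "Xgen H h = (\<Sum>e\<in>csupp H h. Poly_Mapping.single (Letters [e]) (coord H h e))"

text \<open>The algebra morphism \<open>T(X\<^sub>H) \<rightarrow> A\<close> with \<open>X\<^sub>h \<mapsto> g h\<close>, for a linear map \<open>g\<close>.\<close>
definition talg_lift ::
  "('k::zero, 'a::comm_monoid_add, 'm) module_scheme \<Rightarrow> ('h \<Rightarrow> 'a) \<Rightarrow> ('h, 'k) free_alg \<Rightarrow> 'a"
  where
  "talg_lift A g P =
    (\<Sum>w\<in>Poly_Mapping.keys P. Poly_Mapping.lookup P w \<odot>\<^bsub>A\<^esub>
       foldr (\<lambda>e a. g e \<otimes>\<^bsub>A\<^esub> a) (letters w) \<one>\<^bsub>A\<^esub>)"

definition talg_coaction ::
  "('k::field, 'h::ring_1) hopf_data \<Rightarrow> ('h, 'k) free_alg \<Rightarrow> ('h \<Rightarrow>\<^sub>0 ('h, 'k) free_alg)" where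
  "talg_coaction H =
    talg_lift (tens_algebra H (tensor_alg H))
      (\<lambda>h. sw2 H h (\<lambda>h1 h2. tens H (smult (tensor_alg H)) (Xgen H h1) h2))"

definition identities_ideal ::
  "('k::field, 'h::ring_1) hopf_data \<Rightarrow> ('h \<Rightarrow> 'h \<Rightarrow> 'k) \<Rightarrow> ('h, 'k) free_alg set" where
  "identities_ideal H \<alpha> =
    {P \<in> carrier (tensor_alg H).
      \<forall>\<mu> \<in> comodule_algebra_hom H (tensor_alg H) (talg_coaction H)
              (twisted_H H \<alpha>) (twisted_coaction H (*)). \<mu> P = 0}"

definition U_alg ::
  "('k::field, 'h::ring_1) hopf_data \<Rightarrow> ('h \<Rightarrow> 'h \<Rightarrow> 'k) \<Rightarrow> ('h, 'k) free_alg set ring" where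
  "U_alg H \<alpha> = tensor_alg H Quot identities_ideal H \<alpha>"

definition generic_hom ::
  "('k::field, 'h::ring_1) hopf_data \<Rightarrow> ('h \<Rightarrow> 'h \<Rightarrow> 'k) \<Rightarrow>
   ('h, 'k) free_alg \<Rightarrow> ('h \<Rightarrow>\<^sub>0 ('h, 'k) big_field)" where
  "generic_hom H \<alpha> =
    talg_lift (alpha_algebra H \<alpha> (sym_alg H))
      (\<lambda>h. sw2 H h (\<lambda>h1 h2. tens H kscale (tgen H h1) h2))"

text \<open>
  The map induced on \<open>U = T(X\<^sub>H) / I\<close>, whose elements are cosets of \<open>I\<close>. Over an infinite field
  \<open>generic_hom\<close> vanishes on \<open>I\<close>, so its image of a coset is a singleton.
\<close>
definition mu_alpha ::
  "('k::field, 'h::ring_1) hopf_data \<Rightarrow> ('h \<Rightarrow> 'h \<Rightarrow> 'k) \<Rightarrow>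
   ('h, 'k) free_alg set \<Rightarrow> ('h \<Rightarrow>\<^sub>0 ('h, 'k) big_field)" where
  "mu_alpha H \<alpha> C = the_elem (generic_hom H \<alpha> ` C)"

text \<open>\<open>\<mu>\<^sub>\<sigma> = \<phi>\<^sup>-\<^sup>1 \<circ> \<mu>\<^sub>\<alpha>\<close>, with \<open>\<phi>\<close> considered on \<open>S(t\<^sub>H)\<^sub>\<Theta> \<otimes> \<^sup>\<sigma>H\<close>, where it is injective.\<close>
definition mu_sigma ::
  "('k::field, 'h::ring_1) hopf_data \<Rightarrow> ('h \<Rightarrow> 'h \<Rightarrow> 'k) \<Rightarrow>
   ('h, 'k) free_alg set \<Rightarrow> ('h \<Rightarrow>\<^sub>0 ('h, 'k) big_field)" where
  "mu_sigma H \<alpha> C = inv_into (carrier (sigma_algebra H \<alpha>)) (phi H) (mu_alpha H \<alpha> C)"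

end

theory Submission
  imports Defs "Jordan_Normal_Form.Determinant"
begin

text \<open>
  The map \<open>\<phi>\<close> sends \<open>1 \<otimes> h\<close> to the image of \<open>X\<^sub>h\<close>, and the image of \<open>\<phi>\<close> on \<open>B \<otimes> H\<close> is a subalgebra because
  \<open>\<sigma>\<close> takes values in \<open>B\<close>; it contains the unit because \<open>\<sigma>\<^sup>-\<^sup>1(1,1) = t\<^sub>1\<^sup>-\<^sup>1\<close>. So \<open>\<mu>\<^sub>\<sigma>\<close> takes values in \<open>B \<otimes> H\<close>.
  On the other hand \<open>1 \<otimes> h = \<Sum> t\<^sup>-\<^sup>1(h\<^sub>1) \<mu>\<^sub>\<alpha>(X\<^bsub>h\<^sub>2\<^esub>)\<close>, so the image of a central element commutes with
  \<open>1 \<otimes> H\<close>; applying linear functionals \<open>K\<^sub>H \<rightarrow> k\<close> to its coefficients gives central elements of \<open>\<^sup>\<alpha>H\<close>, so by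
  nondegeneracy it is of the form \<open>b \<otimes> 1\<close>. Comparing the two, \<open>b t\<^sub>1\<^sup>-\<^sup>1\<close> and hence \<open>b\<close> lies in \<open>B\<close>.

  The inverse \<open>t\<^sup>-\<^sup>1\<close> exists because the finite matrices through which convolution with \<open>t\<close> acts become
  identity matrices under the specialization \<open>t\<^sub>h \<mapsto> \<epsilon>(h)\<close>. That \<open>\<mu>\<^sub>\<alpha>\<close> is well defined follows since a
  polynomial over an infinite field vanishes if all its values do, and specializing \<open>t\<close> to linear
  forms on \<open>H\<close> gives comodule algebra morphisms to \<open>\<^sup>\<alpha>H\<close>.
\<close>


section \<open>Linear maps and tensor products\<close>

abbreviation lin where "lin \<equiv> Vector_Spaces.linear"

lemma linI:
  assumes "vector_space s1" "vector_space s2"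
    and "\<And>x y. f (x + y) = f x + f y" "\<And>c x. f (s1 c x) = s2 c (f x)"
  shows "lin s1 s2 f"
  using assms by (simp add: Vector_Spaces.linear_iff)

lemma
  assumes "lin s1 s2 f"
  shows lin_add: "f (x + y) = f x + f y"
    and lin_scale: "f (s1 c x) = s2 c (f x)"
    and lin_source: "vector_space s1"
    and lin_target: "vector_space s2"
    and lin_0: "f 0 = 0"
    and lin_sum: "f (sum g A) = (\<Sum>a\<in>A. f (g a))"
    and lin_diff: "f (x - y) = f x - f y"
proof -
  interpret Vector_Spaces.linear s1 s2 f by fact
  show "f (x + y) = f x + f y" "f (s1 c x) = s2 c (f x)" "f 0 = 0"
    "f (sum g A) = (\<Sum>a\<in>A. f (g a))" "f (x - y) = f x - f y"
    by (rule add scale zero sum diff)+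
  show "vector_space s1" "vector_space s2" by unfold_locales
qed

lemma lin_id: "vector_space s \<Longrightarrow> lin s s (\<lambda>x. x)"
  by (rule linI) auto

lemma lin_comp: "lin s2 s3 g \<Longrightarrow> lin s1 s2 f \<Longrightarrow> lin s1 s3 (\<lambda>x. g (f x))"
  by (simp add: Vector_Spaces.linear_iff)

lemma lin_sumI:
  assumes "vector_space s1" "vector_space s2" "\<And>a. a \<in> A \<Longrightarrow> lin s1 s2 (f a)"
  shows "lin s1 s2 (\<lambda>x. \<Sum>a\<in>A. f a x)"
proof (rule linI)
  interpret S: vector_space s2 by fact
  show "(\<Sum>a\<in>A. f a (x + y)) = (\<Sum>a\<in>A. f a x) + (\<Sum>a\<in>A. f a y)" for x y
    by (simp add: lin_add[OF assms(3)] sum.distrib)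
  show "(\<Sum>a\<in>A. f a (s1 c x)) = s2 c (\<Sum>a\<in>A. f a x)" for c x
    by (simp add: lin_scale[OF assms(3)] S.scale_sum_right)
qed (fact assms)+

lemma lin_scaleI: "lin s1 s2 f \<Longrightarrow> lin s1 s2 (\<lambda>x. s2 c (f x))"
  by (intro linI) (auto simp: lin_add lin_scale lin_source lin_target mult.commute
    vector_space.vector_space_assms[OF lin_target])

lemma vector_space_field: "vector_space ((*) :: 'k::field \<Rightarrow> 'k \<Rightarrow> 'k)"
  by standard (auto simp: algebra_simps)

section \<open>Maps of the form \<theta> \<otimes> id on V \<otimes> H\<close>

definition pmmap :: "('v \<Rightarrow> 'w) \<Rightarrow> ('h \<Rightarrow>\<^sub>0 'v::zero) \<Rightarrow> ('h \<Rightarrow>\<^sub>0 'w::zero)" where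
  "pmmap = Poly_Mapping.map"

lemma lookup_pmmap: "\<theta> 0 = 0 \<Longrightarrow> Poly_Mapping.lookup (pmmap \<theta> u) e = \<theta> (Poly_Mapping.lookup u e)"
  by (simp add: pmmap_def Poly_Mapping.map.rep_eq when_def)

lemma keys_pmmap: "Poly_Mapping.keys (pmmap \<theta> u) \<subseteq> Poly_Mapping.keys u"
  by (auto simp: in_keys_iff pmmap_def Poly_Mapping.map.rep_eq when_def)

lemma tscale_pmmap: "tscale s c = pmmap (s c)"
  by (simp add: tscale_def pmmap_def fun_eq_iff)

lemma lookup_tscale:
  assumes "vector_space s"
  shows "Poly_Mapping.lookup (tscale s c u) e = s c (Poly_Mapping.lookup u e)"
proof -
  interpret vector_space s by fact
  show ?thesis by (simp add: tscale_pmmap lookup_pmmap)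
qed

lemma lin_pmmap: "lin s1 s2 \<theta> \<Longrightarrow> lin (tscale s1) (tscale s2) (pmmap \<theta>)"
  by (intro linI vector_space_tscale poly_mapping_eqI)
    (auto simp: lin_source lin_target lookup_pmmap lin_0 lookup_add lin_add lookup_tscale lin_scale)

lemma lin_lookup: "vector_space s \<Longrightarrow> lin (tscale s) s (\<lambda>u. Poly_Mapping.lookup u e)"
  by (intro linI vector_space_tscale) (auto simp: lookup_add lookup_tscale)

lemma tlift_superset:
  assumes "finite A" "Poly_Mapping.keys u \<subseteq> A" "\<And>x. f 0 x = 0"
  shows "tlift f u = (\<Sum>x\<in>A. f (Poly_Mapping.lookup u x) x)"
  unfolding tlift_def by (rule sum_keys_superset[where g = "\<lambda>x a. f a x"]) (use assms in auto)

lemma lin_tlift: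
  fixes f :: "'v::ab_group_add \<Rightarrow> 'h \<Rightarrow> 'z::ab_group_add"
  assumes "\<And>e. lin sv sz (\<lambda>v. f v e)"
  shows "lin (tscale sv) sz (tlift f)"
proof (rule linI)
  note vs = lin_source[OF assms] lin_target[OF assms]
  show "vector_space (tscale sv :: _ \<Rightarrow> ('h \<Rightarrow>\<^sub>0 'v) \<Rightarrow> _)" "vector_space sz"
    by (auto intro: vector_space_tscale vs)
  show "tlift f (x + y) = tlift f x + tlift f y" for x y
    unfolding tlift_def by (rule sum_keys_add[where g = "\<lambda>x a. f a x"]) (auto simp: lin_0[OF assms] lin_add[OF assms])
  show "tlift f (tscale sv c u) = sz c (tlift f u)" for c u
  proof -
    interpret Z: vector_space sz by fact
    have "tlift f (tscale sv c u) = (\<Sum>x\<in>Poly_Mapping.keys u. f (Poly_Mapping.lookup (tscale sv c u) x) x)"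
      by (rule tlift_superset) (auto simp: lin_0[OF assms] tscale_pmmap dest: subsetD[OF keys_pmmap])
    then show ?thesis
      by (simp add: tlift_def lookup_tscale vs lin_scale[OF assms] Z.scale_sum_right)
  qed
qed

lemma tlift_hom:
  assumes "L 0 = 0" "\<And>x y. L (x + y) = L x + L y"
  shows "L (tlift f u) = tlift (\<lambda>v e. L (f v e)) u"
  unfolding tlift_def by (rule sum_comp_morphism[unfolded o_def, symmetric]) (use assms in auto)

lemma tlift_lin: "lin s1 s2 L \<Longrightarrow> L (tlift f u) = tlift (\<lambda>v e. L (f v e)) u"
  by (rule tlift_hom) (auto simp: lin_0 lin_add)

lemma lin_tlift_param:
  assumes "vector_space su" "vector_space sz" "\<And>v e. lin su sz (\<lambda>x. f x v e)"
  shows "lin su sz (\<lambda>x. tlift (f x) u)"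
  unfolding tlift_def by (intro lin_sumI assms)

lemma tlift_swap:
  "tlift (\<lambda>a x. tlift (\<lambda>b y. f a x b y) q) p = tlift (\<lambda>b y. tlift (\<lambda>a x. f a x b y) p) q"
  unfolding tlift_def by (rule sum.swap)

lemma sw2_swap:
  "sw2 H x (\<lambda>a b. sw2 H y (\<lambda>c d. f a b c d)) = sw2 H y (\<lambda>c d. sw2 H x (\<lambda>a b. f a b c d))"
  unfolding sw2_def by (rule tlift_swap)

lemma sw2_lin: "lin s1 s2 L \<Longrightarrow> L (sw2 H x f) = sw2 H x (\<lambda>a b. L (f a b))"
  unfolding sw2_def by (rule tlift_lin)

lemma lin_sw2_param:
  assumes "vector_space su" "vector_space sz" "\<And>v e. lin su sz (\<lambda>x. f x v e)"
  shows "lin su sz (\<lambda>x. sw2 H y (f x))"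
  unfolding sw2_def by (rule lin_tlift_param) (use assms in auto)

lemma bilinear_mapI:
  "(\<And>u. lin sv sw (f u)) \<Longrightarrow> (\<And>v. lin su sw (\<lambda>u. f u v)) \<Longrightarrow> bilinear_map su sv sw f"
  by (simp add: bilinear_map_def)

section \<open>Sweedler calculus in a Hopf algebra\<close>

locale hopf =
  fixes H :: "('k::field, 'h::ring_1) hopf_data"
  assumes hopf: "hopf_algebra H"
begin

abbreviation "hs \<equiv> hscale H"

lemma vsH: "vector_space hs"
  using hopf by (simp add: hopf_algebra_def)

lemma lin_comult: "lin hs (tscale hs) (comult H)"
  and lin_counit: "lin hs (*) (counit H)"
  and counit_left: "sw2 H x (\<lambda>a b. hs (counit H a) b) = x"
  and counit_right: "sw2 H x (\<lambda>a b. hs (counit H b) a) = x"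
  and counit_1 [simp]: "counit H 1 = 1"
  and counit_mult: "counit H (x * y) = counit H x * counit H y"
  using hopf by (simp_all add: hopf_algebra_def)

lemma lin_mult: "lin hs hs ((*) a)" "lin hs hs (\<lambda>x. x * b)"
  using hopf by (auto simp: hopf_algebra_def bilinear_map_def)

lemma lin_tens: "vector_space sv \<Longrightarrow> lin hs (tscale sv) (tens H sv v)"
   "vector_space sv \<Longrightarrow> lin sv (tscale sv) (\<lambda>v. tens H sv v h)"
  using bilinear_tens[OF vsH] by (auto simp: bilinear_map_def)

lemma lin_sw2:
  assumes "\<And>b. lin hs s (\<lambda>a. f a b)"
  shows "lin hs s (\<lambda>x. sw2 H x f)"
  unfolding sw2_def by (rule lin_comp[OF lin_tlift lin_comult]) (rule assms)

lemma tlift_tens':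
  assumes "\<And>u. lin hs sz (f u)" "\<And>v. lin sv sz (\<lambda>u. f u v)"
  shows "tlift f (tens H sv v h) = f v h"
  by (rule tlift_tens[OF vsH bilinear_mapI]) (use assms in auto)

text \<open>The coassociativity axiom is an equation in (H \<otimes> H) \<otimes> H. The trilinear
  \<open>f\<close> induces a linear map \<open>?L\<close> on that space, and applying
  \<open>?L\<close> to the axiom gives the identity for \<open>f\<close>. Linearity in each slot is
  what lets \<open>?L\<close> be computed on pure tensors.\<close>

lemma sw2_coassoc:
  assumes "\<And>b c. lin hs s (\<lambda>a. f a b c)" "\<And>a c. lin hs s (\<lambda>b. f a b c)" "\<And>a b. lin hs s (\<lambda>c. f a b c)"
  shows "sw2 H x (\<lambda>y c. sw2 H y (\<lambda>a b. f a b c)) = sw2 H x (\<lambda>a z. sw2 H z (\<lambda>b c. f a b c))"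
proof -
  note vs = lin_target[OF assms(1)]
  have *: "lin (tscale hs) s (tlift (\<lambda>a b. f a b c))" for c
    by (rule lin_tlift) (rule assms)
  have **: "lin hs s (\<lambda>c. tlift (\<lambda>a b. f a b c) u)" for u
    by (intro lin_tlift_param vsH vs assms)
  let ?L = "tlift (\<lambda>u c. tlift (\<lambda>a b. f a b c) u)"
  have L: "?L (tens H (tscale hs) u z) = tlift (\<lambda>a b. f a b z) u" for u z
    by (rule tlift_tens') (rule * **)+
  have linL: "lin (tscale (tscale hs)) s ?L"
    by (rule lin_tlift) (rule *)
  have "?L (sw2 H x (\<lambda>y z. tens H (tscale hs) (comult H y) z)) =
      ?L (sw2 H x (\<lambda>y z. sw2 H z (\<lambda>z1 z2. tens H (tscale hs) (tens H hs y z1) z2)))"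
    using hopf by (simp add: hopf_algebra_def)
  then show ?thesis
    by (simp add: sw2_lin[OF linL] L tlift_tens'[OF assms(2,1)] sw2_def[of H _ "\<lambda>a b. f a b _"])
qed

lemma sw2_mult:
  assumes "\<And>b. lin hs s (\<lambda>a. f a b)" "\<And>a. lin hs s (\<lambda>b. f a b)"
  shows "sw2 H (x * y) f = sw2 H x (\<lambda>x1 x2. sw2 H y (\<lambda>y1 y2. f (x1 * y1) (x2 * y2)))"
proof -
  have "comult H (x * y) =
       sw2 H x (\<lambda>x1 x2. sw2 H y (\<lambda>y1 y2. tens H (hscale H) (x1 * y1) (x2 * y2)))"
    using hopf by (simp add: hopf_algebra_def)
  then show ?thesis
    by (simp add: sw2_def[of H "x * y"] sw2_lin[OF lin_tlift[OF assms(1)]] tlift_tens'[OF assms(2,1)])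
qed

lemma sw2_1:
  assumes "\<And>b. lin hs s (\<lambda>a. f a b)" "\<And>a. lin hs s (\<lambda>b. f a b)"
  shows "sw2 H 1 f = f 1 1"
proof -
  have "comult H 1 = tens H hs 1 1" using hopf by (simp add: hopf_algebra_def)
  then show ?thesis by (simp add: sw2_def tlift_tens'[OF assms(2,1)])
qed

lemma sw2_counit_left:
  assumes "lin hs s f"
  shows "sw2 H x (\<lambda>a b. s (counit H a) (f b)) = f x"
  using arg_cong[OF counit_left[of x], of f] by (simp add: sw2_lin[OF assms] lin_scale[OF assms])

lemma sw2_counit_right:
  assumes "lin hs s f"
  shows "sw2 H x (\<lambda>a b. s (counit H b) (f a)) = f x"
  using arg_cong[OF counit_right[of x], of f] by (simp add: sw2_lin[OF assms] lin_scale[OF assms])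

lemma lin_coord: "lin hs (*) (\<lambda>h. coord H h e)"
  by (rule linI) (auto simp: vsH vector_space_field coord_add coord_scale)

lemma tens_in:
  assumes "vector_space sv" "\<And>c. sv c v \<in> V"
  shows "tens H sv v h \<in> tens_space H V"
proof -
  interpret vector_space sv by fact
  show ?thesis unfolding tens_space_def
    using csupp_subset[OF vsH, of h] assms(2) by (auto simp: lookup_tens vsH assms in_keys_iff csupp_def)
qed

lemma lin_eq_on_basis:
  assumes "lin hs s f" "lin hs s g" "\<And>e. e \<in> basis H \<Longrightarrow> f e = g e"
  shows "f x = g x"
proof -
  have "f (\<Sum>e\<in>csupp H x. hs (coord H x e) e) = g (\<Sum>e\<in>csupp H x. hs (coord H x e) e)"
    using csupp_subset[OF vsH, of x] assms(3)
    by (auto simp: lin_sum[OF assms(1)] lin_sum[OF assms(2)] lin_scale[OF assms(1)] lin_scale[OF assms(2)]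
      intro!: sum.cong)
  then show ?thesis by (simp add: coord_expand vsH)
qed

lemma tens_space_induct [consumes 2, case_names add tens]:
  assumes "u \<in> tens_space H UNIV" "vector_space sv"
    and "\<And>u v. P u \<Longrightarrow> P v \<Longrightarrow> P (u + v)"
    and "\<And>b e. e \<in> basis H \<Longrightarrow> P (tens H sv b e)"
  shows "P u"
proof -
  interpret vector_space sv by fact
  \<comment> \<open>The induction rule has no case for 0: it comes from 0 \<otimes> e for some basis
    vector e, which exists because 1 \<noteq> 0 in H.\<close>
  have "basis H \<noteq> {}"
  proof
    assume "basis H = {}"
    then have "(1::'h) = 0" using coord_expand[OF vsH, of 1] csupp_subset[OF vsH, of 1] by simp
    then show False by simp
  qed
  then obtain e where "e \<in> basis H" by auto
  then have "P (tens H sv 0 e)" by (rule assms(4))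
  then have P0: "P 0" by (simp add: lin_0[OF lin_tens(2)[OF assms(2)]])
  have "P (\<Sum>e\<in>A. tens H sv (Poly_Mapping.lookup u e) e)" if "finite A" "A \<subseteq> basis H" for A
    using that by (induction A) (auto simp: P0 intro: assms(3,4))
  from this[of "Poly_Mapping.keys u"] assms(1)[unfolded tens_space_def] show ?thesis
    using tens_expand[OF vsH assms(2,1)] by simp
qed

end


section \<open>The twisted algebra\<close>

lemma sw2_cong: "(\<And>a b. f a b = g a b) \<Longrightarrow> sw2 H x f = sw2 H x g"
  by (rule arg_cong[of f g]) (intro ext)

context hopf
begin

lemma lin_tens1: "lin su sv f \<Longrightarrow> lin su (tscale sv) (\<lambda>x. tens H sv (f x) h)"
  by (rule lin_comp[OF lin_tens(2)]) (auto dest: lin_target)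

lemma lin_tens2: "vector_space sv \<Longrightarrow> lin su hs g \<Longrightarrow> lin su (tscale sv) (\<lambda>x. tens H sv v (g x))"
  by (rule lin_comp[OF lin_tens(1)])

lemma lin_mult1: "lin su hs f \<Longrightarrow> lin su hs (\<lambda>x. f x * b)"
  by (rule lin_comp[OF lin_mult(2)])

lemma lin_mult2: "lin su hs f \<Longrightarrow> lin su hs (\<lambda>x. b * f x)"
  by (rule lin_comp[OF lin_mult(1)])

lemma lin_sw2_comp:
  "lin su hs g \<Longrightarrow> (\<And>b. lin hs s (\<lambda>a. f a b)) \<Longrightarrow> lin su s (\<lambda>x. sw2 H (g x) f)"
  by (rule lin_comp[OF lin_sw2])

lemma lin_counit_comp: "lin su hs g \<Longrightarrow> lin su (*) (\<lambda>x. counit H (g x))"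
  by (rule lin_comp[OF lin_counit])

lemma lin_field: "lin su (*) f \<Longrightarrow> lin su (*) (\<lambda>x. f x * (c::'k))"
  by (auto intro!: linI dest: lin_source lin_target simp: lin_add lin_scale algebra_simps)

text \<open>The rules are stated for composites, so that linearity of a nested Sweedler expression
  in one of its variables can be proved by resolution alone.\<close>

lemmas lin_intros = lin_field lin_id lin_tens1 lin_tens2 lin_mult1 lin_mult2 lin_sw2_comp lin_sw2_param
  lin_counit_comp lin_scaleI vsH vector_space_field vector_space_tscale

end

text \<open>The scalar multiplication is a parameter because the same twisted product is used over
  k, over the polynomial ring and over its field of fractions.\<close>

locale comm_alg =
  fixes sr :: "'k::field \<Rightarrow> 'r \<Rightarrow> 'r::comm_ring_1"
  assumes vsR: "vector_space sr" and sr_mult: "sr c a * b = sr c (a * b)"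
begin

lemma mult_sr: "a * sr c b = sr c (a * b)"
  using sr_mult[of c b a] by (simp add: mult.commute)

lemma sr_sr: "sr c (sr d a) = sr (c * d) a"
  using vsR by (simp add: vector_space_def)

lemma sr_1: "sr 1 a = a"
  using vsR by (simp add: vector_space_def)

lemma lin_alg1: "lin su sr f \<Longrightarrow> lin su sr (\<lambda>x. f x * b)"
  by (auto intro!: linI dest: lin_source lin_target simp: lin_add lin_scale sr_mult algebra_simps mult_sr)

lemma lin_alg2: "lin su sr f \<Longrightarrow> lin su sr (\<lambda>x. b * f x)"
  using lin_alg1[of su f b] by (simp add: mult.commute)

lemma lin_scal: "lin su (*) f \<Longrightarrow> lin su sr (\<lambda>x. sr (f x) b)"
  by (auto intro!: linI dest: lin_source lin_target simp: lin_add lin_scale vsR sr_sr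
    vector_space.vector_space_assms(2)[OF vsR])

lemmas alg_lin = lin_alg1 lin_alg2 lin_scal vsR

end

locale hopf_cocycle = hopf H for H :: "('k::field, 'h::ring_1) hopf_data" +
  fixes \<alpha> :: "'h \<Rightarrow> 'h \<Rightarrow> 'k"
  assumes two_cocycle: "two_cocycle H (*) \<alpha>"
    and normalized: "normalized_cocycle H (*) \<alpha>"
begin

lemma lin_alpha1: "lin su hs f \<Longrightarrow> lin su (*) (\<lambda>x. \<alpha> (f x) y)"
  and lin_alpha2: "lin su hs f \<Longrightarrow> lin su (*) (\<lambda>x. \<alpha> y (f x))"
  using two_cocycle unfolding two_cocycle_def bilinear_map_def by (auto intro: lin_comp[where f = f])

lemma cocycle:
  "sw2 H x (\<lambda>x1 x2. sw2 H y (\<lambda>y1 y2. \<alpha> x1 y1 * \<alpha> (x2 * y2) z)) =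
      sw2 H y (\<lambda>y1 y2. sw2 H z (\<lambda>z1 z2. \<alpha> y1 z1 * \<alpha> x (y2 * z2)))"
  using two_cocycle by (simp add: two_cocycle_def)

lemma alpha_1 [simp]: "\<alpha> x 1 = counit H x" "\<alpha> 1 x = counit H x"
  using normalized by (simp_all add: normalized_cocycle_def)

text \<open>The product of the twisted algebra for k-valued \<alpha>, with the whole type as
  coefficient algebra. It depends on the coefficients only through \<open>sr\<close>, which permits
  a change of coefficients between different types.\<close>

definition tmult :: "('k \<Rightarrow> 'r \<Rightarrow> 'r::comm_ring_1) \<Rightarrow> ('h \<Rightarrow>\<^sub>0 'r) \<Rightarrow> ('h \<Rightarrow>\<^sub>0 'r) \<Rightarrow> ('h \<Rightarrow>\<^sub>0 'r)" where
  "tmult sr p q = tlift (\<lambda>b x. tlift (\<lambda>c y.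
     sw2 H x (\<lambda>x1 x2. sw2 H y (\<lambda>y1 y2. tens H sr (sr (\<alpha> x1 y1) (b * c)) (x2 * y2)))) q) p"

end

locale twisted = hopf_cocycle H \<alpha> + comm_alg sr
  for H :: "('k::field, 'h::ring_1) hopf_data" and \<alpha> and sr :: "'k \<Rightarrow> 'r \<Rightarrow> 'r::comm_ring_1"
begin

abbreviation T :: "'r \<Rightarrow> 'h \<Rightarrow> 'h \<Rightarrow>\<^sub>0 'r" where "T \<equiv> tens H sr"
abbreviation M (infixl \<open>\<star>\<close> 70) where "M \<equiv> tmult sr"

lemmas lins = lin_intros alg_lin lin_alpha1 lin_alpha2

lemma twisted_algebra_sel:
  defines "A \<equiv> \<lambda>R u. twisted_algebra H sr R (\<lambda>x y. sr (\<alpha> x y) 1) u"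
  shows "carrier (A R u) = tens_space H R" "p \<otimes>\<^bsub>A R u\<^esub> q = p \<star> q" "\<one>\<^bsub>A R u\<^esub> = T u 1"
    "c \<odot>\<^bsub>A R u\<^esub> p = tscale sr c p" "p \<oplus>\<^bsub>A R u\<^esub> q = p + q" "\<zero>\<^bsub>A R u\<^esub> = 0"
  by (simp_all add: A_def twisted_algebra_def tmult_def mult_sr)

lemma lin_tmult_right: "lin (tscale sr) (tscale sr) ((\<star>) p)"
  unfolding tmult_def by (intro lin_tlift_param lin_tlift) (intro lins)+

lemma lin_tmult_left: "lin (tscale sr) (tscale sr) (\<lambda>p. p \<star> q)"
  unfolding tmult_def by (intro lin_tlift_param lin_tlift; (intro lins)?)

lemma lin_tmult1: "lin su (tscale sr) f \<Longrightarrow> lin su (tscale sr) (\<lambda>x. f x \<star> q)"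
  by (rule lin_comp[OF lin_tmult_left])

lemma lin_tmult2: "lin su (tscale sr) f \<Longrightarrow> lin su (tscale sr) (\<lambda>x. p \<star> f x)"
  by (rule lin_comp[OF lin_tmult_right])

lemma T_mult:
  "T b x \<star> T c y = sw2 H x (\<lambda>x1 x2. sw2 H y (\<lambda>y1 y2. T (sr (\<alpha> x1 y1) (b * c)) (x2 * y2)))"
proof -
  let ?f = "\<lambda>b x c y. sw2 H x (\<lambda>x1 x2. sw2 H y (\<lambda>y1 y2. T (sr (\<alpha> x1 y1) (b * c)) (x2 * y2)))"
  have "tlift (?f b x) (T c y) = ?f b x c y" for b x
    by (rule tlift_tens'[where sz = "tscale sr"]) (intro lins)+
  moreover have "tlift (\<lambda>b x. tlift (?f b x) (T c y)) (T b x) = tlift (?f b x) (T c y)"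
    by (rule tlift_tens'[where sz = "tscale sr"]; intro lin_tlift_param; intro lins)
  ultimately show ?thesis by (simp add: tmult_def)
qed

lemma T_in: "T b x \<in> tens_space H UNIV"
  by (rule tens_in) (auto intro: vsR)

lemma tens_space_sum: "(\<And>a. a \<in> A \<Longrightarrow> f a \<in> tens_space H UNIV) \<Longrightarrow> (\<Sum>a\<in>A. f a) \<in> tens_space H (UNIV :: 'r set)"
  by (induction A rule: infinite_finite_induct)
    (auto simp: tens_space_def dest!: subsetD[OF Poly_Mapping.keys_add])

lemma sw2_in: "(\<And>a b. f a b \<in> tens_space H UNIV) \<Longrightarrow> sw2 H x f \<in> tens_space H (UNIV :: 'r set)"
  unfolding sw2_def tlift_def by (rule tens_space_sum)

lemma tmult_in: "p \<star> q \<in> tens_space H UNIV"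
  unfolding tmult_def tlift_def by (intro tens_space_sum sw2_in T_in)

text \<open>Multiplicativity and coassociativity of \<Delta> bring both bracketings into a form in
  which the last legs of x, y, z make up the factor in H and the leading legs enter only the
  scalars. The scalars are then the two sides of the cocycle identity.\<close>

lemma T_assoc: "T b x \<star> T c y \<star> T d z = T b x \<star> (T c y \<star> T d z)"
proof -
  let ?t = "\<lambda>k h. T (sr k (b * c * d)) h"
  have lint: "lin (*) (tscale sr) (\<lambda>k. ?t k h)" for h
    by (intro lins)
  have mult_yz: "sw2 H y' (\<lambda>y2 y3. sw2 H z' (\<lambda>z2 z3. ?t (k * \<alpha> x' (y2 * z2)) (x3 * (y3 * z3)))) =
      sw2 H (y' * z') (\<lambda>p q. ?t (k * \<alpha> x' p) (x3 * q))" for k x' x3 y' z'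
    by (rule sw2_mult[where s = "tscale sr" and f = "\<lambda>p q. ?t (k * \<alpha> x' p) (x3 * q)", symmetric]; intro lins)
  have "T b x \<star> T c y \<star> T d z =
    sw2 H x (\<lambda>x1 x2. sw2 H y (\<lambda>y1 y2. T (sr (\<alpha> x1 y1) (b * c)) (x2 * y2) \<star> T d z))"
    by (simp add: T_mult[of b x] sw2_lin[OF lin_tmult_left])
  also have "\<dots> = sw2 H x (\<lambda>x1 x2. sw2 H y (\<lambda>y1 y2. sw2 H x2 (\<lambda>x2 x3. sw2 H y2 (\<lambda>y2 y3. sw2 H z (\<lambda>z1 z2.
      ?t (\<alpha> x1 y1 * \<alpha> (x2 * y2) z1) (x3 * y3 * z2))))))"
    unfolding T_mult
    by (subst sw2_mult[where s = "tscale sr"] | intro lins)+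
      (simp add: sr_mult mult_sr sr_sr mult.commute)
  also have "\<dots> = sw2 H x (\<lambda>x1 x2. sw2 H x2 (\<lambda>x2 x3. sw2 H y (\<lambda>y1 y2. sw2 H y2 (\<lambda>y2 y3. sw2 H z (\<lambda>z1 z2.
      ?t (\<alpha> x1 y1 * \<alpha> (x2 * y2) z1) (x3 * y3 * z2))))))"
    by (rule sw2_cong, rule sw2_swap)
  also have "\<dots> = sw2 H x (\<lambda>x' x3. sw2 H x' (\<lambda>x1 x2. sw2 H y (\<lambda>y1 y2. sw2 H y2 (\<lambda>y2 y3. sw2 H z (\<lambda>z1 z2.
      ?t (\<alpha> x1 y1 * \<alpha> (x2 * y2) z1) (x3 * y3 * z2))))))"
    by (rule sw2_coassoc[where s = "tscale sr", symmetric]; intro lins)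
  also have "\<dots> = sw2 H x (\<lambda>x' x3. sw2 H x' (\<lambda>x1 x2. sw2 H y (\<lambda>y' y3. sw2 H y' (\<lambda>y1 y2. sw2 H z (\<lambda>z1 z2.
      ?t (\<alpha> x1 y1 * \<alpha> (x2 * y2) z1) (x3 * y3 * z2))))))"
    by (rule sw2_cong, rule sw2_cong, rule sw2_coassoc[where s = "tscale sr", symmetric]; intro lins)
  also have "\<dots> = sw2 H x (\<lambda>x' x3. sw2 H y (\<lambda>y' y3. sw2 H x' (\<lambda>x1 x2. sw2 H z (\<lambda>z1 z2. sw2 H y' (\<lambda>y1 y2.
      ?t (\<alpha> x1 y1 * \<alpha> (x2 * y2) z1) (x3 * y3 * z2))))))"
    by (rule sw2_cong, subst sw2_swap, (rule sw2_cong)+, rule sw2_swap)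
  also have "\<dots> = sw2 H x (\<lambda>x' x3. sw2 H y (\<lambda>y' y3. sw2 H z (\<lambda>z1 z2. sw2 H x' (\<lambda>x1 x2. sw2 H y' (\<lambda>y1 y2.
      ?t (\<alpha> x1 y1 * \<alpha> (x2 * y2) z1) (x3 * y3 * z2))))))"
    by (rule sw2_cong, rule sw2_cong, rule sw2_swap)
  also have "\<dots> = sw2 H x (\<lambda>x' x3. sw2 H y (\<lambda>y' y3. sw2 H z (\<lambda>z1 z2.
      ?t (sw2 H x' (\<lambda>x1 x2. sw2 H y' (\<lambda>y1 y2. \<alpha> x1 y1 * \<alpha> (x2 * y2) z1))) (x3 * y3 * z2))))"
    by (simp only: sw2_lin[OF lint])
  \<comment> \<open>The cocycle identity is applied to x', y' and the first leg of z; the factor in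
    H is untouched.\<close>
  also have "\<dots> = sw2 H x (\<lambda>x' x3. sw2 H y (\<lambda>y' y3. sw2 H z (\<lambda>z' z3.
      ?t (sw2 H y' (\<lambda>y1 y2. sw2 H z' (\<lambda>z1 z2. \<alpha> y1 z1 * \<alpha> x' (y2 * z2)))) (x3 * y3 * z3))))"
    by (simp only: cocycle)
  also have "\<dots> = sw2 H x (\<lambda>x' x3. sw2 H y (\<lambda>y' y3. sw2 H z (\<lambda>z' z3. sw2 H y' (\<lambda>y1 y2. sw2 H z' (\<lambda>z1 z2.
      ?t (\<alpha> y1 z1 * \<alpha> x' (y2 * z2)) (x3 * (y3 * z3)))))))"
    by (simp only: sw2_lin[OF lint] mult.assoc[where 'a = 'h])
  also have "\<dots> = sw2 H x (\<lambda>x' x3. sw2 H y (\<lambda>y' y3. sw2 H y' (\<lambda>y1 y2. sw2 H z (\<lambda>z' z3. sw2 H z' (\<lambda>z1 z2.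
      ?t (\<alpha> y1 z1 * \<alpha> x' (y2 * z2)) (x3 * (y3 * z3)))))))"
    by (rule sw2_cong, rule sw2_cong, rule sw2_swap)
  also have "\<dots> = sw2 H x (\<lambda>x' x3. sw2 H y (\<lambda>y1 y'. sw2 H y' (\<lambda>y2 y3. sw2 H z (\<lambda>z' z3. sw2 H z' (\<lambda>z1 z2.
      ?t (\<alpha> y1 z1 * \<alpha> x' (y2 * z2)) (x3 * (y3 * z3)))))))"
    by (rule sw2_cong, rule sw2_coassoc[where s = "tscale sr"]; intro lins)
  also have "\<dots> = sw2 H x (\<lambda>x' x3. sw2 H y (\<lambda>y1 y'. sw2 H y' (\<lambda>y2 y3. sw2 H z (\<lambda>z1 z'. sw2 H z' (\<lambda>z2 z3.
      ?t (\<alpha> y1 z1 * \<alpha> x' (y2 * z2)) (x3 * (y3 * z3)))))))"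
    by (rule sw2_cong, rule sw2_cong, rule sw2_cong, rule sw2_coassoc[where s = "tscale sr"]; intro lins)
  also have "\<dots> = sw2 H x (\<lambda>x' x3. sw2 H y (\<lambda>y1 y'. sw2 H z (\<lambda>z1 z'. sw2 H y' (\<lambda>y2 y3. sw2 H z' (\<lambda>z2 z3.
      ?t (\<alpha> y1 z1 * \<alpha> x' (y2 * z2)) (x3 * (y3 * z3)))))))"
    by (rule sw2_cong, rule sw2_cong, rule sw2_swap)
  also have "\<dots> = sw2 H y (\<lambda>y1 y'. sw2 H x (\<lambda>x' x3. sw2 H z (\<lambda>z1 z'. sw2 H y' (\<lambda>y2 y3. sw2 H z' (\<lambda>z2 z3.
      ?t (\<alpha> y1 z1 * \<alpha> x' (y2 * z2)) (x3 * (y3 * z3)))))))"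
    by (rule sw2_swap)
  also have "\<dots> = sw2 H y (\<lambda>y1 y'. sw2 H z (\<lambda>z1 z'. sw2 H x (\<lambda>x' x3. sw2 H y' (\<lambda>y2 y3. sw2 H z' (\<lambda>z2 z3.
      ?t (\<alpha> y1 z1 * \<alpha> x' (y2 * z2)) (x3 * (y3 * z3)))))))"
    by (rule sw2_cong, rule sw2_swap)
  also have "\<dots> = sw2 H y (\<lambda>y1 y'. sw2 H z (\<lambda>z1 z'. sw2 H x (\<lambda>x' x3. sw2 H (y' * z') (\<lambda>p q.
      ?t (\<alpha> y1 z1 * \<alpha> x' p) (x3 * q)))))"
    by (simp only: mult_yz)
  also have "\<dots> = sw2 H y (\<lambda>y1 y'. sw2 H z (\<lambda>z1 z'. T b x \<star> T (sr (\<alpha> y1 z1) (c * d)) (y' * z')))"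
    by (simp only: T_mult mult_sr sr_sr ac_simps)
  also have "\<dots> = T b x \<star> (T c y \<star> T d z)"
    by (simp only: T_mult[of c y] sw2_lin[OF lin_tmult_right])
  finally show ?thesis .
qed

end


section \<open>Generic homomorphisms\<close>

text \<open>The image of \<open>Xgen H h\<close> under the morphism attached to a linear map
  \<open>l\<close>: the generic one for \<open>l\<close> = \<open>tgen H\<close>, a specialization
  for a linear form \<open>l\<close> on H.\<close>

definition (in hopf) gen :: "('k \<Rightarrow> 'r \<Rightarrow> 'r) \<Rightarrow> ('h \<Rightarrow> 'r::comm_ring_1) \<Rightarrow> 'h \<Rightarrow> ('h \<Rightarrow>\<^sub>0 'r)" where
  "gen sr l h = sw2 H h (\<lambda>h1 h2. tens H sr (l h1) h2)"

definition (in hopf_cocycle) word ::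
    "('k \<Rightarrow> 'r \<Rightarrow> 'r) \<Rightarrow> ('h \<Rightarrow> 'r::comm_ring_1) \<Rightarrow> 'h list \<Rightarrow> ('h \<Rightarrow>\<^sub>0 'r)" where
  "word sr l w = foldr (\<lambda>e a. tmult sr (gen sr l e) a) w (tens H sr 1 1)"

text \<open>The morphism produced by \<open>talg_lift\<close>, freed from the algebra records, so
  that the generic morphism and its specializations are instances of one formula.\<close>

definition (in hopf_cocycle) talg ::
    "('k \<Rightarrow> 'r \<Rightarrow> 'r) \<Rightarrow> ('h \<Rightarrow> 'r::comm_ring_1) \<Rightarrow> ('h, 'k) free_alg \<Rightarrow> ('h \<Rightarrow>\<^sub>0 'r)" where
  "talg sr l P = (\<Sum>w\<in>Poly_Mapping.keys P. tscale sr (Poly_Mapping.lookup P w) (word sr l (letters w)))"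

context twisted
begin

lemma tmult_add: "(p + p') \<star> q = p \<star> q + p' \<star> q" "p \<star> (q + q') = p \<star> q + p \<star> q'"
  by (simp_all add: lin_add[OF lin_tmult_left] lin_add[OF lin_tmult_right])

lemma tmult_scale: "tscale sr c p \<star> q = tscale sr c (p \<star> q)" "p \<star> tscale sr c q = tscale sr c (p \<star> q)"
  by (simp_all add: lin_scale[OF lin_tmult_left] lin_scale[OF lin_tmult_right])

lemma tmult_0: "0 \<star> q = 0" "p \<star> 0 = 0"
  by (simp_all add: lin_0[OF lin_tmult_left] lin_0[OF lin_tmult_right])

lemma tmult_assoc:
  assumes "p \<in> tens_space H UNIV" "q \<in> tens_space H UNIV" "r \<in> tens_space H UNIV"
  shows "p \<star> q \<star> r = p \<star> (q \<star> r)"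
  using assms(1) vsR
proof (induction rule: tens_space_induct)
  case (tens b x)
  show ?case using assms(2) vsR
  proof (induction rule: tens_space_induct)
    case (tens c y)
    show ?case using assms(3) vsR
      by (induction rule: tens_space_induct) (simp_all add: tmult_add T_assoc)
  qed (simp_all add: tmult_add)
qed (simp_all add: tmult_add)

lemma T_scale: "T (sr k c) h = tscale sr k (T c h)"
  by (simp add: lin_scale[OF lin_tens(2)[OF vsR]])

lemma tmult_1_left:
  assumes "q \<in> tens_space H UNIV"
  shows "T 1 1 \<star> q = q"
  using assms vsR
proof (induction rule: tens_space_induct)
  case (tens c y)
  have "T 1 1 \<star> T c y = sw2 H y (\<lambda>y1 y2. T (sr (\<alpha> 1 y1) (1 * c)) (1 * y2))"
    unfolding T_mult by (rule sw2_1[where s = "tscale sr"]; intro lins)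
  also have "\<dots> = T c y"
    using sw2_counit_left[OF lin_tens(1)[OF vsR]] by (simp add: T_scale)
  finally show ?case .
qed (simp add: tmult_add)

lemma tmult_1_right:
  assumes "q \<in> tens_space H UNIV"
  shows "q \<star> T 1 1 = q"
  using assms vsR
proof (induction rule: tens_space_induct)
  case (tens c y)
  have "T c y \<star> T 1 1 = sw2 H y (\<lambda>y1 y2. T (sr (\<alpha> y1 1) (c * 1)) (y2 * 1))"
    unfolding T_mult by (rule sw2_cong, rule sw2_1[where s = "tscale sr"]; intro lins)
  also have "\<dots> = T c y"
    using sw2_counit_left[OF lin_tens(1)[OF vsR]] by (simp add: T_scale)
  finally show ?case .
qed (simp add: tmult_add)

lemma gen_in: "gen sr l h \<in> tens_space H UNIV"
  unfolding gen_def by (intro sw2_in T_in)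

lemma lin_gen: "lin hs sr l \<Longrightarrow> lin hs (tscale sr) (gen sr l)"
  unfolding gen_def by (rule lin_sw2) (rule lin_tens1)

lemma word_Nil: "word sr l [] = T 1 1"
  and word_Cons: "word sr l (e # w) = gen sr l e \<star> word sr l w"
  by (simp_all add: word_def)

lemma word_in: "word sr l w \<in> tens_space H UNIV"
  by (cases w) (simp_all add: word_Nil word_Cons T_in tmult_in)

lemma word_append: "word sr l (v @ w) = word sr l v \<star> word sr l w"
  by (induction v) (simp_all add: word_Nil word_Cons tmult_1_left word_in tmult_assoc gen_in)

lemma vs_tscale: "vector_space (tscale sr)"
  by (rule vector_space_tscale[OF vsR])

lemma tscale_in: "u \<in> tens_space H UNIV \<Longrightarrow> tscale sr c u \<in> tens_space H UNIV"
  using keys_pmmap[of "sr c" u] by (auto simp: tens_space_def tscale_pmmap)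

lemma talg_in: "talg sr l P \<in> tens_space H UNIV"
  unfolding talg_def by (intro tens_space_sum tscale_in word_in)

lemma talg_add: "talg sr l (P + Q) = talg sr l P + talg sr l Q"
proof -
  interpret V: vector_space "tscale sr :: _ \<Rightarrow> ('h \<Rightarrow>\<^sub>0 'r) \<Rightarrow> _" by (rule vs_tscale)
  show ?thesis unfolding talg_def
    by (rule sum_keys_add[where g = "\<lambda>w c. tscale sr c (word sr l (letters w))"])
      (simp_all add: V.scale_left_distrib)
qed

lemma talg_0: "talg sr l 0 = 0"
  by (simp add: talg_def)

lemma talg_single: "talg sr l (Poly_Mapping.single w c) = tscale sr c (word sr l (letters w))"
proof -
  interpret V: vector_space "tscale sr :: _ \<Rightarrow> ('h \<Rightarrow>\<^sub>0 'r) \<Rightarrow> _" by (rule vs_tscale)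
  show ?thesis by (simp add: talg_def)
qed

lemma talg_sum: "talg sr l (sum f A) = (\<Sum>a\<in>A. talg sr l (f a))"
  by (induction A rule: infinite_finite_induct) (simp_all add: talg_0 talg_add)

lemma talg_mult: "talg sr l (P * Q) = talg sr l P \<star> talg sr l Q"
proof (induction P rule: poly_mapping_single_induct)
  case (2 v c)
  show ?case
  proof (induction Q rule: poly_mapping_single_induct)
    case (2 w d)
    interpret V: vector_space "tscale sr :: _ \<Rightarrow> ('h \<Rightarrow>\<^sub>0 'r) \<Rightarrow> _" by (rule vs_tscale)
    show ?case
      by (simp add: mult_single talg_single plus_free_monoid_def word_append tmult_scale)
  qed (simp_all add: talg_0 talg_add tmult_0 tmult_add distrib_left)
qed (simp_all add: talg_0 talg_add tmult_0 tmult_add distrib_right)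

lemma talg_1: "talg sr l 1 = T 1 1"
proof -
  interpret V: vector_space "tscale sr :: _ \<Rightarrow> ('h \<Rightarrow>\<^sub>0 'r) \<Rightarrow> _" by (rule vs_tscale)
  show ?thesis
    by (simp add: single_one[symmetric] talg_single zero_free_monoid_def word_Nil del: single_one)
qed

lemma talg_scale: "talg sr l (Poly_Mapping.map ((*) c) P) = tscale sr c (talg sr l P)"
proof -
  interpret V: vector_space "tscale sr :: _ \<Rightarrow> ('h \<Rightarrow>\<^sub>0 'r) \<Rightarrow> _" by (rule vs_tscale)
  have add: "pmmap ((*) c) (P + Q) = pmmap ((*) c) P + pmmap ((*) c) Q" for P Q :: "('h, 'k) free_alg"
    by (rule poly_mapping_eqI) (simp add: lookup_pmmap lookup_add distrib_left)
  have zero: "pmmap ((*) c) 0 = (0 :: ('h, 'k) free_alg)"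
    by (rule poly_mapping_eqI) (simp add: lookup_pmmap)
  have single: "pmmap ((*) c) (Poly_Mapping.single w d) = Poly_Mapping.single w (c * d)" for w :: "'h free_monoid" and d
    by (rule poly_mapping_eqI) (simp add: lookup_pmmap lookup_single when_def)
  have "talg sr l (pmmap ((*) c) P) = tscale sr c (talg sr l P)"
    by (induction P rule: poly_mapping_single_induct)
      (simp_all add: add zero single talg_single talg_add V.scale_right_distrib talg_0)
  then show ?thesis by (simp add: pmmap_def)
qed

lemma talg_letter: "talg sr l (Poly_Mapping.single (Letters [e]) 1) = gen sr l e"
proof -
  interpret V: vector_space "tscale sr :: _ \<Rightarrow> ('h \<Rightarrow>\<^sub>0 'r) \<Rightarrow> _" by (rule vs_tscale)
  show ?thesis by (simp add: talg_single word_Nil word_Cons tmult_1_right gen_in)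
qed

lemma talg_Xgen:
  assumes "lin hs sr l"
  shows "talg sr l (Xgen H h) = gen sr l h"
proof -
  have "talg sr l (Xgen H h) = (\<Sum>e\<in>csupp H h. tscale sr (coord H h e) (gen sr l e))"
    by (simp add: Xgen_def talg_sum talg_single word_Nil word_Cons tmult_1_right gen_in)
  also have "\<dots> = gen sr l (\<Sum>e\<in>csupp H h. hs (coord H h e) e)"
    by (simp add: lin_sum[OF lin_gen[OF assms]] lin_scale[OF lin_gen[OF assms]])
  finally show ?thesis by (simp add: coord_expand vsH)
qed

lemma talg_lift_eq: "talg_lift (twisted_algebra H sr R (\<lambda>x y. sr (\<alpha> x y) 1) 1) (gen sr l) = talg sr l"
  by (simp add: talg_lift_def talg_def word_def twisted_algebra_sel fun_eq_iff)

end

section \<open>Change of coefficients\<close>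

context hopf_cocycle
begin

lemma pmmap_tens:
  assumes "lin sr ss \<theta>"
  shows "pmmap \<theta> (tens H sr v h) = tens H ss (\<theta> v) h"
  by (rule poly_mapping_eqI)
    (simp add: lookup_pmmap lin_0[OF assms] lookup_tens vsH lin_source[OF assms] lin_target[OF assms] lin_scale[OF assms])

lemma pmmap_gen:
  assumes "lin sr ss \<theta>"
  shows "pmmap \<theta> (gen sr l h) = gen ss (\<lambda>x. \<theta> (l x)) h"
  by (simp add: gen_def sw2_lin[OF lin_pmmap[OF assms]] pmmap_tens[OF assms])

lemma pmmap_in: "u \<in> tens_space H UNIV \<Longrightarrow> pmmap \<theta> u \<in> tens_space H UNIV"
  using keys_pmmap[of \<theta> u] by (auto simp: tens_space_def)

text \<open>Three maps are allowed so that one statement covers two uses: ring homomorphisms, where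
  all three agree, and multiplication by a constant, where one of \<open>\<theta>1\<close>,
  \<open>\<theta>2\<close> is the identity. Since \<alpha> has values in k, linearity moves
  \<open>\<theta>\<close> past the cocycle.\<close>

lemma pmmap_tmult:
  assumes "comm_alg sr" "comm_alg ss" "lin sr ss \<theta>" "lin sr ss \<theta>1" "lin sr ss \<theta>2"
    and \<theta>: "\<And>b c. \<theta> (b * c) = \<theta>1 b * \<theta>2 c"
    and p: "p \<in> tens_space H UNIV" and q: "q \<in> tens_space H UNIV"
  shows "pmmap \<theta> (tmult sr p q) = tmult ss (pmmap \<theta>1 p) (pmmap \<theta>2 q)"
proof -
  interpret R: comm_alg sr by fact
  interpret S: comm_alg ss by fact
  interpret R: twisted H \<alpha> sr by unfold_locales
  interpret S: twisted H \<alpha> ss by unfold_locales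
  note L = lin_pmmap[OF assms(3)] lin_pmmap[OF assms(4)] lin_pmmap[OF assms(5)]
  note A = L[THEN lin_add] R.tmult_add S.tmult_add
  show ?thesis
    using p R.vsR
  proof (induction rule: tens_space_induct)
    case (tens b x)
    show ?case using q R.vsR
    proof (induction rule: tens_space_induct)
      case (tens c y)
      show ?case
        by (simp add: pmmap_tens[OF assms(3)] pmmap_tens[OF assms(4)] pmmap_tens[OF assms(5)] R.T_mult S.T_mult
          sw2_lin[OF L(1)] lin_scale[OF assms(3)] \<theta>)
    qed (simp_all add: A)
  qed (simp_all add: A)
qed

text \<open>Specialization: a homomorphism of coefficient algebras respects products and sends the
  image of each letter under the morphism attached to \<open>l\<close> to its image under the one
  attached to \<open>\<theta> \<circ> l\<close>.\<close>

lemma pmmap_talg: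
  assumes "comm_alg sr" "comm_alg ss" "lin sr ss \<theta>"
    and \<theta>: "\<And>b c. \<theta> (b * c) = \<theta> b * \<theta> c" "\<theta> 1 = 1"
  shows "pmmap \<theta> (talg sr l P) = talg ss (\<lambda>x. \<theta> (l x)) P"
proof -
  interpret R: comm_alg sr by fact
  interpret S: comm_alg ss by fact
  interpret R: twisted H \<alpha> sr by unfold_locales
  interpret S: twisted H \<alpha> ss by unfold_locales
  have "pmmap \<theta> (word sr l w) = word ss (\<lambda>x. \<theta> (l x)) w" for w
    by (induction w) (simp_all add: R.word_Nil S.word_Nil R.word_Cons S.word_Cons pmmap_tens[OF assms(3)] \<theta>
        pmmap_tmult[OF assms(1-3,3,3) \<theta>(1)] R.gen_in R.word_in pmmap_gen[OF assms(3)])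
  then show ?thesis
    by (simp add: talg_def lin_sum[OF lin_pmmap[OF assms(3)]] lin_scale[OF lin_pmmap[OF assms(3)]])
qed

end


section \<open>Compatibility with the coactions\<close>

lemma sw2_plus: "sw2 H x (\<lambda>a b. f a b + g a b) = sw2 H x f + sw2 H x g"
  by (simp add: sw2_def tlift_def sum.distrib)

text \<open>Coassociativity of H \<otimes> H: the sums over the legs of x and of y are separated,
  rebracketed one after the other, and interleaved again.\<close>

lemma (in hopf) sw2_coassoc2:
  assumes "\<And>x2 x3 y1 y2 y3. lin hs s (\<lambda>x1. F x1 x2 x3 y1 y2 y3)"
    "\<And>x1 x3 y1 y2 y3. lin hs s (\<lambda>x2. F x1 x2 x3 y1 y2 y3)"
    "\<And>x1 x2 y1 y2 y3. lin hs s (\<lambda>x3. F x1 x2 x3 y1 y2 y3)"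
    "\<And>x1 x2 x3 y2 y3. lin hs s (\<lambda>y1. F x1 x2 x3 y1 y2 y3)"
    "\<And>x1 x2 x3 y1 y3. lin hs s (\<lambda>y2. F x1 x2 x3 y1 y2 y3)"
    "\<And>x1 x2 x3 y1 y2. lin hs s (\<lambda>y3. F x1 x2 x3 y1 y2 y3)"
  shows "sw2 H x (\<lambda>x' x3. sw2 H y (\<lambda>y' y3. sw2 H x' (\<lambda>x1 x2. sw2 H y' (\<lambda>y1 y2. F x1 x2 x3 y1 y2 y3)))) =
    sw2 H x (\<lambda>x1 x'. sw2 H y (\<lambda>y1 y'. sw2 H x' (\<lambda>x2 x3. sw2 H y' (\<lambda>y2 y3. F x1 x2 x3 y1 y2 y3))))"
proof -
  note vs = lin_target[OF assms(1)]
  have "sw2 H x (\<lambda>x' x3. sw2 H y (\<lambda>y' y3. sw2 H x' (\<lambda>x1 x2. sw2 H y' (\<lambda>y1 y2. F x1 x2 x3 y1 y2 y3)))) =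
     sw2 H x (\<lambda>x' x3. sw2 H x' (\<lambda>x1 x2. sw2 H y (\<lambda>y' y3. sw2 H y' (\<lambda>y1 y2. F x1 x2 x3 y1 y2 y3))))"
    by (rule sw2_cong, rule sw2_swap)
  also have "\<dots> = sw2 H x (\<lambda>x1 x'. sw2 H x' (\<lambda>x2 x3. sw2 H y (\<lambda>y' y3. sw2 H y' (\<lambda>y1 y2. F x1 x2 x3 y1 y2 y3))))"
    by (rule sw2_coassoc[where s = s]; intro lin_sw2_param vs vsH assms)
  also have "\<dots> = sw2 H x (\<lambda>x1 x'. sw2 H x' (\<lambda>x2 x3. sw2 H y (\<lambda>y1 y'. sw2 H y' (\<lambda>y2 y3. F x1 x2 x3 y1 y2 y3))))"
    by (rule sw2_cong, rule sw2_cong, rule sw2_coassoc[where s = s]; intro assms)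
  also have "\<dots> = sw2 H x (\<lambda>x1 x'. sw2 H y (\<lambda>y1 y'. sw2 H x' (\<lambda>x2 x3. sw2 H y' (\<lambda>y2 y3. F x1 x2 x3 y1 y2 y3))))"
    by (rule sw2_cong, rule sw2_swap)
  finally show ?thesis .
qed

lemma (in hopf) lin_free_mult:
  "lin (tscale (*)) (tscale (*)) (\<lambda>a :: ('h, 'k) free_alg. a * b)"
  "lin (tscale (*)) (tscale (*)) (\<lambda>b :: ('h, 'k) free_alg. a * b)"
proof -
  have vs: "vector_space (tscale (*) :: _ \<Rightarrow> ('h, 'k) free_alg \<Rightarrow> _)"
    by (intro vector_space_tscale vector_space_field)
  \<comment> \<open>Scalars act as multiplication by constants, and these are central in the free
    algebra.\<close>
  have sc: "tscale (*) c a = Poly_Mapping.single 0 c * a" for c and a :: "('h, 'k) free_alg"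
    by (simp add: tscale_def mult_map_scale_conv_mult)
  have com: "a * Poly_Mapping.single 0 c = Poly_Mapping.single 0 c * a" for c and a :: "('h, 'k) free_alg"
    by (induction a rule: poly_mapping_single_induct) (simp_all add: mult_single distrib_left distrib_right mult.commute)
  show "lin (tscale (*)) (tscale (*)) (\<lambda>a :: ('h, 'k) free_alg. a * b)"
    by (rule linI) (simp_all add: vs distrib_right sc mult.assoc)
  show "lin (tscale (*)) (tscale (*)) (\<lambda>b :: ('h, 'k) free_alg. a * b)"
    by (rule linI) (simp_all add: vs distrib_left sc mult.assoc[symmetric] com)
qed

context twisted
begin

abbreviation "TT \<equiv> tens H (tscale sr)"
abbreviation "D \<equiv> twisted_coaction H sr"

lemma lin_D: "lin (tscale sr) (tscale (tscale sr)) D"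
  unfolding twisted_coaction_def by (rule lin_tlift) (intro lins)

lemma D_T: "D (T b x) = sw2 H x (\<lambda>x1 x2. TT (T b x1) x2)"
  unfolding twisted_coaction_def by (rule tlift_tens'[where sz = "tscale (tscale sr)"]) (intro lins)+

text \<open>The coaction is multiplicative: \<alpha> consumes the first legs and \<Delta> splits the
  remaining product, so after rebracketing the first two legs form a product in the twisted
  algebra.\<close>

lemma D_T_mult:
  "D (T a x \<star> T b y) = sw2 H x (\<lambda>x1 x2. sw2 H y (\<lambda>y1 y2. TT (T a x1 \<star> T b y1) (x2 * y2)))"
proof -
  let ?F = "\<lambda>x1 x2 x3 y1 y2 y3. TT (T (sr (\<alpha> x1 y1) (a * b)) (x2 * y2)) (x3 * y3)"
  have "D (T a x \<star> T b y) = sw2 H x (\<lambda>x1 x2. sw2 H y (\<lambda>y1 y2. sw2 H (x2 * y2) (\<lambda>p q.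
      TT (T (sr (\<alpha> x1 y1) (a * b)) p) q)))"
    by (simp only: T_mult sw2_lin[OF lin_D] D_T)
  also have "\<dots> = sw2 H x (\<lambda>x1 x'. sw2 H y (\<lambda>y1 y'. sw2 H x' (\<lambda>x2 x3. sw2 H y' (\<lambda>y2 y3.
      ?F x1 x2 x3 y1 y2 y3))))"
    by (rule sw2_cong, rule sw2_cong, rule sw2_mult[where s = "tscale (tscale sr)"]; intro lins)
  also have "\<dots> = sw2 H x (\<lambda>x' x3. sw2 H y (\<lambda>y' y3. sw2 H x' (\<lambda>x1 x2. sw2 H y' (\<lambda>y1 y2.
      ?F x1 x2 x3 y1 y2 y3))))"
    by (rule sw2_coassoc2[where s = "tscale (tscale sr)", symmetric]; intro lins)
  also have "\<dots> = sw2 H x (\<lambda>x1 x2. sw2 H y (\<lambda>y1 y2. TT (T a x1 \<star> T b y1) (x2 * y2)))"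
    by (simp only: T_mult sw2_lin[OF lin_tens(2)[OF vs_tscale]])
  finally show ?thesis .
qed

text \<open>The right-hand side is the product of \<Sum> \<open>gen sr l e1\<close> \<otimes>
  \<open>e2\<close>, the coaction of a generator, with \<open>D u\<close>. It is the recursion step
  for the coaction on words.\<close>

lemma D_gen_mult:
  assumes l: "lin hs sr l" and "u \<in> tens_space H UNIV"
  shows "D (gen sr l e \<star> u) = sw2 H e (\<lambda>e1 e2. tlift (\<lambda>v y. TT (gen sr l e1 \<star> v) (e2 * y)) (D u))"
  using assms(2) vsR
proof (induction rule: tens_space_induct)
  have lt: "lin (tscale (tscale sr)) (tscale (tscale sr)) (tlift (\<lambda>v y. TT (gen sr l e1 \<star> v) (e2 * y)))" for e1 e2
    by (rule lin_tlift) (intro lins lin_tmult2 vs_tscale)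
  {
    case (tens b y)
    note l1 = lin_comp[OF l]
    let ?F = "\<lambda>e1 e2 e3 y1 y2. TT (T (l e1) e2 \<star> T b y1) (e3 * y2)"
    have "D (gen sr l e \<star> T b y) = sw2 H e (\<lambda>e1 e'. sw2 H e' (\<lambda>e2 e3. sw2 H y (\<lambda>y1 y2. ?F e1 e2 e3 y1 y2)))"
      by (simp only: gen_def sw2_lin[OF lin_tmult_left] sw2_lin[OF lin_D] D_T_mult)
    also have "\<dots> = sw2 H e (\<lambda>e' e3. sw2 H e' (\<lambda>e1 e2. sw2 H y (\<lambda>y1 y2. ?F e1 e2 e3 y1 y2)))"
      by (rule sw2_coassoc[where s = "tscale (tscale sr)", symmetric]; intro lins lin_tmult1 l1)
    also have "\<dots> = sw2 H e (\<lambda>e' e3. sw2 H y (\<lambda>y1 y2. sw2 H e' (\<lambda>e1 e2. ?F e1 e2 e3 y1 y2)))"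
      by (rule sw2_cong, rule sw2_swap)
    also have "\<dots> = sw2 H e (\<lambda>e' e3. sw2 H y (\<lambda>y1 y2. TT (gen sr l e' \<star> T b y1) (e3 * y2)))"
      by (simp only: gen_def sw2_lin[OF lin_tmult_left] sw2_lin[OF lin_tens(2)[OF vs_tscale]])
    also have "\<dots> = sw2 H e (\<lambda>e1 e2. tlift (\<lambda>v y. TT (gen sr l e1 \<star> v) (e2 * y)) (D (T b y)))"
    proof (rule sw2_cong)
      fix e1 e2
      have "tlift (\<lambda>v y. TT (gen sr l e1 \<star> v) (e2 * y)) (TT v y) = TT (gen sr l e1 \<star> v) (e2 * y)" for v y
        by (rule tlift_tens'[where sz = "tscale (tscale sr)"]; intro lins lin_tmult2 vs_tscale)
      then show "sw2 H y (\<lambda>y1 y2. TT (gen sr l e1 \<star> T b y1) (e2 * y2)) =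
          tlift (\<lambda>v y. TT (gen sr l e1 \<star> v) (e2 * y)) (D (T b y))"
        by (simp add: D_T sw2_lin[OF lt])
    qed
    finally show ?case .
  next
    case (add u v)
    then show ?case
      by (simp add: tmult_add lin_add[OF lin_D] lin_add[OF lt] sw2_plus)
  }
qed

lemma lin_talg: "lin (tscale (*)) (tscale sr) (talg sr l)"
  by (rule linI) (simp_all add: vector_space_tscale vector_space_field vsR talg_add talg_scale tscale_def)

definition talg_tens :: "('h \<Rightarrow> 'r) \<Rightarrow> ('h \<Rightarrow>\<^sub>0 ('h, 'k) free_alg) \<Rightarrow> ('h \<Rightarrow>\<^sub>0 'h \<Rightarrow>\<^sub>0 'r)" where
  "talg_tens l = tlift (\<lambda>a h. TT (talg sr l a) h)"

lemma lin_talg_tens: "lin (tscale (tscale (*))) (tscale (tscale sr)) (talg_tens l)"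
  unfolding talg_tens_def by (rule lin_tlift) (intro lins lin_talg)

abbreviation "sT \<equiv> tscale ((*) :: 'k \<Rightarrow> 'k \<Rightarrow> 'k) :: 'k \<Rightarrow> ('h, 'k) free_alg \<Rightarrow> ('h, 'k) free_alg"
abbreviation "TX \<equiv> tens H sT"

lemma vs_sT: "vector_space sT"
  by (intro vector_space_tscale vector_space_field)

lemma talg_tens_TX: "talg_tens l (TX a h) = TT (talg sr l a) h"
  unfolding talg_tens_def
  by (rule tlift_tens'[where sz = "tscale (tscale sr)"]; intro lins lin_talg vs_tscale)

lemma tensor_alg_sel:
  "module.smult (tensor_alg H) = sT" "p \<otimes>\<^bsub>tensor_alg H\<^esub> q = p * q" "\<one>\<^bsub>tensor_alg H\<^esub> = 1" "p \<oplus>\<^bsub>tensor_alg H\<^esub> q = p + q"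
  by (simp_all add: tensor_alg_def tscale_def fun_eq_iff)

definition mult_TX where "mult_TX = monoid.mult (tens_algebra H (tensor_alg H))"

lemma mult_TX_eq: "mult_TX u v = tlift (\<lambda>a x. tlift (\<lambda>b y. TX (a * b) (x * y)) v) u"
  by (simp add: mult_TX_def tens_algebra_def tensor_alg_sel)

lemma lin_mult_TX: "lin (tscale sT) (tscale sT) (\<lambda>u. mult_TX u v)"
  unfolding mult_TX_eq
  by (rule lin_tlift, rule lin_tlift_param; intro vs_sT vector_space_tscale lin_tens1 lin_free_mult(1))

text \<open>\<open>talg_tens l\<close> is \<open>talg sr l\<close> \<otimes> id, hence
  multiplicative. The left factor is a pure tensor because words are built by multiplying with sums
  of such tensors from the left.\<close>

lemma talg_tens_mult:
  "talg_tens l (mult_TX (TX a x) c) = tlift (\<lambda>v y. TT (talg sr l a \<star> v) (x * y)) (talg_tens l c)"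
proof -
  have "mult_TX (TX a x) c = tlift (\<lambda>b y. TX (a * b) (x * y)) c"
    unfolding mult_TX_eq
    by (rule tlift_tens'[where sz = "tscale sT"]; rule lin_tlift_param;
      intro vs_sT vsH vector_space_tscale lin_tens1 lin_tens2 lin_free_mult(1) lin_mult1 lin_id)
  then have "talg_tens l (mult_TX (TX a x) c) = tlift (\<lambda>b y. TT (talg sr l a \<star> talg sr l b) (x * y)) c"
    by (simp add: tlift_lin[OF lin_talg_tens] talg_tens_TX talg_mult)
  moreover have "tlift (\<lambda>v y. TT (talg sr l a \<star> v) (x * y)) (TT v y) = TT (talg sr l a \<star> v) (x * y)" for v y
    by (rule tlift_tens'[where sz = "tscale (tscale sr)"]; intro lins lin_tmult2 vs_tscale)
  moreover have "lin (tscale (tscale sr)) (tscale (tscale sr)) (tlift (\<lambda>v y. TT (talg sr l a \<star> v) (x * y)))"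
    by (rule lin_tlift) (intro lins lin_tmult2 vs_tscale)
  ultimately show ?thesis
    by (simp add: talg_tens_def tlift_lin)
qed

text \<open>Induction on words: the coactions of a letter and of its image \<open>gen sr l e\<close>
  are given by the same formula, and both sides multiply in the same way.\<close>

lemma talg_coaction:
  assumes l: "lin hs sr l"
  shows "D (talg sr l P) = talg_tens l (talg_coaction H P)"
proof -
  let ?g = "\<lambda>h. sw2 H h (\<lambda>h1 h2. TX (Xgen H h1) h2)"
  let ?c = "\<lambda>w. foldr (\<lambda>e a. mult_TX (?g e) a) w (TX 1 1)"
  have w: "D (word sr l w) = talg_tens l (?c w)" for w
  proof (induction w)
    case Nil
    have "D (T 1 1) = TT (T 1 1) 1"
      unfolding D_T by (rule sw2_1[where s = "tscale (tscale sr)"]; intro lins)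
    then show ?case by (simp add: word_Nil talg_tens_TX talg_1)
  next
    case (Cons e w)
    then show ?case
      by (simp add: word_Cons D_gen_mult[OF l word_in] sw2_lin[OF lin_mult_TX] sw2_lin[OF lin_talg_tens]
         talg_tens_mult talg_Xgen[OF l])
  qed
  have "talg_coaction H P = (\<Sum>w\<in>Poly_Mapping.keys P. tscale sT (Poly_Mapping.lookup P w) (?c (letters w)))"
    unfolding talg_coaction_def talg_lift_def mult_TX_def
    by (simp add: tensor_alg_sel) (simp add: tens_algebra_def tensor_alg_sel)
  then show ?thesis
    by (simp add: talg_def lin_sum[OF lin_D] lin_scale[OF lin_D] lin_sum[OF lin_talg_tens] lin_scale[OF lin_talg_tens] w)
qed

end

lemma comm_alg_field: "comm_alg ((*) :: 'k::field \<Rightarrow> 'k \<Rightarrow> 'k)"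
  by standard (auto simp: algebra_simps)

text \<open>Supplies, for every linear form on H, a morphism that must kill each identity.\<close>

lemma (in hopf_cocycle) talg_comodule_algebra_hom:
  assumes l: "lin hs (*) l"
  shows "talg (*) l \<in> comodule_algebra_hom H (tensor_alg H) (talg_coaction H) (twisted_H H \<alpha>) (twisted_coaction H (*))"
proof -
  interpret comm_alg "(*) :: 'k \<Rightarrow> 'k \<Rightarrow> 'k" by (rule comm_alg_field)
  interpret twisted H \<alpha> "(*)" by unfold_locales
  have eq: "(\<lambda>x y. \<alpha> x y * 1) = \<alpha>" by simp
  note sel = twisted_algebra_sel[where R = UNIV and u = 1, unfolded eq, folded twisted_H_def]
  have smult: "module.smult (twisted_H H \<alpha>) = tscale (*)"
    by (simp add: twisted_H_def twisted_algebra_def)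
  show ?thesis
    unfolding comodule_algebra_hom_def
    by (auto intro!: ring_hom_memI simp: sel talg_in talg_mult talg_add tensor_alg_sel talg_1
      lin_scale[OF lin_talg] talg_coaction[OF l] talg_tens_def smult)
qed


section \<open>Polynomials over an infinite field\<close>

text \<open>Induction on the set of variables. With the other variables specialized, the sum is a
  polynomial in x with infinitely many roots, so all its coefficients vanish; the one in degree
  \<open>m x\<close> collects exactly the monomials with that exponent of x.\<close>

lemma monomials_independent:
  fixes c :: "('x \<Rightarrow> nat) \<Rightarrow> 'k::field"
  assumes "infinite (UNIV :: 'k set)" "finite V" "finite A"
    and "\<And>m n. m \<in> A \<Longrightarrow> n \<in> A \<Longrightarrow> (\<And>x. x \<in> V \<Longrightarrow> m x = n x) \<Longrightarrow> m = n"
    and "\<And>l. (\<Sum>m\<in>A. c m * (\<Prod>x\<in>V. l x ^ m x)) = 0"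
    and "m \<in> A"
  shows "c m = 0"
  using assms(2-)
proof (induction V arbitrary: A m rule: finite_induct)
  case empty
  \<comment> \<open>On the empty set all exponents agree, so \<open>A\<close> is a singleton; the
    empty product is 1 at every point, \<open>undefined\<close> included.\<close>
  then have "A = {m}" by auto
  with empty.prems(3)[of undefined] show ?case by simp
next
  case (insert x V)
  let ?B = "{n \<in> A. n x = m x}"
  show ?case
  proof (rule insert.IH[of ?B])
    show "finite ?B" "m \<in> ?B" using insert.prems by auto
    \<comment> \<open>Exponents in \<open>?B\<close> agree at x already, so agreement on
      \<open>V\<close> identifies them.\<close>
    show "n = n'" if "n \<in> ?B" "n' \<in> ?B" "\<And>x. x \<in> V \<Longrightarrow> n x = n' x" for n n'
      using that by (intro insert.prems(2)) auto
    fix l :: "'x \<Rightarrow> 'k"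
    define q where "q = (\<Sum>n\<in>A. Polynomial.monom (c n * (\<Prod>y\<in>V. l y ^ n y)) (n x))"
    have "poly q a = 0" for a
    proof -
      have "(\<Prod>y\<in>V. (l(x := a)) y ^ n y) = (\<Prod>y\<in>V. l y ^ n y)" for n :: "'x \<Rightarrow> nat"
        using insert.hyps by (intro prod.cong) auto
      then have "(\<Sum>n\<in>A. c n * (\<Prod>y\<in>insert x V. (l(x := a)) y ^ n y)) = poly q a"
        using insert.hyps by (simp add: q_def poly_sum poly_monom ac_simps)
      then show ?thesis using insert.prems(3) by metis
    qed
    then have "{a. poly q a = 0} = UNIV" by simp
    then have "q = 0"
      using assms(1) poly_roots_finite[of q] by auto
    then have "coeff q (m x) = 0" by simp
    also have "coeff q (m x) = (\<Sum>n\<in>A. if n x = m x then c n * (\<Prod>y\<in>V. l y ^ n y) else 0)"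
      by (simp add: q_def coeff_sum)
    also have "\<dots> = (\<Sum>n\<in>?B. c n * (\<Prod>y\<in>V. l y ^ n y))"
      using insert.prems(1) by (simp add: sum.inter_filter)
    finally show "(\<Sum>n\<in>?B. c n * (\<Prod>y\<in>V. l y ^ n y)) = 0" .
  qed
qed

section \<open>Evaluation of polynomials at points\<close>

definition mon_eval :: "('x \<Rightarrow> 'k::comm_ring_1) \<Rightarrow> ('x \<Rightarrow>\<^sub>0 nat) \<Rightarrow> 'k" where
  "mon_eval l m = (\<Prod>x\<in>Poly_Mapping.keys m. l x ^ Poly_Mapping.lookup m x)"

lemma mon_eval_superset:
  assumes "finite A" "Poly_Mapping.keys m \<subseteq> A"
  shows "mon_eval l m = (\<Prod>x\<in>A. l x ^ Poly_Mapping.lookup m x)"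
  unfolding mon_eval_def using assms by (intro prod.mono_neutral_left) (auto simp: in_keys_iff)

lemma mon_eval_add: "mon_eval l (m + n) = mon_eval l m * mon_eval l n"
proof -
  let ?A = "Poly_Mapping.keys m \<union> Poly_Mapping.keys n"
  have "mon_eval l k = (\<Prod>x\<in>?A. l x ^ Poly_Mapping.lookup k x)" if "k \<in> {m, n, m + n}" for k
    using that by (intro mon_eval_superset) (auto dest: subsetD[OF Poly_Mapping.keys_add])
  then show ?thesis by (simp add: lookup_add power_add prod.distrib)
qed

lift_definition peval :: "('x \<Rightarrow> 'k::comm_ring_1) \<Rightarrow> ('x, 'k) cpoly \<Rightarrow> 'k" is
  "\<lambda>l p. \<Sum>m\<in>Poly_Mapping.keys p. Poly_Mapping.lookup p m * mon_eval l m" .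

lemma peval_add: "peval l (p + q) = peval l p + peval l q"
  by transfer (rule sum_keys_add[where g = "\<lambda>m c. c * mon_eval _ m"]; simp add: distrib_right)

lemma peval_mult:
  fixes l :: "'x \<Rightarrow> 'k::comm_ring_1"
  shows "peval l (p * q) = peval l p * peval l q"
proof (transfer fixing: l)
  fix p q :: "('x \<Rightarrow>\<^sub>0 nat) \<Rightarrow>\<^sub>0 'k"
  let ?e = "\<lambda>p. \<Sum>m\<in>Poly_Mapping.keys p. Poly_Mapping.lookup p m * mon_eval l m"
  have add: "?e (p + q) = ?e p + ?e q" for p q
    by (rule sum_keys_add[where g = "\<lambda>m c. c * mon_eval l m"]; simp add: distrib_right)
  have single: "?e (Poly_Mapping.single m c) = c * mon_eval l m" for m c
    by simp
  show "?e (p * q) = ?e p * ?e q"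
  proof (induction p rule: poly_mapping_single_induct)
    case (2 m c)
    show ?case
    proof (induction q rule: poly_mapping_single_induct)
      case (2 n d)
      show ?case unfolding mult_single single mon_eval_add by (simp add: ac_simps)
    next
      case (3 p q)
      then show ?case by (simp only: distrib_left add)
    qed simp
  next
    case (3 p q)
    then show ?case by (simp only: distrib_right add)
  qed simp
qed

lemma peval_const [simp]: "peval l (cconst c) = c"
  by transfer (simp add: mon_eval_def)

lemma peval_var [simp]: "peval l (cvar x) = l x"
  by transfer (simp add: mon_eval_def)

lemma cconst_add: "cconst (a + b) = cconst a + cconst b"
  by transfer (simp add: single_add)

lemma cconst_mult: "cconst (a * b) = cconst a * cconst b"
  by transfer (simp add: mult_single)

lemma cconst_1 [simp]: "cconst 1 = 1"
  by transfer simp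

lemma cconst_0 [simp]: "cconst 0 = 0"
  by transfer simp

lemma peval_hom: "comm_ring_hom (peval l)"
  by unfold_locales
    (simp_all add: peval_add peval_mult peval_const[of l 0, simplified] peval_const[of l 1, simplified])

lemma peval_eq_0:
  fixes p :: "('x, 'k::field) cpoly"
  assumes "infinite (UNIV :: 'k set)" "\<And>l. peval l p = 0"
  shows "p = 0"
  using assms(2)
proof (transfer)
  fix p :: "('x \<Rightarrow>\<^sub>0 nat) \<Rightarrow>\<^sub>0 'k"
  assume *: "\<And>l. (\<Sum>m\<in>Poly_Mapping.keys p. Poly_Mapping.lookup p m * mon_eval l m) = 0"
  define V where "V = (\<Union>m\<in>Poly_Mapping.keys p. Poly_Mapping.keys m)"
  have V: "finite V" by (simp add: V_def)
  define A where "A = Poly_Mapping.lookup ` Poly_Mapping.keys p"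
  have inj: "inj_on Poly_Mapping.lookup B" for B :: "('x \<Rightarrow>\<^sub>0 nat) set"
    by (auto intro: inj_onI simp: lookup_inject)
  \<comment> \<open>\<open>Abs_poly_mapping\<close> recovers a monomial from its exponent function,
    so the coefficients can be indexed by plain functions.\<close>
  define c where "c m = Poly_Mapping.lookup p (Abs_poly_mapping m)" for m
  have c: "c (Poly_Mapping.lookup m) = Poly_Mapping.lookup p m" for m
    by (simp add: c_def lookup_inverse)
  have "c m = 0" if "m \<in> A" for m
  proof (rule monomials_independent[OF assms(1) V _ _ _ that])
    show "finite A" by (simp add: A_def)
    show "m = n" if "m \<in> A" "n \<in> A" "\<And>x. x \<in> V \<Longrightarrow> m x = n x" for m n
    proof
      fix x
      show "m x = n x"
      proof (cases "x \<in> V")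
        case False
        then have "m x = 0" "n x = 0" using that(1,2) by (auto simp: A_def V_def in_keys_iff)
        then show ?thesis by simp
      qed (rule that)
    qed
    fix l :: "'x \<Rightarrow> 'k"
    have "(\<Sum>m\<in>A. c m * (\<Prod>x\<in>V. l x ^ m x)) =
        (\<Sum>m\<in>Poly_Mapping.keys p. Poly_Mapping.lookup p m * (\<Prod>x\<in>V. l x ^ Poly_Mapping.lookup m x))"
      unfolding A_def by (simp add: sum.reindex[OF inj] c)
    also have "\<dots> = (\<Sum>m\<in>Poly_Mapping.keys p. Poly_Mapping.lookup p m * mon_eval l m)"
      using V by (intro sum.cong) (auto simp: V_def intro!: arg_cong2[where f = "(*)"] mon_eval_superset[symmetric])
    finally show "(\<Sum>m\<in>A. c m * (\<Prod>x\<in>V. l x ^ m x)) = 0" using * by simp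
  qed
  then show "p = 0"
    by (metis A_def c imageI in_keys_iff poly_mapping_eqI lookup_zero)
qed

section \<open>The polynomial ring inside its field of fractions\<close>

definition pscale :: "'k::field \<Rightarrow> ('h, 'k) cpoly \<Rightarrow> ('h, 'k) cpoly" where
  "pscale c p = cconst c * p"

definition emb :: "('h, 'k::field) cpoly \<Rightarrow> ('h, 'k) big_field" where
  "emb p = Fract p 1"

lemma emb_add: "emb (p + q) = emb p + emb q"
  and emb_mult: "emb (p * q) = emb p * emb q"
  and emb_1 [simp]: "emb 1 = 1"
  and emb_0 [simp]: "emb 0 = 0"
  by (simp_all add: emb_def One_fract_def Zero_fract_def)

lemma emb_sum: "emb (sum f A) = (\<Sum>a\<in>A. emb (f a))"
  by (induction A rule: infinite_finite_induct) (simp_all add: emb_add)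

lemma emb_eq_0_iff [simp]: "emb p = 0 \<longleftrightarrow> p = 0"
  by (simp add: emb_def Zero_fract_def eq_fract)

lemma kscale_emb: "kscale c a = emb (cconst c) * a"
  by (simp add: kscale_def emb_def)

lemma comm_alg_pscale: "comm_alg (pscale :: 'k::field \<Rightarrow> ('h, 'k) cpoly \<Rightarrow> _)"
  by standard (simp_all add: pscale_def cconst_add cconst_mult algebra_simps)

lemma comm_alg_kscale: "comm_alg (kscale :: 'k::field \<Rightarrow> ('h, 'k) big_field \<Rightarrow> _)"
  by standard (simp_all add: kscale_emb cconst_add cconst_mult emb_add emb_mult algebra_simps)

lemmas vs_kscale = comm_alg.vsR[OF comm_alg_kscale]
lemmas vs_pscale = comm_alg.vsR[OF comm_alg_pscale]

lemma lin_emb: "lin pscale kscale emb"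
  by (rule linI) (simp_all add: vs_kscale vs_pscale emb_add pscale_def emb_mult kscale_emb)

lemma lin_peval: "lin pscale (*) (peval l)"
  by (rule linI) (simp_all add: vs_pscale vector_space_field peval_add peval_mult pscale_def)

context hopf
begin

text \<open>The element \<open>tgen H h\<close> before passing to fractions: a polynomial can be
  evaluated at every point, a fraction cannot.\<close>

definition tvar :: "'h \<Rightarrow> ('h, 'k) cpoly" where
  "tvar h = (\<Sum>e\<in>csupp H h. pscale (coord H h e) (cvar e))"

lemma lin_basis_extension:
  assumes "vector_space s"
  shows "lin hs s (\<lambda>h. \<Sum>e\<in>csupp H h. s (coord H h e) (f e))"
proof (rule linI)
  interpret S: vector_space s by fact
  have eq: "(\<Sum>e\<in>csupp H h. s (coord H h e) (f e)) = (\<Sum>e\<in>A. s (coord H h e) (f e))"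
    if "finite A" "csupp H h \<subseteq> A" for A h
    using that by (intro sum.mono_neutral_left) (auto simp: csupp_def)
  show "vector_space hs" "vector_space s" by (fact vsH assms)+
  show "(\<Sum>e\<in>csupp H (x + y). s (coord H (x + y) e) (f e)) =
      (\<Sum>e\<in>csupp H x. s (coord H x e) (f e)) + (\<Sum>e\<in>csupp H y. s (coord H y e) (f e))" for x y
  proof -
    let ?A = "csupp H x \<union> csupp H y"
    have fin: "finite ?A" by (simp add: finite_csupp vsH)
    have sub: "csupp H (x + y) \<subseteq> ?A" by (auto simp: csupp_def coord_add vsH)
    show ?thesis
      unfolding eq[OF fin sub] eq[OF fin Un_upper1] eq[OF fin Un_upper2]
      by (simp add: coord_add vsH S.scale_left_distrib sum.distrib)
  qed
  show "(\<Sum>e\<in>csupp H (hs c x). s (coord H (hs c x) e) (f e)) = s c (\<Sum>e\<in>csupp H x. s (coord H x e) (f e))" for c x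
  proof -
    have sub: "csupp H (hs c x) \<subseteq> csupp H x" by (auto simp: csupp_def coord_scale vsH)
    show ?thesis
      unfolding eq[OF finite_csupp[OF vsH] sub]
      by (simp add: coord_scale vsH S.scale_sum_right)
  qed
qed

lemma lin_tvar: "lin hs pscale tvar"
  unfolding tvar_def by (rule lin_basis_extension[OF vs_pscale])

lemma tgen_eq: "tgen H h = emb (tvar h)"
  by (simp add: tgen_def tvar_def emb_sum lin_scale[OF lin_emb] emb_def[symmetric])

lemma lin_tgen: "lin hs kscale (tgen H)"
  using lin_comp[OF lin_emb lin_tvar] by (simp add: tgen_eq[symmetric])

end

section \<open>Vanishing of the generic morphism on identities\<close>

context hopf_cocycle
begin

lemma generic_hom_eq: "generic_hom H \<alpha> = talg kscale (tgen H)"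
proof -
  interpret comm_alg kscale by (rule comm_alg_kscale)
  interpret twisted H \<alpha> kscale by unfold_locales
  show ?thesis unfolding generic_hom_def alpha_algebra_def gen_def[symmetric] by (rule talg_lift_eq)
qed

text \<open>The coefficients of the generic image of P are polynomials. At a point \<open>l\<close>
  they become the coefficients of the image of P under the morphism given by the linear form
  \<open>\<lambda>h. peval l (tvar h)\<close>, which is 0. Over an infinite field the polynomials
  themselves are then 0.\<close>

lemma generic_hom_identities:
  assumes "infinite (UNIV :: 'k set)" "P \<in> identities_ideal H \<alpha>"
  shows "generic_hom H \<alpha> P = 0"
proof -
  have "Poly_Mapping.lookup (talg pscale tvar P) e = 0" for e
  proof (rule peval_eq_0[OF assms(1)])
    fix l
    have "pmmap (peval l) (talg pscale tvar P) = talg (*) (\<lambda>h. peval l (tvar h)) P"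
      by (intro pmmap_talg comm_alg_pscale comm_alg_field lin_peval peval_mult) (simp add: peval_const[of l 1, simplified])
    also have "\<dots> = 0"
      using assms(2) talg_comodule_algebra_hom[OF lin_comp[OF lin_peval lin_tvar]]
      by (auto simp: identities_ideal_def)
    finally show "peval l (Poly_Mapping.lookup (talg pscale tvar P) e) = 0"
      by (metis lookup_pmmap lin_0[OF lin_peval] lookup_zero)
  qed
  then have "talg pscale tvar P = 0"
    by (intro poly_mapping_eqI) simp
  moreover have "generic_hom H \<alpha> P = pmmap emb (talg pscale tvar P)"
    unfolding generic_hom_eq tgen_eq
    by (intro pmmap_talg[symmetric] comm_alg_pscale comm_alg_kscale lin_emb emb_mult emb_1)
  ultimately show ?thesis
    by (simp add: poly_mapping_eqI lookup_pmmap)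
qed

end


section \<open>The convolution inverse of the generic map\<close>

lemma cvars_add: "cvars (p + q) \<subseteq> cvars p \<union> cvars q" for p q :: "('x, 'k::comm_ring_1) cpoly"
  by transfer (auto dest!: subsetD[OF Poly_Mapping.keys_add])

lemma cvars_uminus: "cvars (- p) = cvars p" for p :: "('x, 'k::comm_ring_1) cpoly"
  by transfer simp

lemma cvars_mult: "cvars (p * q) \<subseteq> cvars p \<union> cvars q" for p q :: "('x, 'k::comm_ring_1) cpoly"
  by transfer (fastforce dest!: subsetD[OF Poly_Mapping.keys_mult] subsetD[OF Poly_Mapping.keys_add])

lemma cvars_cconst [simp]: "cvars (cconst c :: ('x, 'k::comm_ring_1) cpoly) = {}"
  by transfer simp

lemma cvars_cvar: "cvars (cvar x :: ('x, 'k::comm_ring_1) cpoly) \<subseteq> {x}"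
  by transfer (auto split: if_splits)

text \<open>Serves to track membership in K_H, since the ambient field also contains indeterminates
  outside the basis.\<close>

definition polys_in :: "'x set \<Rightarrow> ('x, 'k::comm_ring_1) cpoly set" where
  "polys_in B = {p. cvars p \<subseteq> B}"

lemma polys_in_add: "p \<in> polys_in B \<Longrightarrow> q \<in> polys_in B \<Longrightarrow> p + q \<in> polys_in B"
  and polys_in_mult: "p \<in> polys_in B \<Longrightarrow> q \<in> polys_in B \<Longrightarrow> p * q \<in> polys_in B"
  and polys_in_uminus: "p \<in> polys_in B \<Longrightarrow> - p \<in> polys_in B"
  and polys_in_cconst: "cconst c \<in> polys_in B"
  and polys_in_cvar: "x \<in> B \<Longrightarrow> cvar x \<in> polys_in B"
  using cvars_add[of p q] cvars_mult[of p q] cvars_uminus[of p] cvars_cvar[of x]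
  by (auto simp: polys_in_def)

lemma polys_in_0: "0 \<in> polys_in B" and polys_in_1: "1 \<in> polys_in B"
  using polys_in_cconst[of 0 B] polys_in_cconst[of 1 B] by simp_all

lemma polys_in_sum: "(\<And>a. a \<in> A \<Longrightarrow> f a \<in> polys_in B) \<Longrightarrow> sum f A \<in> polys_in B"
  by (induction A rule: infinite_finite_induct) (simp_all add: polys_in_0 polys_in_add)

lemma polys_in_prod: "(\<And>a. a \<in> A \<Longrightarrow> f a \<in> polys_in B) \<Longrightarrow> prod f A \<in> polys_in B"
  by (induction A rule: infinite_finite_induct) (simp_all add: polys_in_1 polys_in_mult)

lemma polys_in_power: "p \<in> polys_in B \<Longrightarrow> p ^ n \<in> polys_in B"
  by (induction n) (simp_all add: polys_in_1 polys_in_mult)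

lemma det_polys_in:
  assumes "A \<in> carrier_mat n n" "\<And>i j. i < n \<Longrightarrow> j < n \<Longrightarrow> A $$ (i, j) \<in> polys_in B"
  shows "det A \<in> polys_in B"
  unfolding det_def'[OF assms(1)]
proof (intro polys_in_sum polys_in_mult polys_in_prod assms(2))
  show "signof p \<in> polys_in B" for p :: "nat \<Rightarrow> nat"
    by (simp add: sign_def polys_in_1 polys_in_uminus)
qed (auto simp: permutes_in_image)

lemma adj_mat_polys_in:
  assumes "A \<in> carrier_mat n n" "\<And>i j. i < n \<Longrightarrow> j < n \<Longrightarrow> A $$ (i, j) \<in> polys_in B" "i < n" "j < n"
  shows "adj_mat A $$ (i, j) \<in> polys_in B"
proof -
  have "det (mat_delete A j i) \<in> polys_in B"
    using assms by (intro det_polys_in[where n = "n - 1"]) (auto simp: mat_delete_def)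
  then show ?thesis
    using assms by (simp add: adj_mat_def cofactor_def polys_in_mult polys_in_power polys_in_uminus polys_in_1)
qed

lemma (in hopf) sym_alg_eq: "sym_alg H = emb ` polys_in (basis H)"
  by (auto simp: sym_alg_def emb_def polys_in_def)

lemma (in hopf) sym_fieldI:
  "p \<in> polys_in (basis H) \<Longrightarrow> q \<in> polys_in (basis H) \<Longrightarrow> q \<noteq> 0 \<Longrightarrow> emb p / emb q \<in> sym_field H"
  unfolding sym_field_def sym_alg_eq mem_Collect_eq by (rule exI[of _ "emb p"], rule exI[of _ "emb q"]) auto

lemma (in hopf) sym_fieldE:
  assumes "a \<in> sym_field H"
  obtains p q where "p \<in> polys_in (basis H)" "q \<in> polys_in (basis H)" "q \<noteq> 0" "a = emb p / emb q"
  using assms by (auto simp: sym_field_def sym_alg_eq)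

text \<open>The determinant specializes to 1 under \<open>peval l\<close>, hence is a nonzero
  polynomial; the adjugate divided by it is a two-sided inverse over K_H. A bijection of
  \<open>F\<close> with an initial segment of the natural numbers turns \<open>m\<close> into a
  matrix.\<close>

lemma (in hopf) inverse_matrix:
  fixes m :: "'h \<Rightarrow> 'h \<Rightarrow> ('h, 'k) cpoly"
  assumes F: "finite F" and m: "\<And>i j. i \<in> F \<Longrightarrow> j \<in> F \<Longrightarrow> m i j \<in> polys_in (basis H)"
    and l: "\<And>i j. i \<in> F \<Longrightarrow> j \<in> F \<Longrightarrow> peval l (m i j) = (if i = j then 1 else 0)"
  obtains N where "\<And>i j. i \<in> F \<Longrightarrow> j \<in> F \<Longrightarrow> N i j \<in> sym_field H"
    and "\<And>i j. i \<in> F \<Longrightarrow> j \<in> F \<Longrightarrow> (\<Sum>k\<in>F. emb (m i k) * N k j) = (if i = j then 1 else 0)"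
    and "\<And>i j. i \<in> F \<Longrightarrow> j \<in> F \<Longrightarrow> (\<Sum>k\<in>F. N i k * emb (m k j)) = (if i = j then 1 else 0)"
proof -
  define n where "n = card F"
  obtain f where f: "bij_betw f {0..<n} F"
    using ex_bij_betw_nat_finite[OF F] by (auto simp: n_def)
  define g where "g = the_inv_into {0..<n} f"
  have g: "g i < n" "f (g i) = i" if "i \<in> F" for i
    using that f f_the_inv_into_f_bij_betw[OF f] the_inv_into_into[of f "{0..<n}" i "{0..<n}"]
    by (auto simp: g_def bij_betw_def)
  have f': "f i \<in> F" if "i < n" for i
    using that f by (auto simp: bij_betw_def)
  have ginj: "g i = g j \<longleftrightarrow> i = j" if "i \<in> F" "j \<in> F" for i j
    using g that by metis
  have finj: "f i = f j \<longleftrightarrow> i = j" if "i < n" "j < n" for i j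
    using that f by (auto simp: bij_betw_def dest: inj_onD)
  define A where "A = mat n n (\<lambda>(i, j). m (f i) (f j))"
  have A: "A \<in> carrier_mat n n" by (simp add: A_def)
  have A_el: "A $$ (i, j) = m (f i) (f j)" if "i < n" "j < n" for i j
    using that by (simp add: A_def)
  interpret P: comm_ring_hom "peval l" by (rule peval_hom)
  have "map_mat (peval l) A = 1\<^sub>m n"
    by (rule eq_matI) (auto simp: A_def l f' finj)
  then have "peval l (det A) = 1"
    using P.hom_det[of A] by simp
  then have d0: "det A \<noteq> 0" by (metis P.hom_zero zero_neq_one)
  let ?B = "adj_mat A"
  have B: "?B \<in> carrier_mat n n" by (rule adj_mat[OF A])
  define N where "N i j = emb (?B $$ (g i, g j)) / emb (det A)" for i j
  have Ap: "A $$ (i, j) \<in> polys_in (basis H)" if "i < n" "j < n" for i j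
    using that by (simp add: A_def m f')
  show ?thesis
  proof (rule that[of N])
    fix i j assume ij: "i \<in> F" "j \<in> F"
    have "?B $$ (g i, g j) \<in> polys_in (basis H)" "det A \<in> polys_in (basis H)"
      using adj_mat_polys_in[OF A Ap] det_polys_in[OF A Ap] g ij by auto
    then show "N i j \<in> sym_field H"
      unfolding N_def using d0 by (rule sym_fieldI)
    have reindex: "sum h F = (\<Sum>k = 0..<n. h (f k))" for h :: "'h \<Rightarrow> ('h, 'k) big_field"
      using sum.reindex_bij_betw[OF f, of h] by simp
    have gf: "g (f k) = k" if "k < n" for k
      using finj[of "g (f k)" k] g f' that by metis
    have "(A * ?B) $$ (g i, g j) = (if i = j then det A else 0)"
      unfolding adj_mat[OF A] using g ij ginj by auto
    moreover have "(A * ?B) $$ (g i, g j) = (\<Sum>k = 0..<n. A $$ (g i, k) * ?B $$ (k, g j))"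
      using g ij A B by (simp add: scalar_prod_def)
    ultimately have "(\<Sum>k = 0..<n. m i (f k) * ?B $$ (k, g j)) = (if i = j then det A else 0)"
      using g ij by (simp add: A_el)
    from arg_cong[OF this, of emb] show "(\<Sum>k\<in>F. emb (m i k) * N k j) = (if i = j then 1 else 0)"
      using d0 by (simp add: reindex N_def gf emb_sum emb_mult sum_divide_distrib[symmetric])
    have "(?B * A) $$ (g i, g j) = (if i = j then det A else 0)"
      unfolding adj_mat[OF A] using g ij ginj by auto
    moreover have "(?B * A) $$ (g i, g j) = (\<Sum>k = 0..<n. ?B $$ (g i, k) * A $$ (k, g j))"
      using g ij A B by (simp add: scalar_prod_def)
    ultimately have "(\<Sum>k = 0..<n. ?B $$ (g i, k) * m (f k) j) = (if i = j then det A else 0)"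
      using g ij by (simp add: A_el)
    from arg_cong[OF this, of emb] show "(\<Sum>k\<in>F. N i k * emb (m k j)) = (if i = j then 1 else 0)"
      using d0 by (simp add: reindex N_def gf emb_sum emb_mult sum_divide_distrib[symmetric])
  qed
qed

section \<open>Matrix coefficients of the comultiplication\<close>

context hopf
begin

lemma tvar_in: "tvar h \<in> polys_in (basis H)"
  unfolding tvar_def pscale_def using csupp_subset[OF vsH, of h]
  by (auto intro!: polys_in_sum polys_in_mult polys_in_cconst polys_in_cvar)

text \<open>The point \<open>counit H\<close> realizes the specialization of t to \<epsilon>, at
  which the matrices below become identity matrices.\<close>

lemma peval_tvar: "peval (counit H) (tvar h) = counit H h"
proof -
  have "counit H (\<Sum>e\<in>csupp H h. hs (coord H h e) e) = peval (counit H) (tvar h)"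
    by (simp add: tvar_def lin_sum[OF lin_counit] lin_scale[OF lin_counit] lin_sum[OF lin_peval] lin_scale[OF lin_peval])
  then show ?thesis by (simp add: coord_expand vsH)
qed

text \<open>
  \<open>\<Delta> x = \<Sum>\<^sub>e rcoef e x \<otimes> e = \<Sum>\<^sub>e e \<otimes> lcoef e x\<close>, where \<open>e\<close> ranges over the basis; in the second sum it
  suffices that \<open>e\<close> ranges over the finite set \<open>lfin x\<close>.
\<close>
definition rcoef :: "'h \<Rightarrow> 'h \<Rightarrow> 'h" where "rcoef e x = sw2 H x (\<lambda>a b. hs (coord H b e) a)"
definition lcoef :: "'h \<Rightarrow> 'h \<Rightarrow> 'h" where "lcoef e x = sw2 H x (\<lambda>a b. hs (coord H a e) b)"

text \<open>Take the coordinate at \<open>e\<close> in the counit axiom. For basis elements x the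
  result is a Kronecker delta, which is why the matrices with entries t of \<open>rcoef\<close>
  specialize to the identity.\<close>

lemma counit_rcoef: "counit H (rcoef e x) = coord H x e"
  using arg_cong[OF counit_left[of x], of "\<lambda>h. coord H h e"]
  by (simp add: rcoef_def sw2_lin[OF lin_counit] sw2_lin[OF lin_coord] lin_scale[OF lin_counit] lin_scale[OF lin_coord] mult.commute)

lemma counit_lcoef: "counit H (lcoef e x) = coord H x e"
  using arg_cong[OF counit_right[of x], of "\<lambda>h. coord H h e"]
  by (simp add: lcoef_def sw2_lin[OF lin_counit] sw2_lin[OF lin_coord] lin_scale[OF lin_counit] lin_scale[OF lin_coord] mult.commute)

lemma lin_lcoef: "lin hs hs (lcoef e)"
  unfolding lcoef_def
  by (rule lin_sw2) (auto intro!: linI simp: vsH coord_add coord_scale vector_space.vector_space_assms[OF vsH])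

definition lfin :: "'h \<Rightarrow> 'h set" where
  "lfin x = (\<Union>k\<in>Poly_Mapping.keys (comult H x). csupp H (Poly_Mapping.lookup (comult H x) k))"

lemma finite_lfin: "finite (lfin x)" and lfin_basis: "lfin x \<subseteq> basis H"
  using csupp_subset[OF vsH] by (auto simp: lfin_def finite_csupp[OF vsH])

text \<open>The left legs of \<Delta> x are expanded in the basis, and the right legs are collected
  by basis element.\<close>

lemma sw2_lcoef:
  assumes "\<And>b. lin hs s (\<lambda>a. f a b)" "\<And>a. lin hs s (\<lambda>b. f a b)"
  shows "sw2 H x f = (\<Sum>e\<in>lfin x. f e (lcoef e x))"
proof -
  let ?y = "Poly_Mapping.lookup (comult H x)"
  interpret S: vector_space s by (rule lin_target[OF assms(1)])
  have "f (?y k) k = (\<Sum>e\<in>lfin x. s (coord H (?y k) e) (f e k))" if "k \<in> Poly_Mapping.keys (comult H x)" for k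
  proof -
    have "f (\<Sum>e\<in>csupp H (?y k). hs (coord H (?y k) e) e) k = (\<Sum>e\<in>csupp H (?y k). s (coord H (?y k) e) (f e k))"
      by (simp add: lin_sum[OF assms(1)] lin_scale[OF assms(1)])
    also have "\<dots> = (\<Sum>e\<in>lfin x. s (coord H (?y k) e) (f e k))"
      using that finite_lfin by (intro sum.mono_neutral_left) (auto simp: csupp_def lfin_def)
    finally show ?thesis by (simp add: coord_expand vsH)
  qed
  then have "sw2 H x f = (\<Sum>k\<in>Poly_Mapping.keys (comult H x). \<Sum>e\<in>lfin x. s (coord H (?y k) e) (f e k))"
    by (simp add: sw2_def tlift_def)
  also have "\<dots> = (\<Sum>e\<in>lfin x. sw2 H x (\<lambda>a b. s (coord H a e) (f e b)))"
    unfolding sw2_def tlift_def by (rule sum.swap)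
  also have "\<dots> = (\<Sum>e\<in>lfin x. f e (lcoef e x))"
    by (simp add: lcoef_def sw2_lin[OF assms(2)] lin_scale[OF assms(2)])
  finally show ?thesis .
qed

lemma lcoef_expand: "x = (\<Sum>e\<in>lfin x. hs (counit H e) (lcoef e x))"
  by (subst (1) counit_left[of x, symmetric], rule sw2_lcoef[where s = hs])
    (auto intro!: linI simp: vsH lin_add[OF lin_counit] lin_scale[OF lin_counit] mult.commute vector_space.vector_space_assms[OF vsH])

text \<open>By coassociativity, \<Delta> maps \<open>lcoef e x\<close> to \<Sum>
  \<open>lcoef e e'\<close> \<otimes> \<open>lcoef e' x\<close>, with \<open>e'\<close> in a finite
  set independent of \<open>e\<close>. This turns convolution with t into multiplication by a finite
  matrix.\<close>

lemma sw2_of_lcoef: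
  assumes "\<And>b. lin hs s (\<lambda>a. f a b)" "\<And>a. lin hs s (\<lambda>b. f a b)"
  shows "sw2 H (lcoef e x) f = (\<Sum>e'\<in>lfin x. f (lcoef e e') (lcoef e' x))"
proof -
  interpret S: vector_space s by (rule lin_target[OF assms(1)])
  have lc: "lin hs s (\<lambda>a. s (coord H a e) v)" for v
    by (auto intro!: linI simp: vsH S.vector_space_axioms coord_add coord_scale S.scale_left_distrib)
  have "sw2 H (lcoef e x) f = sw2 H x (\<lambda>a z. sw2 H z (\<lambda>b c. s (coord H a e) (f b c)))"
    by (simp add: lcoef_def[of e x] sw2_lin[OF lin_sw2[OF assms(1)]] lin_scale[OF lin_sw2[OF assms(1)]]
        sw2_lin[OF lin_scaleI[OF lin_id[OF S.vector_space_axioms]]])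
  also have "\<dots> = sw2 H x (\<lambda>y c. sw2 H y (\<lambda>a b. s (coord H a e) (f b c)))"
    by (rule sw2_coassoc[where s = s, symmetric]; intro lin_scaleI assms lc)
  also have "\<dots> = sw2 H x (\<lambda>y c. f (lcoef e y) c)"
    by (simp add: lcoef_def sw2_lin[OF assms(1)] lin_scale[OF assms(1)])
  also have "\<dots> = (\<Sum>e'\<in>lfin x. f (lcoef e e') (lcoef e' x))"
    by (rule sw2_lcoef[where s = s]) (intro lin_comp[OF assms(1) lin_lcoef] assms)+
  finally show ?thesis .
qed

lemma lcoef_matrix:
  obtains N where "\<And>i j. i \<in> lfin x \<Longrightarrow> j \<in> lfin x \<Longrightarrow> N i j \<in> sym_field H"
    and "\<And>i j. i \<in> lfin x \<Longrightarrow> j \<in> lfin x \<Longrightarrow> (\<Sum>k\<in>lfin x. N i k * tgen H (lcoef k j)) = (if i = j then 1 else 0)"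
proof (rule inverse_matrix[OF finite_lfin[of x], of "\<lambda>i j. tvar (lcoef i j)" "counit H"])
  show "peval (counit H) (tvar (lcoef i j)) = (if i = j then 1 else 0)" if "i \<in> lfin x" "j \<in> lfin x" for i j
    using that by (auto simp: peval_tvar counit_lcoef coord_basis[OF vsH subsetD[OF lfin_basis[of x]]])
qed (auto simp: tvar_in tgen_eq that)

text \<open>At the elements \<open>lcoef k x\<close>, convolution with t multiplies the vector of
  values of \<open>g\<close> by the matrix with entries t of \<open>lcoef k e'\<close>. Its inverse
  over K_H recovers these values, and x is the combination of the \<open>lcoef i x\<close> with
  coefficients \<epsilon>(i).\<close>

lemma tgen_conv_inverse:
  assumes g: "lin hs kscale g"
  obtains N where "\<And>i j. i \<in> lfin x \<Longrightarrow> j \<in> lfin x \<Longrightarrow> N i j \<in> sym_field H"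
    and "g x = (\<Sum>i\<in>lfin x. kscale (counit H i) (\<Sum>k\<in>lfin x. N i k * sw2 H (lcoef k x) (\<lambda>a b. tgen H a * g b)))"
proof -
  obtain N where N: "\<And>i j. i \<in> lfin x \<Longrightarrow> j \<in> lfin x \<Longrightarrow> N i j \<in> sym_field H"
    "\<And>i j. i \<in> lfin x \<Longrightarrow> j \<in> lfin x \<Longrightarrow> (\<Sum>k\<in>lfin x. N i k * tgen H (lcoef k j)) = (if i = j then 1 else 0)"
    using lcoef_matrix by blast
  note K = comm_alg.alg_lin[OF comm_alg_kscale]
  have "g (lcoef i x) = (\<Sum>k\<in>lfin x. N i k * sw2 H (lcoef k x) (\<lambda>a b. tgen H a * g b))" if i: "i \<in> lfin x" for i
  proof -
    have "sw2 H (lcoef k x) (\<lambda>a b. tgen H a * g b) = (\<Sum>e'\<in>lfin x. tgen H (lcoef k e') * g (lcoef e' x))" for k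
      by (rule sw2_of_lcoef[where s = kscale]) (intro K g lin_tgen)+
    then have "(\<Sum>k\<in>lfin x. N i k * sw2 H (lcoef k x) (\<lambda>a b. tgen H a * g b)) =
        (\<Sum>k\<in>lfin x. \<Sum>e'\<in>lfin x. N i k * tgen H (lcoef k e') * g (lcoef e' x))"
      by (simp add: sum_distrib_left ac_simps)
    also have "\<dots> = (\<Sum>e'\<in>lfin x. (\<Sum>k\<in>lfin x. N i k * tgen H (lcoef k e')) * g (lcoef e' x))"
      by (subst sum.swap) (simp add: sum_distrib_right)
    also have "\<dots> = (\<Sum>e'\<in>lfin x. if i = e' then g (lcoef e' x) else 0)"
      using N(2) i by (intro sum.cong) auto
    finally show ?thesis using i finite_lfin by simp
  qed
  moreover have "g x = (\<Sum>i\<in>lfin x. kscale (counit H i) (g (lcoef i x)))"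
    by (subst lcoef_expand) (simp add: lin_sum[OF g] lin_scale[OF g])
  ultimately have "g x = (\<Sum>i\<in>lfin x. kscale (counit H i)
      (\<Sum>k\<in>lfin x. N i k * sw2 H (lcoef k x) (\<lambda>a b. tgen H a * g b)))"
    by simp
  with N(1) show ?thesis by (rule that)
qed

text \<open>The inversion formula is applied to the difference of \<open>f\<close> and
  \<open>g\<close>, whose convolution with t is 0.\<close>

lemma tgen_conv_inj:
  assumes "lin hs kscale f" "lin hs kscale g"
    and "\<And>h. sw2 H h (\<lambda>a b. tgen H a * f b) = sw2 H h (\<lambda>a b. tgen H a * g b)"
  shows "f = g"
proof
  fix x
  have l: "lin hs kscale (\<lambda>x. f x - g x)"
    by (rule linI) (simp_all add: vsH vs_kscale lin_add[OF assms(1)] lin_add[OF assms(2)] lin_scale[OF assms(1)]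
      lin_scale[OF assms(2)] kscale_emb algebra_simps)
  have "sw2 H h (\<lambda>a b. tgen H a * (f b - g b)) = 0" for h
    using assms(3)[of h] by (simp add: sw2_def tlift_def right_diff_distrib sum_subtractf)
  with tgen_conv_inverse[OF l, of x] have "f x - g x = 0"
    by (metis (no_types, lifting) kscale_emb mult_zero_right sum.neutral)
  then show "f x = g x" by simp
qed

section \<open>Closure properties of K_H\<close>

lemma sym_field_add: "a \<in> sym_field H \<Longrightarrow> b \<in> sym_field H \<Longrightarrow> a + b \<in> sym_field H"
  and sym_field_mult: "a \<in> sym_field H \<Longrightarrow> b \<in> sym_field H \<Longrightarrow> a * b \<in> sym_field H"
  and sym_field_emb: "p \<in> polys_in (basis H) \<Longrightarrow> emb p \<in> sym_field H"
proof -
  show "emb p \<in> sym_field H" if "p \<in> polys_in (basis H)"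
    using sym_fieldI[OF that polys_in_1] by simp
  assume "a \<in> sym_field H" "b \<in> sym_field H"
  then obtain p q r s where *: "p \<in> polys_in (basis H)" "q \<in> polys_in (basis H)" "q \<noteq> 0" "a = emb p / emb q"
    "r \<in> polys_in (basis H)" "s \<in> polys_in (basis H)" "s \<noteq> 0" "b = emb r / emb s"
    by (elim sym_fieldE)
  show "a * b \<in> sym_field H"
    using sym_fieldI[of "p * r" "q * s"] * by (simp add: polys_in_mult emb_mult)
  show "a + b \<in> sym_field H"
    using sym_fieldI[of "p * s + r * q" "q * s"] * by (simp add: polys_in_mult polys_in_add emb_mult emb_add add_frac_eq)
qed

lemma sym_field_kscale: "a \<in> sym_field H \<Longrightarrow> kscale c a \<in> sym_field H"
  unfolding kscale_emb by (intro sym_field_mult sym_field_emb polys_in_cconst)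

lemma sym_field_sum: "(\<And>a. a \<in> A \<Longrightarrow> f a \<in> sym_field H) \<Longrightarrow> sum f A \<in> sym_field H"
  using sym_field_emb[OF polys_in_0]
  by (induction A rule: infinite_finite_induct) (simp_all add: sym_field_add)

section \<open>The map \<phi> as a linear map over the field of fractions\<close>

abbreviation TK where "TK \<equiv> tens H (kscale :: 'k \<Rightarrow> ('h, 'k) big_field \<Rightarrow> _)"
text \<open>Scalars are now elements of the big field instead of k; \<phi> is linear over it, so
  linear algebra over that field applies.\<close>

abbreviation mulK where "mulK \<equiv> tscale ((*) :: ('h, 'k) big_field \<Rightarrow> _)"

lemma lin_TK: "lin (*) mulK (\<lambda>b. TK b h)"
proof (rule linI)
  show "vector_space (mulK :: _ \<Rightarrow> ('h \<Rightarrow>\<^sub>0 ('h, 'k) big_field) \<Rightarrow> _)"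
    by (intro vector_space_tscale vector_space_field)
  show "TK (x + y) h = TK x h + TK y h" for x y
    by (rule lin_add[OF lin_tens(2)[OF vs_kscale]])
  show "TK (c * x) h = mulK c (TK x h)" for c x
    by (rule poly_mapping_eqI) (simp add: lookup_tscale vector_space_field lookup_tens vsH vs_kscale kscale_emb)
qed (rule vector_space_field)

lemma lin_phi: "lin mulK mulK (phi H)"
  unfolding phi_def
proof (rule lin_tlift)
  show "lin (*) mulK (\<lambda>b. sw2 H h (\<lambda>h1. TK (b * tgen H h1)))" for h
    by (intro lin_sw2_param vector_space_field vector_space_tscale lin_comp[OF lin_TK] lin_field lin_id)
       (auto intro!: linI vector_space_field simp: algebra_simps)
qed

lemma phi_TK: "phi H (TK b h) = sw2 H h (\<lambda>h1 h2. TK (b * tgen H h1) h2)"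
  unfolding phi_def
  by (rule tlift_tens'[where sz = "tscale kscale"])
    (intro lin_intros comm_alg.alg_lin[OF comm_alg_kscale] lin_tgen)+

text \<open>In the basis of H, the matrix of \<phi> has the entries t of
  \<open>rcoef e k\<close>.\<close>

lemma lookup_phi:
  "Poly_Mapping.lookup (phi H u) e = (\<Sum>k\<in>Poly_Mapping.keys u. Poly_Mapping.lookup u k * tgen H (rcoef e k))"
proof -
  have "Poly_Mapping.lookup (sw2 H h (\<lambda>h1 h2. TK (b * tgen H h1) h2)) e = b * tgen H (rcoef e h)" for b h
    by (simp add: sw2_lin[OF lin_lookup[OF vs_kscale]] lookup_tens vsH vs_kscale rcoef_def
        sw2_lin[OF lin_tgen] lin_scale[OF lin_tgen])
      (simp add: sw2_def tlift_def sum_distrib_left comm_alg.mult_sr[OF comm_alg_kscale])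
  then show ?thesis
    by (simp add: phi_def tlift_def lookup_sum)
qed

text \<open>An element of the kernel has finite support \<open>?F\<close> in the basis, and the
  square block of the matrix of \<phi> on \<open>?F\<close> is invertible.\<close>

lemma phi_inj: "inj_on (phi H) (tens_space H UNIV)"
proof (rule inj_onI)
  fix u v assume uv: "u \<in> tens_space H UNIV" "v \<in> tens_space H UNIV" "phi H u = phi H v"
  let ?w = "u - v" and ?F = "Poly_Mapping.keys (u - v)"
  have "?F \<subseteq> Poly_Mapping.keys u \<union> Poly_Mapping.keys v"
    by (auto simp: in_keys_iff lookup_minus)
  then have sub: "?F \<subseteq> basis H"
    using uv by (auto simp: tens_space_def)
  \<comment> \<open>The transpose of the block is inverted, since the coefficients of
    \<open>?w\<close> enter as a row vector.\<close>
  obtain N where N: "\<And>i j. i \<in> ?F \<Longrightarrow> j \<in> ?F \<Longrightarrow> (\<Sum>k\<in>?F. emb (tvar (rcoef k i)) * N k j) = (if i = j then 1 else 0)"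
  proof (rule inverse_matrix[of ?F "\<lambda>i j. tvar (rcoef j i)" "counit H"])
    show "peval (counit H) (tvar (rcoef j i)) = (if i = j then 1 else 0)" if "i \<in> ?F" "j \<in> ?F" for i j
      using that sub by (auto simp: peval_tvar counit_rcoef coord_basis vsH)
  qed (auto simp: tvar_in)
  have 0: "(\<Sum>k\<in>?F. Poly_Mapping.lookup ?w k * tgen H (rcoef e k)) = 0" for e
    using uv(3) lookup_phi[of ?w e] by (simp add: lin_diff[OF lin_phi])
  have "Poly_Mapping.lookup ?w j = 0" if j: "j \<in> ?F" for j
  proof -
    have "0 = (\<Sum>e\<in>?F. (\<Sum>k\<in>?F. Poly_Mapping.lookup ?w k * tgen H (rcoef e k)) * N e j)"
      by (simp only: 0) simp
    also have "\<dots> = (\<Sum>k\<in>?F. Poly_Mapping.lookup ?w k * (\<Sum>e\<in>?F. emb (tvar (rcoef e k)) * N e j))"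
      by (simp only: sum_distrib_left sum_distrib_right tgen_eq, subst sum.swap) (simp add: ac_simps)
    also have "\<dots> = (\<Sum>k\<in>?F. if k = j then Poly_Mapping.lookup ?w k else 0)"
      using j N by (intro sum.cong) auto
    finally show ?thesis using j by simp
  qed
  then have "?w = 0" by (metis in_keys_iff poly_mapping_eqI lookup_zero)
  then show "u = v" by simp
qed

text \<open>Let \<open>g\<close> be a linear left inverse of \<phi>, let \<open>\<Omega>\<close> be
  id \<otimes> \<epsilon>, and let f(h) be the value of \<open>\<Omega>\<close> at \<open>g\<close>
  of 1 \<otimes> h. By linearity over the field, \<Sum> t(h1) f(h2) is the value of
  \<open>\<Omega>\<close> at \<open>g\<close> of \<phi>(1 \<otimes> h), which is
  \<epsilon>(h).\<close>

lemma ex_right_inverse: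
  obtains f where "lin hs kscale f" "\<And>h. sw2 H h (\<lambda>a b. tgen H a * f b) = kscale (counit H h) 1"
proof -
  let ?W = "tens_space H (UNIV :: ('h, 'k) big_field set)"
  interpret V: vector_space "mulK :: _ \<Rightarrow> ('h \<Rightarrow>\<^sub>0 ('h, 'k) big_field) \<Rightarrow> _"
    by (intro vector_space_tscale vector_space_field)
  interpret VV: vector_space_pair "mulK :: _ \<Rightarrow> ('h \<Rightarrow>\<^sub>0 ('h, 'k) big_field) \<Rightarrow> _"
      "mulK :: _ \<Rightarrow> ('h \<Rightarrow>\<^sub>0 ('h, 'k) big_field) \<Rightarrow> _" by unfold_locales
  have "V.subspace ?W"
    by (rule V.subspaceI) (auto simp: tens_space_def tscale_pmmap dest!: subsetD[OF Poly_Mapping.keys_add] subsetD[OF keys_pmmap])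
  then have span: "V.span ?W = ?W" by simp
  obtain g where g: "lin mulK mulK g" "\<And>u. u \<in> ?W \<Longrightarrow> g (phi H u) = u"
    using VV.linear_inj_on_left_inverse[OF lin_phi, of ?W] phi_inj span by auto
  define \<Omega> :: "('h \<Rightarrow>\<^sub>0 ('h, 'k) big_field) \<Rightarrow> _" where "\<Omega> = tlift (\<lambda>b e. kscale (counit H e) b)"
  have "lin mulK (*) \<Omega>" unfolding \<Omega>_def
    by (rule lin_tlift) (auto intro!: linI vector_space_field simp: kscale_emb algebra_simps)
  then have l: "lin mulK (*) (\<lambda>u. \<Omega> (g u))" by (rule lin_comp[OF _ g(1)])
  note K = comm_alg.alg_lin[OF comm_alg_kscale]
  have \<Omega>: "\<Omega> (TK b h) = kscale (counit H h) b" for b h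
    unfolding \<Omega>_def by (rule tlift_tens'[where sz = kscale]; intro K lin_intros)
  have in_W: "TK b h \<in> ?W" for b h by (rule tens_in) (auto simp: vs_kscale)
  have T: "TK b h = mulK b (TK 1 h)" for b h
    using lin_scale[OF lin_TK, of b 1 h] by simp
  define f where "f h = \<Omega> (g (TK 1 h))" for h
  have "lin hs kscale f"
  proof (rule linI)
    show "f (x + y) = f x + f y" for x y
      by (simp add: f_def lin_add[OF l] lin_add[OF lin_tens(1)[OF vs_kscale]])
    have "TK 1 (hs c x) = TK (kscale c 1) x" for c x
      by (simp add: lin_scale[OF lin_tens(1)[OF vs_kscale]] lin_scale[OF lin_tens(2)[OF vs_kscale]])
    then show "f (hs c x) = kscale c (f x)" for c x
      using T[of "kscale c 1" x] by (simp add: f_def lin_scale[OF l] kscale_emb)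
  qed (fact vsH vs_kscale)+
  moreover have "sw2 H h (\<lambda>a b. tgen H a * f b) = kscale (counit H h) 1" for h
  proof -
    have "sw2 H h (\<lambda>a b. tgen H a * f b) = sw2 H h (\<lambda>a b. \<Omega> (g (TK (tgen H a) b)))"
      by (rule sw2_cong) (simp add: f_def T[of "tgen H _"] lin_scale[OF l])
    also have "\<dots> = \<Omega> (g (phi H (TK 1 h)))"
      by (simp add: phi_TK sw2_lin[OF l])
    finally show ?thesis by (simp add: g(2) in_W \<Omega>)
  qed
  ultimately show ?thesis using that by blast
qed

lemma is_tinv_tinv: "is_tinv H (tinv H)"
proof -
  obtain f where f: "lin hs kscale f" "\<And>h. sw2 H h (\<lambda>a b. tgen H a * f b) = kscale (counit H h) 1"
    by (rule ex_right_inverse) blast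
  note K = comm_alg.alg_lin[OF comm_alg_kscale]
  let ?f = "\<lambda>h. sw2 H h (\<lambda>h1 h2. f h1 * tgen H h2)" and ?e = "\<lambda>h. kscale (counit H h) 1"
  \<comment> \<open>A right convolution inverse is also a left one: t * (f * t) = (t * f) * t = t =
    t * \<epsilon>, and t cancels on the left.\<close>
  have "?f = ?e"
  proof (rule tgen_conv_inj)
    show "lin hs kscale ?f" by (intro lin_intros K f)
    show "lin hs kscale ?e" by (intro lin_intros K)
    fix h
    have "sw2 H h (\<lambda>a b. tgen H a * ?f b) = sw2 H h (\<lambda>a z. sw2 H z (\<lambda>b c. tgen H a * f b * tgen H c))"
      by (simp add: sw2_def tlift_def sum_distrib_left mult.assoc)
    also have "\<dots> = sw2 H h (\<lambda>y c. sw2 H y (\<lambda>a b. tgen H a * f b * tgen H c))"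
      by (rule sw2_coassoc[where s = kscale, symmetric]; intro K f lin_tgen)
    also have "\<dots> = sw2 H h (\<lambda>y c. sw2 H y (\<lambda>a b. tgen H a * f b) * tgen H c)"
      by (simp add: sw2_def tlift_def sum_distrib_right)
    also have "\<dots> = tgen H h"
      using sw2_counit_left[OF lin_tgen, of h] by (simp add: f kscale_emb)
    also have "\<dots> = sw2 H h (\<lambda>a b. tgen H a * ?e b)"
      using sw2_counit_right[OF lin_tgen, of h] by (simp add: kscale_emb mult.commute)
    finally show "sw2 H h (\<lambda>a b. tgen H a * ?f b) = sw2 H h (\<lambda>a b. tgen H a * ?e b)" .
  qed
  then have f3: "?f h = ?e h" for h by metis
  \<comment> \<open>The construction places \<open>f\<close> only in the ambient field. The
    inversion formula expresses its values through matrix entries in K_H and values of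
    \<epsilon>.\<close>
  have f4: "f h \<in> sym_field H" for h
  proof (rule tgen_conv_inverse[OF f(1), of h])
    fix N assume "\<And>i j. i \<in> lfin h \<Longrightarrow> j \<in> lfin h \<Longrightarrow> N i j \<in> sym_field H"
    then show ?thesis if "f h = (\<Sum>i\<in>lfin h. kscale (counit H i) (\<Sum>k\<in>lfin h. N i k * sw2 H (lcoef k h) (\<lambda>a b. tgen H a * f b)))"
      unfolding that f(2) by (intro sym_field_sum sym_field_kscale sym_field_mult) (auto simp: sym_field_emb[OF polys_in_1, simplified])
  qed
  have *: "is_tinv H f" using f f3 f4 by (simp add: is_tinv_def)
  show ?thesis unfolding tinv_def
  proof (rule theI[of _ f])
    show "g = f" if "is_tinv H g" for g
      using that f by (intro tgen_conv_inj) (auto simp: is_tinv_def)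
  qed fact
qed

lemma lin_tinv: "lin hs kscale (tinv H)"
  and tgen_tinv: "sw2 H h (\<lambda>h1 h2. tgen H h1 * tinv H h2) = kscale (counit H h) 1"
  and tinv_tgen: "sw2 H h (\<lambda>h1 h2. tinv H h1 * tgen H h2) = kscale (counit H h) 1"
  using is_tinv_tinv by (auto simp: is_tinv_def)

end


section \<open>The universal cocycle\<close>

lemma (in hopf) lin_fun_K: "lin kscale kscale ((*) (c :: ('h, 'k) big_field))"
  by (rule comm_alg.lin_alg2[OF comm_alg_kscale lin_id[OF vs_kscale]])

section \<open>The convolution inverse of \<alpha> and values at 1\<close>

locale invertible_cocycle = hopf_cocycle H \<alpha>
  for H :: "('k::field, 'h::ring_1) hopf_data" and \<alpha> +
  assumes invertible: "convolution_invertible H (*) \<alpha>"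
begin

text \<open>The usual chain c = (b * \<alpha>) * c = b * (\<alpha> * c) = b in the convolution
  algebra of H \<otimes> H. It justifies the definite description in
  \<open>cocycle_inv\<close>.\<close>

lemma convolution_inverse_unique:
  assumes b: "convolution_inverse H (*) \<alpha> b" and c: "convolution_inverse H (*) \<alpha> c"
  shows "b = c"
proof (intro ext)
  fix x y
  have lb: "lin su hs f \<Longrightarrow> lin su (*) (\<lambda>x. b (f x) y)" "lin su hs f \<Longrightarrow> lin su (*) (\<lambda>x. b y (f x))" for su and f :: "'h \<Rightarrow> 'h" and y
    using b unfolding convolution_inverse_def bilinear_map_def by (auto intro: lin_comp[where f = f])
  have lc: "lin su hs f \<Longrightarrow> lin su (*) (\<lambda>x. c (f x) y)" "lin su hs f \<Longrightarrow> lin su (*) (\<lambda>x. c y (f x))" for su and f :: "'h \<Rightarrow> 'h" and y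
    using c unfolding convolution_inverse_def bilinear_map_def by (auto intro: lin_comp[where f = f])
  note lins = lin_intros comm_alg.alg_lin[OF comm_alg_field] lin_alpha1 lin_alpha2 lb lc
  have ac: "sw2 H x (\<lambda>x1 x2. sw2 H y (\<lambda>y1 y2. \<alpha> x1 y1 * c x2 y2)) = counit H x * counit H y" for x y
    using c by (simp add: convolution_inverse_def)
  have dist: "sw2 H x f * k = sw2 H x (\<lambda>a b. f a b * k)" "k * sw2 H x f = sw2 H x (\<lambda>a b. k * f a b)" for x f and k :: 'k
    by (simp_all add: sw2_def tlift_def sum_distrib_left sum_distrib_right)
  have "c x y = sw2 H x (\<lambda>x' x3. sw2 H y (\<lambda>y' y3. counit H x' * counit H y' * c x3 y3))"
  proof -
    have "sw2 H y (\<lambda>y' y3. counit H x' * counit H y' * c x3 y3) = counit H x' * c x3 y" for x' x3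
      using sw2_counit_left[of "(*)" "\<lambda>y. c x3 y" y] by (simp add: dist(2)[symmetric] mult.assoc lins)
    then show ?thesis
      using sw2_counit_left[of "(*)" "\<lambda>x. c x y" x] by (simp add: lins)
  qed
  also have "\<dots> = sw2 H x (\<lambda>x' x3. sw2 H y (\<lambda>y' y3. sw2 H x' (\<lambda>x1 x2. sw2 H y' (\<lambda>y1 y2. b x1 y1 * \<alpha> x2 y2 * c x3 y3))))"
    using b by (simp add: convolution_inverse_def dist[symmetric])
  also have "\<dots> = sw2 H x (\<lambda>x1 x'. sw2 H y (\<lambda>y1 y'. sw2 H x' (\<lambda>x2 x3. sw2 H y' (\<lambda>y2 y3. b x1 y1 * \<alpha> x2 y2 * c x3 y3))))"
    by (rule sw2_coassoc2[where s = "(*)"]; intro lins)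
  also have "\<dots> = sw2 H x (\<lambda>x1 x'. sw2 H y (\<lambda>y1 y'. b x1 y1 * (counit H x' * counit H y')))"
    by (simp only: mult.assoc dist(2)[symmetric] ac)
  also have "\<dots> = sw2 H x (\<lambda>x1 x'. sw2 H y (\<lambda>y1 y'. counit H x' * counit H y' * b x1 y1))"
    by (simp only: ac_simps)
  also have "\<dots> = b x y"
  proof -
    have "sw2 H y (\<lambda>y1 y'. counit H x' * counit H y' * b x1 y1) = counit H x' * b x1 y" for x' x1
      using sw2_counit_right[of "(*)" "\<lambda>y. b x1 y" y] by (simp add: dist(2)[symmetric] mult.assoc lins)
    then show ?thesis
      using sw2_counit_right[of "(*)" "\<lambda>x. b x y" x] by (simp add: lins)
  qed
  finally show "b x y = c x y" by simp
qed

lemma convolution_inverse_cocycle_inv: "convolution_inverse H (*) \<alpha> (cocycle_inv H \<alpha>)"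
  using invertible unfolding convolution_invertible_def cocycle_inv_def
  by (metis convolution_inverse_unique the_equality)

lemma lin_cocycle_inv1: "lin su hs f \<Longrightarrow> lin su (*) (\<lambda>x. cocycle_inv H \<alpha> (f x) y)"
  and lin_cocycle_inv2: "lin su hs f \<Longrightarrow> lin su (*) (\<lambda>x. cocycle_inv H \<alpha> y (f x))"
  using convolution_inverse_cocycle_inv unfolding convolution_inverse_def bilinear_map_def
  by (auto intro: lin_comp[where f = f])

lemmas lin_tgen_comp = lin_comp[OF lin_tgen]
lemmas lin_tinv_comp = lin_comp[OF lin_tinv]
lemmas K_lin = lin_intros comm_alg.alg_lin[OF comm_alg_kscale] lin_alpha1 lin_alpha2 lin_cocycle_inv1 lin_cocycle_inv2
  lin_tgen_comp lin_tinv_comp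

lemma cocycle_inv_1: "cocycle_inv H \<alpha> 1 1 = 1"
proof -
  have "sw2 H 1 (\<lambda>x1 x2. sw2 H 1 (\<lambda>y1 y2. \<alpha> x1 y1 * cocycle_inv H \<alpha> x2 y2)) = 1"
    using convolution_inverse_cocycle_inv by (simp add: convolution_inverse_def)
  moreover have "sw2 H 1 (\<lambda>x1 x2. sw2 H 1 (\<lambda>y1 y2. \<alpha> x1 y1 * cocycle_inv H \<alpha> x2 y2)) =
      sw2 H 1 (\<lambda>y1 y2. \<alpha> 1 y1 * cocycle_inv H \<alpha> 1 y2)"
    by (rule sw2_1[where s = "(*)"]; intro K_lin comm_alg.alg_lin[OF comm_alg_field])
  moreover have "\<dots> = \<alpha> 1 1 * cocycle_inv H \<alpha> 1 1"
    by (rule sw2_1[where s = "(*)"]; intro K_lin comm_alg.alg_lin[OF comm_alg_field])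
  ultimately show ?thesis by simp
qed

lemma tgen_tinv_1: "tgen H 1 * tinv H 1 = 1"
proof -
  have "sw2 H 1 (\<lambda>h1 h2. tgen H h1 * tinv H h2) = tgen H 1 * tinv H 1"
    by (rule sw2_1[where s = kscale]; intro K_lin lin_tgen lin_tinv)
  then show ?thesis by (simp add: tgen_tinv comm_alg.sr_1[OF comm_alg_kscale])
qed

lemma sw3_1:
  assumes "\<And>b c. lin hs s (\<lambda>a. f a b c)" "\<And>a c. lin hs s (\<lambda>b. f a b c)" "\<And>a b. lin hs s (\<lambda>c. f a b c)"
  shows "sw3 H 1 f = f 1 1 1"
proof -
  note vs = lin_target[OF assms(1)]
  have "sw3 H 1 f = sw2 H 1 (\<lambda>x1 x2. f x1 x2 1)"
    unfolding sw3_def by (rule sw2_1[where s = s]; intro lin_sw2 lin_sw2_param vsH vs assms)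
  also have "\<dots> = f 1 1 1" by (rule sw2_1[where s = s]; intro assms)
  finally show ?thesis .
qed

lemma lin_sw3_param: "vector_space su \<Longrightarrow> vector_space sz \<Longrightarrow> (\<And>u v e. lin su sz (\<lambda>x. f x u v e)) \<Longrightarrow> lin su sz (\<lambda>x. sw3 H y (f x))"
  unfolding sw3_def by (intro lin_sw2_param)

text \<open>Since 1 is grouplike, all Sweedler sums collapse to one term. Together with the value of
  \<open>sigma_inv\<close> at 1 this puts \<open>tgen H 1\<close> and \<open>tinv H 1\<close> into
  B.\<close>

lemma sigma_1: "sigma H \<alpha> 1 1 = tgen H 1"
proof -
  have "sigma H \<alpha> 1 1 = sw3 H 1 (\<lambda>y1 y2 y3. kscale (\<alpha> 1 y2) (tgen H 1 * tgen H y1 * tinv H (1 * y3)))"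
    unfolding sigma_def by (rule sw3_1[where s = kscale]; intro lin_sw3_param K_lin)
  also have "\<dots> = kscale (\<alpha> 1 1) (tgen H 1 * tgen H 1 * tinv H (1 * 1))"
    by (rule sw3_1[where s = kscale]; intro K_lin)
  finally show ?thesis by (simp add: comm_alg.sr_1[OF comm_alg_kscale] mult.assoc tgen_tinv_1)
qed

lemma sigma_inv_1: "sigma_inv H \<alpha> 1 1 = tinv H 1"
proof -
  have "sigma_inv H \<alpha> 1 1 = sw3 H 1 (\<lambda>y1 y2 y3. kscale (cocycle_inv H \<alpha> 1 y2) (tgen H (1 * y1) * tinv H 1 * tinv H y3))"
    unfolding sigma_inv_def by (rule sw3_1[where s = kscale]; intro lin_sw3_param K_lin)
  also have "\<dots> = kscale (cocycle_inv H \<alpha> 1 1) (tgen H (1 * 1) * tinv H 1 * tinv H 1)"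
    by (rule sw3_1[where s = kscale]; intro K_lin)
  finally show ?thesis by (simp add: comm_alg.sr_1[OF comm_alg_kscale] cocycle_inv_1 tgen_tinv_1)
qed

sublocale K: twisted H \<alpha> "kscale :: 'k \<Rightarrow> ('h, 'k) big_field \<Rightarrow> _"
  by (intro twisted.intro comm_alg_kscale) unfold_locales

text \<open>The convolution product of (x, y) \<mapsto> t(x) t(y) with \<alpha>. Convolving it with
  (x, y) \<mapsto> \<open>tinv H (x * y)\<close> gives \<sigma>.\<close>

definition tau :: "'h \<Rightarrow> 'h \<Rightarrow> ('h, 'k) big_field" where
  "tau x y = sw2 H x (\<lambda>x1 x2. sw2 H y (\<lambda>y1 y2. kscale (\<alpha> x2 y2) (tgen H x1 * tgen H y1)))"

lemma lin_tau: "lin hs kscale (\<lambda>x. tau x y)" "lin hs kscale (tau x)"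
  unfolding tau_def by (intro K_lin)+

lemmas lin_tau1 = lin_comp[OF lin_tau(1)]
lemmas lin_tau2 = lin_comp[OF lin_tau(2)]

lemma sw2_K_dist: "sw2 H x f * k = sw2 H x (\<lambda>a b. f a b * k)" "k * sw2 H x f = sw2 H x (\<lambda>a b. k * f a b)"
  for k :: "('h, 'k) big_field"
  by (simp_all add: sw2_def tlift_def sum_distrib_left sum_distrib_right)

lemma sigma_tau: "sigma H \<alpha> x y = sw2 H x (\<lambda>x1 x2. sw2 H y (\<lambda>y1 y2. tau x1 y1 * tinv H (x2 * y2)))"
proof -
  have "sigma H \<alpha> x y = sw2 H x (\<lambda>x' x3. sw2 H y (\<lambda>y' y3. sw2 H x' (\<lambda>x1 x2. sw2 H y' (\<lambda>y1 y2.
      kscale (\<alpha> x2 y2) (tgen H x1 * tgen H y1 * tinv H (x3 * y3))))))"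
    unfolding sigma_def sw3_def by (rule sw2_cong, rule sw2_swap)
  then show ?thesis
    by (simp only: tau_def sw2_K_dist comm_alg.sr_mult[OF comm_alg_kscale])
qed

lemma lin_sigma: "lin hs kscale (\<lambda>x. sigma H \<alpha> x y)" "lin hs kscale (sigma H \<alpha> x)"
  unfolding sigma_tau by (intro K_lin lin_tau1 lin_tau2)+

lemmas lin_sigma1 = lin_comp[OF lin_sigma(1)]
lemmas lin_sigma2 = lin_comp[OF lin_sigma(2)]

text \<open>The factor \<open>tinv\<close> in \<sigma> is cancelled by convolving with t on
  products, because \<Delta> is multiplicative and \<open>tinv\<close> is a convolution inverse of
  t.\<close>

lemma sigma_tgen:
  "sw2 H x (\<lambda>x1 x2. sw2 H y (\<lambda>y1 y2. sigma H \<alpha> x1 y1 * tgen H (x2 * y2))) = tau x y"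
proof -
  have "sw2 H x (\<lambda>x1 x2. sw2 H y (\<lambda>y1 y2. sigma H \<alpha> x1 y1 * tgen H (x2 * y2))) =
    sw2 H x (\<lambda>x' x3. sw2 H y (\<lambda>y' y3. sw2 H x' (\<lambda>x1 x2. sw2 H y' (\<lambda>y1 y2.
      tau x1 y1 * tinv H (x2 * y2) * tgen H (x3 * y3)))))"
    by (simp only: sigma_tau sw2_K_dist)
  also have "\<dots> = sw2 H x (\<lambda>x1 x'. sw2 H y (\<lambda>y1 y'. sw2 H x' (\<lambda>x2 x3. sw2 H y' (\<lambda>y2 y3.
      tau x1 y1 * tinv H (x2 * y2) * tgen H (x3 * y3)))))"
    by (rule sw2_coassoc2[where s = kscale]; intro K_lin lin_tau1 lin_tau2)
  also have "\<dots> = sw2 H x (\<lambda>x1 x'. sw2 H y (\<lambda>y1 y'. kscale (counit H x') (kscale (counit H y') (tau x1 y1))))"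
  proof (rule sw2_cong, rule sw2_cong)
    fix x1 x' y1 y'
    have "sw2 H (x' * y') (\<lambda>a b. tinv H a * tgen H b) =
        sw2 H x' (\<lambda>x2 x3. sw2 H y' (\<lambda>y2 y3. tinv H (x2 * y2) * tgen H (x3 * y3)))"
      by (rule sw2_mult[where s = kscale]; intro K_lin lin_tgen lin_tinv)
    note eq = this
    show "sw2 H x' (\<lambda>x2 x3. sw2 H y' (\<lambda>y2 y3. tau x1 y1 * tinv H (x2 * y2) * tgen H (x3 * y3))) =
        kscale (counit H x') (kscale (counit H y') (tau x1 y1))"
      by (simp only: mult.assoc flip: sw2_K_dist(2))
        (simp add: tinv_tgen counit_mult K.mult_sr K.sr_sr flip: eq)
  qed
  also have "\<dots> = tau x y"
  proof -
    have "sw2 H y (\<lambda>y1 y'. kscale (counit H x') (kscale (counit H y') (tau x1 y1))) = kscale (counit H x') (tau x1 y)" for x' x1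
      using sw2_counit_right[of kscale "\<lambda>y. tau x1 y" y]
      by (simp add: sw2_lin[OF lin_scaleI[OF lin_id[OF vs_kscale]], symmetric] lin_tau2[OF lin_id[OF vsH]])
    then show ?thesis
      using sw2_counit_right[of kscale "\<lambda>x. tau x y" x] by (simp add: lin_tau1[OF lin_id[OF vsH]])
  qed
  finally show ?thesis .
qed

section \<open>Multiplicativity of \<phi> on the elements 1 \<otimes> h\<close>

abbreviation tg where "tg \<equiv> gen kscale (tgen H)"

lemma phi_TK_gen: "phi H (TK b h) = mulK b (tg h)"
  by (simp add: phi_TK gen_def sw2_lin[OF lin_id[OF vector_space_tscale[OF vector_space_field], THEN lin_scaleI]]
    lin_scale[OF lin_TK, symmetric])

text \<open>The Sweedler sum on the right is the product of 1 \<otimes> x and 1 \<otimes> y in the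
  algebra twisted by \<sigma>, and \<open>tg x\<close> is \<phi>(1 \<otimes> x). The passage from
  \<alpha> to \<sigma> is the identity \<open>sigma_tgen\<close>.\<close>

lemma gen_mult_gen:
  "tmult kscale (tg x) (tg y) = phi H (sw2 H x (\<lambda>x1 x2. sw2 H y (\<lambda>y1 y2. TK (sigma H \<alpha> x1 y1) (x2 * y2))))"
proof -
  note lins = K_lin lin_tau1 lin_tau2 lin_sigma1 lin_sigma2
  have "tmult kscale (tg x) (tg y) = sw2 H x (\<lambda>x1 x'. sw2 H y (\<lambda>y1 y'. sw2 H x' (\<lambda>x2 x3. sw2 H y' (\<lambda>y2 y3.
      TK (kscale (\<alpha> x2 y2) (tgen H x1 * tgen H y1)) (x3 * y3)))))"
    by (simp only: gen_def[of kscale "tgen H" x] sw2_lin[OF K.lin_tmult_left])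
      (simp only: gen_def sw2_lin[OF K.lin_tmult_right] K.T_mult)
  also have "\<dots> = sw2 H x (\<lambda>x' x3. sw2 H y (\<lambda>y' y3. sw2 H x' (\<lambda>x1 x2. sw2 H y' (\<lambda>y1 y2.
      TK (kscale (\<alpha> x2 y2) (tgen H x1 * tgen H y1)) (x3 * y3)))))"
    by (rule sw2_coassoc2[where s = "tscale kscale", symmetric]; intro lins)
  also have "\<dots> = sw2 H x (\<lambda>x' x3. sw2 H y (\<lambda>y' y3. TK (tau x' y') (x3 * y3)))"
    by (simp only: tau_def sw2_lin[OF lin_tens(2)[OF vs_kscale]])
  also have "\<dots> = sw2 H x (\<lambda>x' x3. sw2 H y (\<lambda>y' y3. sw2 H x' (\<lambda>x1 x2. sw2 H y' (\<lambda>y1 y2.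
      TK (sigma H \<alpha> x1 y1 * tgen H (x2 * y2)) (x3 * y3)))))"
    by (simp only: sigma_tgen[symmetric] sw2_lin[OF lin_tens(2)[OF vs_kscale]])
  also have "\<dots> = sw2 H x (\<lambda>x1 x'. sw2 H y (\<lambda>y1 y'. sw2 H x' (\<lambda>x2 x3. sw2 H y' (\<lambda>y2 y3.
      TK (sigma H \<alpha> x1 y1 * tgen H (x2 * y2)) (x3 * y3)))))"
    by (rule sw2_coassoc2[where s = "tscale kscale"]; intro lins)
  also have "\<dots> = sw2 H x (\<lambda>x1 x'. sw2 H y (\<lambda>y1 y'. phi H (TK (sigma H \<alpha> x1 y1) (x' * y'))))"
    unfolding phi_TK
    by (rule sw2_cong, rule sw2_cong, rule sw2_mult[where s = "tscale kscale", symmetric]; intro lins)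
  also have "\<dots> = phi H (sw2 H x (\<lambda>x1 x2. sw2 H y (\<lambda>y1 y2. TK (sigma H \<alpha> x1 y1) (x2 * y2))))"
    by (simp only: sw2_lin[OF lin_phi])
  finally show ?thesis .
qed

end


section \<open>Central elements\<close>

lemma subalgebra_gen_0: "0 \<in> subalgebra_gen kscale G" for G :: "('h, 'k::field) big_field set"
  using subalgebra_gen.scale[OF subalgebra_gen.one, of kscale 0 G] by (simp add: kscale_emb)

lemma subalgebra_gen_sum:
  fixes G :: "('h, 'k::field) big_field set"
  shows "(\<And>a. a \<in> A \<Longrightarrow> f a \<in> subalgebra_gen kscale G) \<Longrightarrow> sum f A \<in> subalgebra_gen kscale G"
proof (induction A rule: infinite_finite_induct)
  case (insert x A)
  then show ?case by (simp add: subalgebra_gen.add)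
qed (simp_all add: subalgebra_gen_0)

lemma subalgebra_gen_sw2:
  fixes G :: "('h, 'k::field) big_field set"
  shows "(\<And>a b. f a b \<in> subalgebra_gen kscale G) \<Longrightarrow> sw2 H x f \<in> subalgebra_gen kscale G"
  unfolding sw2_def tlift_def by (rule subalgebra_gen_sum)

lemma subalgebra_gen_mono:
  assumes "G \<subseteq> subalgebra_gen s G'" "x \<in> subalgebra_gen s G"
  shows "x \<in> subalgebra_gen s G'"
  using assms(2) by induction (use assms(1) in \<open>auto intro: subalgebra_gen.intros\<close>)

text \<open>The coordinate at v in a basis that contains v.\<close>

lemma exists_functional:
  assumes "vector_space s" "v \<noteq> 0"
  obtains l :: "'r::ab_group_add \<Rightarrow> 'k::field" where "lin s (*) l" "l v \<noteq> 0"
proof -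
  interpret vector_space s by fact
  have ind: "independent {v}" using assms(2) by (simp add: dependent_single)
  let ?B = "extend_basis {v}"
  have B: "independent ?B" "span ?B = UNIV" "v \<in> ?B"
    using independent_extend_basis[OF ind] span_extend_basis[OF ind] extend_basis_superset[OF ind] by auto
  show ?thesis
  proof
    show "lin s (*) (\<lambda>x. representation ?B x v)"
      by (rule linI) (use B in \<open>auto simp: vector_space_axioms vector_space_field representation_add representation_scale\<close>)
    show "representation ?B v v \<noteq> 0" using B by (simp add: representation_basis)
  qed
qed

lemma pmmap_ident: "pmmap (\<lambda>x. x) u = u"
  by (rule poly_mapping_eqI) (simp add: lookup_pmmap)

context hopf
begin

lemma tens_space_sum_closed:
  fixes V :: "'r::ab_group_add set"
  assumes "0 \<in> V" "\<And>x y. x \<in> V \<Longrightarrow> y \<in> V \<Longrightarrow> x + y \<in> V"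
  shows "(\<And>a. a \<in> A \<Longrightarrow> f a \<in> tens_space H V) \<Longrightarrow> sum f A \<in> tens_space H V"
proof (induction A rule: infinite_finite_induct)
  case (insert x A)
  then have "f x \<in> tens_space H V" "sum f A \<in> tens_space H V" by auto
  then show ?case using insert.hyps assms Poly_Mapping.keys_add[of "f x" "sum f A"]
    by (auto simp: tens_space_def lookup_add)
qed (auto simp: tens_space_def assms)

end

section \<open>Generic images lie in \<phi>(B \<otimes> H)\<close>

context invertible_cocycle
begin

abbreviation "B \<equiv> B_alg H \<alpha>"

lemma B_0: "0 \<in> B"
  unfolding B_alg_def by (rule subalgebra_gen_0)

lemma B_closed: "a \<in> B \<Longrightarrow> b \<in> B \<Longrightarrow> a + b \<in> B" "a \<in> B \<Longrightarrow> b \<in> B \<Longrightarrow> a * b \<in> B" "a \<in> B \<Longrightarrow> kscale c a \<in> B"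
  unfolding B_alg_def by (auto intro: subalgebra_gen.intros)

lemma sigma_B: "sigma H \<alpha> x y \<in> B"
  unfolding B_alg_def by (rule subalgebra_gen.gen) blast

lemma tgen_1_B: "tgen H 1 \<in> B" and tinv_1_B: "tinv H 1 \<in> B"
  using sigma_B[of 1 1] subalgebra_gen.gen[of "sigma_inv H \<alpha> 1 1" _ kscale]
  by (auto simp: sigma_1 sigma_inv_1[symmetric] B_alg_def intro!: subalgebra_gen.gen)

text \<open>Ensures that preimages in B \<otimes> H lie in the domain on which
  \<open>mu_sigma\<close> inverts \<phi>.\<close>

lemma B_sym_theta: "B \<subseteq> sym_theta H"
proof -
  have gens: "tgen H h \<in> sym_theta H" "tinv H h \<in> sym_theta H" for h
    by (auto simp: sym_theta_def intro: subalgebra_gen.gen)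
  have "sigma H \<alpha> x y \<in> sym_theta H" "sigma_inv H \<alpha> x y \<in> sym_theta H" for x y
    unfolding sigma_def sigma_inv_def sw3_def sym_theta_def
    by (intro subalgebra_gen_sw2 subalgebra_gen.scale subalgebra_gen.mult gens[unfolded sym_theta_def])+
  then have "{sigma H \<alpha> x y | x y. True} \<union> {sigma_inv H \<alpha> x y | x y. True} \<subseteq> sym_theta H"
    by blast
  then show ?thesis
    unfolding B_alg_def sym_theta_def using subalgebra_gen_mono by blast
qed

lemma TK_B: "b \<in> B \<Longrightarrow> TK b h \<in> tens_space H B"
  by (rule tens_in) (auto simp: vs_kscale B_closed)

lemma tens_space_B_sum: "(\<And>a. a \<in> A \<Longrightarrow> f a \<in> tens_space H B) \<Longrightarrow> sum f A \<in> tens_space H B"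
  by (rule tens_space_sum_closed) (auto simp: B_0 B_closed)

lemma mulK_B: "b \<in> B \<Longrightarrow> u \<in> tens_space H B \<Longrightarrow> mulK b u \<in> tens_space H B"
  using keys_pmmap[of "(*) b" u]
  by (auto simp: tens_space_def tscale_pmmap lookup_pmmap B_closed)

lemma tscale_B: "u \<in> tens_space H B \<Longrightarrow> tscale kscale c u \<in> tens_space H B"
  using keys_pmmap[of "kscale c" u]
  by (auto simp: tens_space_def lookup_tscale vs_kscale B_closed) (auto simp: tscale_pmmap)

lemma tens_space_UNIV: "u \<in> tens_space H V \<Longrightarrow> u \<in> tens_space H UNIV"
  by (auto simp: tens_space_def)

lemma lin_phi_k: "lin (tscale kscale) (tscale kscale) (phi H)"
proof -
  have "tscale kscale c u = mulK (kscale c 1) u" for c and u :: "'h \<Rightarrow>\<^sub>0 ('h, 'k) big_field"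
    by (rule poly_mapping_eqI) (simp add: lookup_tscale vs_kscale vector_space_field kscale_emb)
  then show ?thesis
    using lin_phi by (intro linI) (auto simp: lin_add lin_scale K.vs_tscale)
qed

lemma mulK_tmult_right:
  assumes "p \<in> tens_space H UNIV" "q \<in> tens_space H UNIV"
  shows "tmult kscale p (mulK c q) = mulK c (tmult kscale p q)"
  unfolding tscale_pmmap
  using pmmap_tmult[OF comm_alg_kscale comm_alg_kscale lin_fun_K[of c] lin_id[OF vs_kscale] lin_fun_K[of c] _ assms]
  by (simp add: pmmap_ident)

text \<open>By \<open>gen_mult_gen\<close> the only new coefficients that arise are values of
  \<sigma>, so \<phi>(B \<otimes> H) is stable under left multiplication by generators.\<close>

lemma gen_mult_phi:
  assumes "v \<in> tens_space H B"
  shows "tmult kscale (tg e) (phi H v) \<in> phi H ` tens_space H B"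
proof -
  let ?s = "\<lambda>k. sw2 H e (\<lambda>x1 x2. sw2 H k (\<lambda>y1 y2. TK (sigma H \<alpha> x1 y1) (x2 * y2)))"
  have s: "?s k \<in> tens_space H B" for k
    unfolding sw2_def tlift_def by (intro tens_space_B_sum TK_B sigma_B)
  have "phi H v = (\<Sum>k\<in>Poly_Mapping.keys v. mulK (Poly_Mapping.lookup v k) (tg k))"
    by (subst tens_expand[OF vsH vs_kscale tens_space_UNIV[OF assms]])
      (simp add: lin_sum[OF lin_phi] phi_TK_gen)
  then have "tmult kscale (tg e) (phi H v) = phi H (\<Sum>k\<in>Poly_Mapping.keys v. mulK (Poly_Mapping.lookup v k) (?s k))"
    by (simp add: lin_sum[OF K.lin_tmult_right] mulK_tmult_right K.gen_in gen_mult_gen lin_sum[OF lin_phi] lin_scale[OF lin_phi])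
  moreover have "(\<Sum>k\<in>Poly_Mapping.keys v. mulK (Poly_Mapping.lookup v k) (?s k)) \<in> tens_space H B"
    using assms by (intro tens_space_B_sum mulK_B s) (auto simp: tens_space_def)
  ultimately show ?thesis by (rule image_eqI)
qed

text \<open>For b = 1 the preimage is the unit of the algebra twisted by \<sigma>; the general case
  differs by a scalar of the field.\<close>

lemma phi_tinv_1: "phi H (TK (b * tinv H 1) 1) = TK b 1"
proof -
  have "phi H (TK (b * tinv H 1) 1) = TK (b * tinv H 1 * tgen H 1) 1"
    unfolding phi_TK by (rule sw2_1[where s = "tscale kscale"]; intro K_lin)
  moreover have "b * tinv H 1 * tgen H 1 = b"
    using tgen_tinv_1 by (simp add: mult.assoc mult.commute[of "tinv H 1"])
  ultimately show ?thesis by simp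
qed

lemma word_phi: "word kscale (tgen H) w \<in> phi H ` tens_space H B"
proof (induction w)
  case Nil
  show ?case using phi_tinv_1[of 1] TK_B[OF tinv_1_B] by (auto simp: K.word_Nil intro!: image_eqI[OF sym])
next
  case (Cons e w)
  then show ?case using gen_mult_phi by (auto simp: K.word_Cons)
qed

lemma generic_hom_phi: "generic_hom H \<alpha> P \<in> phi H ` tens_space H B"
proof -
  have "\<forall>w. \<exists>v. v \<in> tens_space H B \<and> word kscale (tgen H) w = phi H v"
    using word_phi by (auto simp: image_iff)
  then obtain v where v: "\<And>w. v w \<in> tens_space H B" "\<And>w. word kscale (tgen H) w = phi H (v w)"
    by metis
  have "generic_hom H \<alpha> P = phi H (\<Sum>w\<in>Poly_Mapping.keys P. tscale kscale (Poly_Mapping.lookup P w) (v (letters w)))"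
    by (simp add: generic_hom_eq talg_def v lin_sum[OF lin_phi_k] lin_scale[OF lin_phi_k])
  moreover have "(\<Sum>w\<in>Poly_Mapping.keys P. tscale kscale (Poly_Mapping.lookup P w) (v (letters w))) \<in> tens_space H B"
    by (intro tens_space_B_sum tscale_B v)
  ultimately show ?thesis by (rule image_eqI)
qed

section \<open>Elements commuting with the generic generators\<close>

lemma coord_1: obtains e where "coord H 1 e \<noteq> 0"
proof -
  have "\<exists>e. coord H 1 e \<noteq> 0"
  proof (rule ccontr)
    assume "\<nexists>e. coord H 1 e \<noteq> 0"
    then have "csupp H 1 = {}" by (auto simp: csupp_def)
    then show False using coord_expand[OF vsH, of 1] by simp
  qed
  then show ?thesis using that by blast
qed

lemma TK_1_B:
  assumes "TK b 1 \<in> tens_space H B"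
  shows "b \<in> B"
proof -
  obtain e where e: "coord H 1 e \<noteq> 0" by (rule coord_1)
  have "kscale (coord H 1 e) b \<in> B"
    using assms by (auto simp: tens_space_def lookup_tens vsH vs_kscale dest: spec[of _ e])
  then have "kscale (inverse (coord H 1 e)) (kscale (coord H 1 e) b) \<in> B"
    by (rule B_closed)
  then show ?thesis using e by (simp add: K.sr_sr K.sr_1)
qed

text \<open>Nondegeneracy is a statement over k, while the coefficients of u lie in the big field. A
  k-linear functional applied to the coefficients yields a central element over k, hence a multiple
  of 1; as functionals separate points, the coefficients of u are proportional to the coordinates of
  1.\<close>

lemma central_element:
  assumes nd: "nondegenerate H \<alpha>" and u: "u \<in> tens_space H UNIV"
    and comm: "\<And>e. e \<in> basis H \<Longrightarrow> tmult kscale u (tg e) = tmult kscale (tg e) u"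
  obtains b where "u = TK b 1"
proof -
  interpret F: twisted H \<alpha> "(*) :: 'k \<Rightarrow> 'k \<Rightarrow> 'k"
    by (intro twisted.intro comm_alg_field) unfold_locales
  have comm_gen: "tmult kscale u (tg h) = tmult kscale (tg h) u" for h
    by (rule lin_eq_on_basis[where s = "tscale kscale"])
      (intro K.lin_tmult2 K.lin_tmult1 K.lin_gen lin_tgen comm)+
  \<comment> \<open>\<open>tinv\<close> cancels the factor t in \<open>tg\<close>, so 1 \<otimes> h
    is a combination of generators over the field. Since products are linear over the field in both
    factors, u commutes with 1 \<otimes> h.\<close>
  have TK_1: "TK 1 h = sw2 H h (\<lambda>a b. mulK (tinv H a) (tg b))" for h
  proof -
    have "sw2 H h (\<lambda>a b. mulK (tinv H a) (tg b)) = sw2 H h (\<lambda>a b. sw2 H b (\<lambda>b c. TK (tinv H a * tgen H b) c))"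
      by (simp add: phi_TK_gen[symmetric] phi_TK)
    also have "\<dots> = sw2 H h (\<lambda>y c. sw2 H y (\<lambda>a b. TK (tinv H a * tgen H b) c))"
      by (rule sw2_coassoc[where s = "tscale kscale", symmetric]; intro K_lin lin_tgen lin_tinv)
    also have "\<dots> = sw2 H h (\<lambda>y c. tscale kscale (counit H y) (TK 1 c))"
      by (simp add: sw2_lin[OF lin_tens(2)[OF vs_kscale], symmetric] tinv_tgen K.T_scale)
    also have "\<dots> = TK 1 h"
      by (rule sw2_counit_left[OF lin_tens(1)[OF vs_kscale]])
    finally show ?thesis by simp
  qed
  have mulK_left: "tmult kscale (mulK c p) q = mulK c (tmult kscale p q)"
    if "p \<in> tens_space H UNIV" "q \<in> tens_space H UNIV" for c p q
    unfolding tscale_pmmap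
    using pmmap_tmult[OF comm_alg_kscale comm_alg_kscale lin_fun_K[of c] lin_fun_K[of c] lin_id[OF vs_kscale] _ that]
    by (simp add: pmmap_ident)
  have comm_T: "tmult kscale u (TK 1 h) = tmult kscale (TK 1 h) u" for h
    by (simp add: TK_1 sw2_lin[OF K.lin_tmult_left] sw2_lin[OF K.lin_tmult_right] mulK_left mulK_tmult_right
        u K.gen_in comm_gen)
  obtain e0 where e0: "coord H 1 e0 \<noteq> 0" by (rule coord_1)
  \<comment> \<open>Proportionality is stated in cross-multiplied form: any violation is detected by
    a functional \<open>l\<close>.\<close>
  have proportional: "kscale (coord H 1 e0) (Poly_Mapping.lookup u e) = kscale (coord H 1 e) (Poly_Mapping.lookup u e0)" for e
  proof (rule ccontr)
    assume "\<not> ?thesis"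
    then have "kscale (coord H 1 e0) (Poly_Mapping.lookup u e) - kscale (coord H 1 e) (Poly_Mapping.lookup u e0) \<noteq> 0"
      by simp
    from exists_functional[OF vs_kscale this] obtain l :: "('h, 'k) big_field \<Rightarrow> 'k" where l: "lin kscale (*) l"
      "l (kscale (coord H 1 e0) (Poly_Mapping.lookup u e) - kscale (coord H 1 e) (Poly_Mapping.lookup u e0)) \<noteq> 0"
      by blast
    note L = lin_pmmap[OF l(1)]
    \<comment> \<open>\<open>l\<close> need not be multiplicative, but it passes through a product
      with 1 \<otimes> h, since the coefficients of \<open>v\<close> are multiplied there by scalars
      from k only.\<close>
    have R: "pmmap l (tmult kscale v (TK 1 h)) = tmult (*) (pmmap l v) (F.T 1 h)"
      if "v \<in> tens_space H UNIV" for v h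
      using that vs_kscale
      by (induction rule: tens_space_induct)
        (simp_all add: K.tmult_add F.tmult_add lin_add[OF L] pmmap_tens[OF l(1)] K.T_mult F.T_mult sw2_lin[OF L] lin_scale[OF l(1)])
    have Lf: "pmmap l (tmult kscale (TK 1 h) v) = tmult (*) (F.T 1 h) (pmmap l v)"
      if "v \<in> tens_space H UNIV" for v h
      using that vs_kscale
      by (induction rule: tens_space_induct)
        (simp_all add: K.tmult_add F.tmult_add lin_add[OF L] pmmap_tens[OF l(1)] K.T_mult F.T_mult sw2_lin[OF L] lin_scale[OF l(1)])
    have c1: "tmult (*) (pmmap l u) (F.T 1 h) = tmult (*) (F.T 1 h) (pmmap l u)" for h
      using R[OF u] Lf[OF u] comm_T by metis
    have c2: "tmult (*) (pmmap l u) v = tmult (*) v (pmmap l u)" if "v \<in> tens_space H UNIV" for v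
      using that vector_space_field
    proof (induction rule: tens_space_induct)
      case (tens b e)
      have "F.T b e = tscale (*) b (F.T 1 e)" using F.T_scale[of b 1 e] by simp
      then show ?case by (simp add: F.tmult_scale c1)
    qed (simp add: F.tmult_add)
    have eq: "(\<lambda>x y. \<alpha> x y * 1) = \<alpha>" by simp
    note sel = F.twisted_algebra_sel[where R = UNIV and u = 1, unfolded eq, folded twisted_H_def]
    have "pmmap l u \<in> ring_center (twisted_H H \<alpha>)"
      using c2 by (simp add: ring_center_def sel pmmap_in u)
    then obtain c where c: "pmmap l u = tscale (*) c (F.T 1 1)"
      using nd by (auto simp: nondegenerate_def sel)
    \<comment> \<open>The constant \<open>c\<close> is the same for all basis elements, so
      \<open>l\<close> kills the cross-multiplied difference.\<close>
    have "l (Poly_Mapping.lookup u e) = c * coord H 1 e" for e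
      using arg_cong[OF c, of "\<lambda>p. Poly_Mapping.lookup p e"]
      by (simp add: lookup_pmmap lin_0[OF l(1)] lookup_tscale vector_space_field lookup_tens vsH)
    then show False
      using l(2) by (simp add: lin_diff[OF l(1)] lin_scale[OF l(1)])
  qed
  define b where "b = kscale (inverse (coord H 1 e0)) (Poly_Mapping.lookup u e0)"
  have "Poly_Mapping.lookup u e = kscale (coord H 1 e) b" for e
  proof -
    have "Poly_Mapping.lookup u e = kscale (inverse (coord H 1 e0)) (kscale (coord H 1 e0) (Poly_Mapping.lookup u e))"
      using e0 by (simp add: K.sr_sr K.sr_1)
    then show ?thesis unfolding proportional by (simp add: b_def K.sr_sr mult.commute)
  qed
  then have "u = TK b 1"
    by (intro poly_mapping_eqI) (simp add: lookup_tens vsH vs_kscale)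
  then show ?thesis by (rule that)
qed

section \<open>Passage to the quotient by the identities\<close>

lemma generic_hom_add: "generic_hom H \<alpha> (P + Q) = generic_hom H \<alpha> P + generic_hom H \<alpha> Q"
  and generic_hom_mult: "generic_hom H \<alpha> (P * Q) = tmult kscale (generic_hom H \<alpha> P) (generic_hom H \<alpha> Q)"
  by (simp_all add: generic_hom_eq K.talg_add K.talg_mult)

text \<open>Guarantees that every element belongs to its own coset.\<close>

lemma zero_identity: "0 \<in> identities_ideal H \<alpha>"
proof -
  have "f 0 = 0" if "f \<in> Ring.ring_hom (tensor_alg H) (twisted_H H \<alpha>)" for f
  proof -
    have "f (0 \<oplus>\<^bsub>tensor_alg H\<^esub> 0) = f 0 \<oplus>\<^bsub>twisted_H H \<alpha>\<^esub> f 0"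
      using that by (intro ring_hom_add) (auto simp: tensor_alg_def)
    then show ?thesis by (simp add: tensor_alg_def twisted_H_def twisted_algebra_def)
  qed
  then show ?thesis by (auto simp: identities_ideal_def comodule_algebra_hom_def tensor_alg_def)
qed

lemma generic_hom_coset:
  assumes "infinite (UNIV :: 'k set)" "x \<in> identities_ideal H \<alpha> +>\<^bsub>tensor_alg H\<^esub> z"
  shows "generic_hom H \<alpha> x = generic_hom H \<alpha> z"
  using assms generic_hom_identities[OF assms(1)]
  by (auto simp: a_r_coset_def' generic_hom_add tensor_alg_def)

text \<open>One \<open>b\<close> serves both maps: centrality gives the value b \<otimes> 1 of
  \<open>mu_alpha\<close>, its preimage under \<phi> is \<open>b * tinv H 1\<close> \<otimes> 1, and
  the coefficient of that preimage is in B because generic images lie in \<phi>(B \<otimes>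
  H).\<close>

lemma mu_alpha_center:
  assumes inf: "infinite (UNIV :: 'k set)" and nd: "nondegenerate H \<alpha>"
    and Z: "Z \<in> ring_center (U_alg H \<alpha>)"
  obtains b where "b \<in> B" "mu_alpha H \<alpha> Z = TK b 1" "mu_sigma H \<alpha> Z = TK (b * tinv H 1) 1"
proof -
  let ?I = "identities_ideal H \<alpha>" and ?T = "tensor_alg H" and ?G = "generic_hom H \<alpha>"
  obtain z where z: "z \<in> carrier ?T" "Z = ?I +>\<^bsub>?T\<^esub> z"
    using Z by (auto simp: ring_center_def U_alg_def FactRing_def A_RCOSETS_def')
  have self: "x \<in> ?I +>\<^bsub>?T\<^esub> x" for x
    using zero_identity by (auto simp: a_r_coset_def' tensor_alg_def intro!: bexI[of _ 0])
  have "?G ` Z = {?G z}"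
    using self[of z] generic_hom_coset[OF inf] z(2) by blast
  then have mu: "mu_alpha H \<alpha> Z = ?G z"
    by (simp add: mu_alpha_def)
  have G_in: "?G z \<in> tens_space H UNIV"
    by (simp add: generic_hom_eq K.talg_in)
  have comm: "tmult kscale (?G z) (tg e) = tmult kscale (tg e) (?G z)" if e: "e \<in> basis H" for e
  proof -
    let ?x = "Poly_Mapping.single (Letters [e]) 1 :: ('h, 'k) free_alg"
    let ?X = "?I +>\<^bsub>?T\<^esub> ?x"
    have "?x \<in> carrier ?T" using e by (simp add: tensor_alg_def)
    then have "?X \<in> carrier (U_alg H \<alpha>)"
      by (auto simp: U_alg_def FactRing_def A_RCOSETS_def')
    then have "Z \<otimes>\<^bsub>U_alg H \<alpha>\<^esub> ?X = ?X \<otimes>\<^bsub>U_alg H \<alpha>\<^esub> Z"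
      using Z by (auto simp: ring_center_def)
    \<comment> \<open>A product in the quotient is a union of cosets over all representatives. Its
      equality with the opposite product yields some representatives a, b with z x in the coset of a
      b; the generic morphism does not depend on their choice.\<close>
    then have eq: "(\<Union>a\<in>Z. \<Union>b\<in>?X. ?I +>\<^bsub>?T\<^esub> (a * b)) = (\<Union>a\<in>?X. \<Union>b\<in>Z. ?I +>\<^bsub>?T\<^esub> (a * b))"
      by (simp add: U_alg_def FactRing_def rcoset_mult_def tensor_alg_def)
    have "z * ?x \<in> (\<Union>a\<in>Z. \<Union>b\<in>?X. ?I +>\<^bsub>?T\<^esub> (a * b))"
      using self z(2) by blast
    then obtain a b where ab: "a \<in> ?X" "b \<in> Z" "z * ?x \<in> ?I +>\<^bsub>?T\<^esub> (a * b)"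
      unfolding eq by blast
    have "?G (z * ?x) = ?G (a * b)" by (rule generic_hom_coset[OF inf ab(3)])
    moreover have "?G a = ?G ?x" "?G b = ?G z"
      using generic_hom_coset[OF inf] ab(1,2) z(2) by auto
    ultimately show ?thesis
      by (simp add: generic_hom_mult) (simp add: generic_hom_eq K.talg_letter)
  qed
  obtain b where b: "?G z = TK b 1"
    using central_element[OF nd G_in comm] by blast
  obtain v where v: "v \<in> tens_space H B" "?G z = phi H v"
    using generic_hom_phi[of z] by blast
  \<comment> \<open>Injectivity of \<phi> identifies two preimages of the generic image of z: one
    with coefficients in B, the other explicit.\<close>
  have "phi H v = phi H (TK (b * tinv H 1) 1)"
    using v b by (simp add: phi_tinv_1)
  then have v_eq: "v = TK (b * tinv H 1) 1"
    using phi_inj v(1) K.T_in by (meson inj_onD tens_space_UNIV)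
  then have "b * tinv H 1 \<in> B" using v(1) TK_1_B by blast
  then have "b * tinv H 1 * tgen H 1 \<in> B" using tgen_1_B by (rule B_closed)
  then have "b \<in> B" using tgen_tinv_1 by (simp add: mult.assoc mult.commute[of "tinv H 1"])
  moreover have "mu_sigma H \<alpha> Z = TK (b * tinv H 1) 1"
  proof -
    have "v \<in> tens_space H (sym_theta H)" using v(1) B_sym_theta by (auto simp: tens_space_def)
    moreover have "inj_on (phi H) (tens_space H (sym_theta H))"
      using phi_inj by (rule inj_on_subset) (auto simp: tens_space_UNIV)
    ultimately show ?thesis
      unfolding mu_sigma_def mu v(2) v_eq[symmetric]
      by (simp add: sigma_algebra_def twisted_algebra_def)
  qed
  ultimately show ?thesis using that mu b by auto
qed

end

theorem proposition9p1:
  fixes H :: "('k::field, 'h::ring_1) hopf_data" and \<alpha> :: "'h \<Rightarrow> 'h \<Rightarrow> 'k"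
  assumes "infinite (UNIV :: 'k set)"
    and "hopf_algebra H"
    and "two_cocycle H (*) \<alpha>"
    and "normalized_cocycle H (*) \<alpha>"
    and "convolution_invertible H (*) \<alpha>"
    and "nondegenerate H \<alpha>"
  shows "mu_alpha H \<alpha> ` ring_center (U_alg H \<alpha>) \<subseteq> {tens H kscale b 1 | b. b \<in> B_alg H \<alpha>} \<and>
    mu_sigma H \<alpha> ` ring_center (U_alg H \<alpha>) \<subseteq> {tens H kscale b 1 | b. b \<in> B_alg H \<alpha>}"
proof -
  interpret invertible_cocycle H \<alpha>
    by unfold_locales (fact assms)+
  \<comment> \<open>For \<open>mu_sigma\<close> the required element of B is
    \<open>b * tinv H 1\<close>.\<close>
  have "mu_alpha H \<alpha> Z \<in> {tens H kscale b 1 | b. b \<in> B_alg H \<alpha>} \<and>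
      mu_sigma H \<alpha> Z \<in> {tens H kscale b 1 | b. b \<in> B_alg H \<alpha>}"
    if "Z \<in> ring_center (U_alg H \<alpha>)" for Z
    by (rule mu_alpha_center[OF assms(1,6) that]) (use B_closed(2)[OF _ tinv_1_B] in blast)
  then show ?thesis by blast
qed

end
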